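(* Let $\mathcal{INC}$ be the class of incomparability graphs. A graph limit belongs to $\widehat{\mathcal{INC}}^{\max}$ if and only if it is represented by the graphon $W^2_a$ for some $a\in[0,1]$.
   Context: The incomparability graph of a partial order $<$ on $[n]$ is the graph on $[n]$ in which $x\sim y$ iff neither $x<y$ nor $y<x$; $\mathcal{INC}$ is the class of (graphs isomorphic to) such graphs. A graphon is a measurable symmetric function $W:[0,1]^2\to[0,1]$; every graphon represents a graph limit (limit of a convergent graph sequence in the sense of Lovász–Szegedy), and every graph limit is represented by some graphon. The entropy of a graphon is $\int_0^1\int_0^1 h(W(x,y))\,dx\,dy$ with $h(x)=-x\log_2x-(1-x)\log_2(1-x)$. For a graph class $\mathcal{P}$, $\widehat{\mathcal{P}}$ is the set of graph limits of sequences $G_n\in\mathcal{P}$ with $|V(G_n)|\to\infty$, and $\widehat{\mathcal{P}}^{\max}$ is the set of elements of $\widehat{\mathcal{P}}$ of maximal entropy. For $k\ge1$, let $I_i=[(i-1)/k,i/k)$. For $a\in[0,1]$, $W^k_a$ is the graphon equal to $1/2$ on $\bigcup_{i\ne j}I_i\times I_j$, $1$ on $I_i\times I_i$ for $2\le i\le k$, and on $I_1\times I_1$ equal to $1$ on $[0,a/k)^2\cup[a/k,1/k)^2$ and $0$ elsewhere in $I_1\times I_1$. *)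

theory Defs
  imports "HOL-Analysis.Analysis" "Graph_Theory.Pair_Digraph" "Graph_Theory.Digraph_Isomorphism"
begin

text \<open>
  Finite simple graphs are the digraphs \<open>G\<close> with \<open>pair_graph G\<close>: finitely many vertices, no loops,
  and a symmetric arc set, each edge \<open>uv\<close> being present as the two arcs \<open>(u, v)\<close> and \<open>(v, u)\<close>.
  Every finite graph is isomorphic to one with vertices in \<^typ>\<open>nat\<close>, and homomorphism densities only
  depend on isomorphism classes, so graphs (and graph classes) are taken on this vertex type.
\<close>

definition incomparability_graph :: "nat \<Rightarrow> (nat \<times> nat) set \<Rightarrow> nat pair_pre_digraph" where
  "incomparability_graph n r =
     \<lparr> pverts = {1..n},
       parcs = {(x, y). x \<in> {1..n} \<and> y \<in> {1..n} \<and> x \<noteq> y \<and> (x, y) \<notin> r \<and> (y, x) \<notin> r} \<rparr>"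

definition INC :: "nat pair_pre_digraph set" where
  "INC = {G. pair_graph G \<and>
             (\<exists>n r. irrefl_on {1..n} r \<and> trans_on {1..n} r \<and>
                    digraph_iso (with_proj (incomparability_graph n r)) (with_proj G))}"

definition unit_leb :: "real measure" where
  "unit_leb = restrict_space lborel {0..1}"

text \<open>
  Only the values on the unit square matter.
\<close>

definition graphon :: "(real \<Rightarrow> real \<Rightarrow> real) \<Rightarrow> bool" where
  "graphon W \<longleftrightarrow>
     (\<lambda>(x, y). W x y) \<in> borel_measurable (unit_leb \<Otimes>\<^sub>M unit_leb) \<and>
     (\<forall>x\<in>{0..1}. \<forall>y\<in>{0..1}. 0 \<le> W x y \<and> W x y \<le> 1 \<and> W x y = W y x)"

definition hom_density :: "nat pair_pre_digraph \<Rightarrow> nat pair_pre_digraph \<Rightarrow> real" where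
  "hom_density F G =
     real (card {f \<in> pverts F \<rightarrow>\<^sub>E pverts G. \<forall>(u, v)\<in>parcs F. (f u, f v) \<in> parcs G})
       / real (card (pverts G)) ^ card (pverts F)"

text \<open>
  The product ranges over the edges of \<open>F\<close>, each represented by its arc \<open>(u, v)\<close> with \<open>u < v\<close>, so
  that no edge is counted twice.
\<close>

definition graphon_density :: "nat pair_pre_digraph \<Rightarrow> (real \<Rightarrow> real \<Rightarrow> real) \<Rightarrow> real" where
  "graphon_density F W =
     (\<integral>x. (\<Prod>(u, v)\<in>{(u, v). (u, v) \<in> parcs F \<and> u < v}. W (x u) (x v))
        \<partial>(PiM (pverts F) (\<lambda>_. unit_leb)))"

text \<open>
  A graph limit is identified with the family of its homomorphism densities \<open>F \<mapsto> t(F, \<Gamma>)\<close>.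
  Its values at arguments that are not graphs carry no information and are left unconstrained.
\<close>

type_synonym graph_limit = "nat pair_pre_digraph \<Rightarrow> real"

definition converges_to :: "(nat \<Rightarrow> nat pair_pre_digraph) \<Rightarrow> graph_limit \<Rightarrow> bool" where
  "converges_to G \<Gamma> \<longleftrightarrow> (\<forall>F. pair_graph F \<longrightarrow> (\<lambda>n. hom_density F (G n)) \<longlonglongrightarrow> \<Gamma> F)"

definition class_limits :: "nat pair_pre_digraph set \<Rightarrow> graph_limit set" where
  "class_limits P =
     {\<Gamma>. \<exists>G. (\<forall>n. G n \<in> P) \<and> filterlim (\<lambda>n. card (pverts (G n))) at_top sequentially \<and>
             converges_to G \<Gamma>}"

definition graph_limits :: "graph_limit set" where
  "graph_limits = class_limits {G. pair_graph G}"

definition represents :: "(real \<Rightarrow> real \<Rightarrow> real) \<Rightarrow> graph_limit \<Rightarrow> bool" where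
  "represents W \<Gamma> \<longleftrightarrow> graphon W \<and> (\<forall>F. pair_graph F \<longrightarrow> \<Gamma> F = graphon_density F W)"

text \<open>
  In \<^const>\<open>log\<close> the logarithm of \<open>0\<close> is \<open>0\<close>, which gives the usual values \<open>h 0 = h 1 = 0\<close>.
\<close>

definition binary_entropy :: "real \<Rightarrow> real" where
  "binary_entropy p = - p * log 2 p - (1 - p) * log 2 (1 - p)"

definition graphon_entropy :: "(real \<Rightarrow> real \<Rightarrow> real) \<Rightarrow> real" where
  "graphon_entropy W = (\<integral>x. (\<integral>y. binary_entropy (W x y) \<partial>unit_leb) \<partial>unit_leb)"

text \<open>
  The entropy of a graph limit is the entropy of a graphon representing it.
\<close>

definition has_entropy :: "graph_limit \<Rightarrow> real \<Rightarrow> bool" where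
  "has_entropy \<Gamma> e \<longleftrightarrow> (\<exists>W. represents W \<Gamma> \<and> graphon_entropy W = e)"

definition max_entropy_limits :: "nat pair_pre_digraph set \<Rightarrow> graph_limit set" where
  "max_entropy_limits P =
     {\<Gamma> \<in> class_limits P.
        \<exists>e. has_entropy \<Gamma> e \<and> (\<forall>\<Gamma>'\<in>class_limits P. \<forall>e'. has_entropy \<Gamma>' e' \<longrightarrow> e' \<le> e)}"

definition part :: "nat \<Rightarrow> nat \<Rightarrow> real set" where
  "part k i = {(real i - 1) / real k ..< real i / real k}"

text \<open>
  The parts cover \<open>[0, 1)\<close>; on the null set of points with a coordinate equal to \<open>1\<close> the value is \<open>0\<close>.
\<close>

definition W_graphon :: "nat \<Rightarrow> real \<Rightarrow> real \<Rightarrow> real \<Rightarrow> real" where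
  "W_graphon k a x y =
     (if \<exists>i\<in>{1..k}. \<exists>j\<in>{1..k}. i \<noteq> j \<and> x \<in> part k i \<and> y \<in> part k j then 1/2
      else if \<exists>i\<in>{2..k}. x \<in> part k i \<and> y \<in> part k i then 1
      else if (x, y) \<in> {0..<a / real k} \<times> {0..<a / real k} \<union>
                        {a / real k..<1 / real k} \<times> {a / real k..<1 / real k} then 1
      else 0)"

end

theory Submission
  imports Defs "HOL-Probability.Probability"
begin

text \<open>
  Let \<open>W\<close> represent a limit of incomparability graphs. A graph that is not an incomparability graph
  has vanishing induced density in \<open>W\<close>, and three such graphs suffice: the 5-cycle, the 6-cycle and
  the net (a triangle with three pendant edges). Cloning vertices, they exclude a positive density of
  triangles in the set \<open>E = {0 < W < 1}\<close> of random pairs. By Mantel's theorem for measurable graphs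
  \<open>E\<close> has measure at most \<open>1/2\<close>, and so the entropy is at most \<open>1/2\<close>; in case of equality \<open>E\<close> is complete
  bipartite with two halves as sides, and \<open>W = 1/2\<close> on \<open>E\<close>. The same three graphs then force \<open>W\<close> to be
  \<open>1\<close> on one of the two sides and a union of at most two cliques on the other one.
  Conversely, three-layered Kleitman--Rothschild orders, with a universal family of subsets in the
  middle layer in place of randomness, converge to the step graphon.
\<close>

section \<open>Almost everywhere statements on product spaces\<close>

text \<open>The obstacle to cloning is that the forbidden patterns bind \<open>W\<close> only up to
  null sets: a single bad triangle contradicts nothing, and its clones have to be drawn from
  non-null sets so that all conditions hold for them jointly. Inside a class of clones the values of
  \<open>W\<close> are unknown, while a pair in \<open>E\<close> can be read as an edge or as a
  non-edge, so any pattern can be drawn across classes. The three graphs are matched to the possible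
  behaviours inside the classes, and classes of 3, 3 and 1 clones already leave no way out. The
  three graphs fail to be incomparability graphs for one reason: a vertex comparable to both ends of
  an edge lies above both or below both. This turns certain vertices into sources or sinks of the
  order, which cannot be placed along an odd cycle of comparabilities. A limit is a family of
  densities, and the densities of a step graphon depend only on the measures of its steps and on its
  values. Comparing these replaces a measure-preserving rearrangement of \<open>W\<close> into
  standard form.\<close>

lemma prob_space_unit_leb: "prob_space unit_leb"
  unfolding unit_leb_def
  by (rule prob_spaceI) (simp add: emeasure_restrict_space space_restrict_space)

lemma space_unit_leb [simp]: "space unit_leb = {0..1}"
  by (simp add: unit_leb_def space_restrict_space)

text \<open>Reading off coordinates along an injection maps one product measure onto the other, so
  an almost sure property of a sample on \<open>V\<close> can be placed at any distinct indices of a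
  larger sample.\<close>

lemma AE_PiM_reindex:
  assumes "prob_space M" "inj_on s V" "s ` V \<subseteq> I"
    and "AE y in PiM V (\<lambda>_. M). P y"
  shows "AE x in PiM I (\<lambda>_. M). P (\<lambda>v\<in>V. x (s v))"
proof -
  have "distr (PiM I (\<lambda>_. M)) (PiM V (\<lambda>_. M)) (\<lambda>x. \<lambda>v\<in>V. x (s v)) = PiM V (\<lambda>_. M)"
    using distr_PiM_reindex[of I "\<lambda>_. M" s V] assms by auto
  moreover have "(\<lambda>x. \<lambda>v\<in>V. x (s v)) \<in> PiM I (\<lambda>_. M) \<rightarrow>\<^sub>M PiM V (\<lambda>_. M)"
    using assms(3) by (intro measurable_restrict measurable_component_singleton) auto
  ultimately show ?thesis
    using assms(4) AE_distrD by metis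
qed

lemma AE_PiM_insert:
  assumes "prob_space M" "AE f in PiM (insert i I) (\<lambda>_. M). P f"
  shows "AE x in M. AE f in PiM I (\<lambda>_. M). P (f(i := x))"
proof -
  interpret M: prob_space M by fact
  interpret I: prob_space "PiM I (\<lambda>_. M)" by (intro prob_space_PiM assms)
  interpret pair_sigma_finite M "PiM I (\<lambda>_. M)" ..
  have eq: "distr (M \<Otimes>\<^sub>M PiM I (\<lambda>_. M)) (PiM (insert i I) (\<lambda>_. M)) (\<lambda>(x, f). f(i := x)) = PiM (insert i I) (\<lambda>_. M)"
    using distr_pair_PiM_eq_PiM[of I "\<lambda>_. M" i] assms(1) by simp
  have m: "(\<lambda>(x, f). f(i := x)) \<in> M \<Otimes>\<^sub>M PiM I (\<lambda>_. M) \<rightarrow>\<^sub>M PiM (insert i I) (\<lambda>_. M)"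
    unfolding case_prod_beta by measurable
  have "AE z in M \<Otimes>\<^sub>M PiM I (\<lambda>_. M). P ((\<lambda>(x, f). f(i := x)) z)"
    using AE_distrD[OF m, of P] assms(2) unfolding eq .
  from AE_pair[OF this] show ?thesis by simp
qed

lemma AE_PiM_empty:
  assumes "AE f in PiM {} M. P f" shows "P (\<lambda>_. undefined)"
proof -
  have "AE f in count_space {\<lambda>_. undefined}. P f"
    using assms unfolding PiM_empty .
  then show ?thesis by (simp add: AE_count_space)
qed

lemma AE_PiM_pair:
  assumes "prob_space M" "u \<in> V" "v \<in> V" "u \<noteq> v"
    and "AE z in M \<Otimes>\<^sub>M M. P (fst z) (snd z)"
  shows "AE x in PiM V (\<lambda>_. M). P (x u) (x v)"
proof -
  interpret M: prob_space M by fact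
  \<comment> \<open>The binary product is read as a product indexed by \<open>bool\<close>, so that
    placing the pair at \<open>u\<close> and \<open>v\<close> becomes a reindexing.\<close>
  have *: "M \<Otimes>\<^sub>M M = distr (PiM UNIV (\<lambda>_::bool. M)) (M \<Otimes>\<^sub>M M) (\<lambda>x. (x True, x False))"
    using pair_measure_eq_distr_PiM[OF M.sigma_finite_measure_axioms M.sigma_finite_measure_axioms] 
    by (simp add: case_bool_if)
  have m: "(\<lambda>x. (x True, x False)) \<in> PiM UNIV (\<lambda>_::bool. M) \<rightarrow>\<^sub>M M \<Otimes>\<^sub>M M"
    by measurable
  have "AE x in PiM UNIV (\<lambda>_::bool. M). P (fst (x True, x False)) (snd (x True, x False))"
    by (rule AE_distrD[OF m]) (use assms(5) * in metis)
  then have "AE x in PiM UNIV (\<lambda>_::bool. M). P (x True) (x False)"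
    by simp
  moreover have "inj_on (\<lambda>b. if b then u else v) UNIV" "(\<lambda>b. if b then u else v) ` UNIV \<subseteq> V"
    using assms by (auto simp: inj_on_def)
  ultimately have "AE x in PiM V (\<lambda>_. M). P ((\<lambda>b\<in>UNIV. x (if b then u else v)) True) ((\<lambda>b\<in>UNIV. x (if b then u else v)) False)"
    by (intro AE_PiM_reindex[OF assms(1)])
  then show ?thesis by simp
qed

text \<open>The coordinate \<open>n - 1\<close> is outermost. Unlike a statement about the product
  measure, this form lets points be picked one after the other from non-null sets, each choice
  keeping the remaining conditions almost sure. The start is the only element of the empty
  product.\<close>

primrec AEs :: "'a measure \<Rightarrow> nat \<Rightarrow> ((nat \<Rightarrow> 'a) \<Rightarrow> bool) \<Rightarrow> bool" where
  "AEs M 0 P = P (\<lambda>_. undefined)"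
| "AEs M (Suc n) P = (AE x in M. AEs M n (\<lambda>f. P (f(n := x))))"

lemma AEs_numeral:
  "AEs M (numeral k) P = (AE x in M. AEs M (pred_numeral k) (\<lambda>f. P (f(pred_numeral k := x))))"
  by (simp add: numeral_eq_Suc)

lemma AE_PiM_imp_AEs:
  assumes "prob_space M" "AE f in PiM {..<n} (\<lambda>_. M). P f"
  shows "AEs M n P"
  using assms(2)
proof (induction n arbitrary: P)
  case 0
  then have "AE f in PiM {} (\<lambda>_. M). P f" by (simp only: lessThan_0)
  from AE_PiM_empty[OF this] show ?case by simp
next
  case (Suc n)
  have "AE x in M. AE f in PiM {..<n} (\<lambda>_. M). P (f(n := x))"
    by (rule AE_PiM_insert[OF assms(1)]) (use Suc.prems in \<open>simp only: lessThan_Suc\<close>)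
  then show ?case
    using Suc.IH by (auto elim!: eventually_mono)
qed

section \<open>Patterns in graph limits\<close>

definition pattern_graph :: "nat set \<Rightarrow> (nat \<times> nat) set \<Rightarrow> nat pair_pre_digraph" where
  "pattern_graph V P = \<lparr>pverts = V, parcs = P \<union> P\<inverse>\<rparr>"

definition vertex_pairs :: "nat set \<Rightarrow> (nat \<times> nat) set" where
  "vertex_pairs V = {(u, v). u \<in> V \<and> v \<in> V \<and> u < v}"

text \<open>Maps may identify vertices, and in a loopless graph an identified pair counts as a
  non-edge. Forbidden patterns therefore have to be excluded for all maps, not only for induced
  copies.\<close>

definition pattern_maps ::
  "nat set \<Rightarrow> (nat \<times> nat) set \<Rightarrow> (nat \<times> nat) set \<Rightarrow> nat pair_pre_digraph \<Rightarrow> (nat \<Rightarrow> nat) set" where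
  "pattern_maps V P N G =
     {f \<in> V \<rightarrow>\<^sub>E pverts G. (\<forall>(u, v)\<in>P. (f u, f v) \<in> parcs G) \<and> (\<forall>(u, v)\<in>N. (f u, f v) \<notin> parcs G)}"

text \<open>For disjoint \<open>P\<close> and \<open>N\<close>, the probability, given the positions
  \<open>x\<close>, that a \<open>W\<close>-random graph has all edges of \<open>P\<close> and none
  of \<open>N\<close>.\<close>

definition pattern_weight ::
  "(nat \<times> nat) set \<Rightarrow> (nat \<times> nat) set \<Rightarrow> (real \<Rightarrow> real \<Rightarrow> real) \<Rightarrow> (nat \<Rightarrow> real) \<Rightarrow> real" where
  "pattern_weight P N W x = (\<Prod>(u, v)\<in>P. W (x u) (x v)) * (\<Prod>(u, v)\<in>N. 1 - W (x u) (x v))"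

lemma finite_vertex_pairs: "finite V \<Longrightarrow> finite (vertex_pairs V)"
  by (rule finite_subset[of _ "V \<times> V"]) (auto simp: vertex_pairs_def)

lemma pair_graphD:
  assumes "pair_graph G"
  shows "finite (pverts G)" "finite (parcs G)" "(u, v) \<in> parcs G \<Longrightarrow> u \<in> pverts G \<and> v \<in> pverts G \<and> u \<noteq> v"
    "(u, v) \<in> parcs G \<Longrightarrow> (v, u) \<in> parcs G"
proof -
  interpret pair_graph G by fact
  show "finite (pverts G)" "finite (parcs G)" by auto
  show "(u, v) \<in> parcs G \<Longrightarrow> u \<in> pverts G \<and> v \<in> pverts G \<and> u \<noteq> v"
    using in_arcsD1 in_arcsD2 pair_no_loops by fastforce
  show "(u, v) \<in> parcs G \<Longrightarrow> (v, u) \<in> parcs G"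
    using pair_sym_arcs by (auto simp: symmetric_def sym_def)
qed

lemma pair_graphI:
  assumes "finite (pverts G)" "\<And>u v. (u, v) \<in> parcs G \<Longrightarrow> u \<in> pverts G \<and> v \<in> pverts G \<and> u \<noteq> v"
    "\<And>u v. (u, v) \<in> parcs G \<Longrightarrow> (v, u) \<in> parcs G"
  shows "pair_graph G"
proof -
  have "finite (parcs G)"
    by (rule finite_subset[of _ "pverts G \<times> pverts G"]) (use assms in auto)
  then show ?thesis
    by unfold_locales (use assms in \<open>fastforce simp: symmetric_def sym_def\<close>)+
qed

lemma pair_graph_pattern_graph:
  assumes "finite V" "P \<subseteq> vertex_pairs V"
  shows "pair_graph (pattern_graph V P)"
  using assms by (intro pair_graphI) (auto simp: pattern_graph_def vertex_pairs_def)

lemma hom_density_pattern_graph: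
  assumes "pair_graph G" 
  shows "hom_density (pattern_graph V P) G = real (card (pattern_maps V P {} G)) / real (card (pverts G)) ^ card V"
proof -
  have ball: "(\<forall>(u, v)\<in>S. R u v) \<longleftrightarrow> (\<forall>u v. (u, v) \<in> S \<longrightarrow> R u v)" for S :: "(nat \<times> nat) set" and R
    by auto
  have "(\<forall>(u, v)\<in>P \<union> P\<inverse>. (f u, f v) \<in> parcs G) \<longleftrightarrow> (\<forall>(u, v)\<in>P. (f u, f v) \<in> parcs G)" for f
    unfolding ball using pair_graphD(4)[OF assms] by blast
  then show ?thesis
    by (simp add: hom_density_def pattern_graph_def pattern_maps_def)
qed

lemma graphon_density_pattern_graph:
  assumes "P \<subseteq> vertex_pairs V"
  shows "graphon_density (pattern_graph V P) W = (\<integral>x. pattern_weight P {} W x \<partial>PiM V (\<lambda>_. unit_leb))"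
proof -
  have "{(u, v). (u, v) \<in> P \<union> P\<inverse> \<and> u < v} = P"
    using assms by (auto simp: vertex_pairs_def)
  then show ?thesis
    by (simp add: graphon_density_def pattern_graph_def pattern_weight_def)
qed

lemma graphon_measurable_edge:
  assumes "graphon W" "u \<in> V" "v \<in> V"
  shows "(\<lambda>x. W (x u) (x v)) \<in> borel_measurable (PiM V (\<lambda>_. unit_leb))"
proof -
  have m: "(\<lambda>x. (x u, x v)) \<in> PiM V (\<lambda>_. unit_leb) \<rightarrow>\<^sub>M unit_leb \<Otimes>\<^sub>M unit_leb"
    using assms by measurable
  show ?thesis
    using measurable_compose[OF m, of "\<lambda>(x, y). W x y" borel] assms(1)
    by (simp add: graphon_def)
qed

lemma graphon_range:
  assumes "graphon W" "x \<in> space (PiM V (\<lambda>_. unit_leb))" "u \<in> V" "v \<in> V"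
  shows "0 \<le> W (x u) (x v)" "W (x u) (x v) \<le> 1"
proof -
  have "x u \<in> {0..1}" "x v \<in> {0..1}"
    using assms PiE_mem[of x V "\<lambda>_. space unit_leb"] by (auto simp: space_PiM)
  then show "0 \<le> W (x u) (x v)" "W (x u) (x v) \<le> 1"
    using assms(1) by (auto simp: graphon_def)
qed

lemma borel_measurable_pattern_weight:
  assumes "graphon W" "P \<subseteq> vertex_pairs V" "N \<subseteq> vertex_pairs V"
  shows "pattern_weight P N W \<in> borel_measurable (PiM V (\<lambda>_. unit_leb))"
proof -
  have "(\<lambda>x. W (x (fst e)) (x (snd e))) \<in> borel_measurable (PiM V (\<lambda>_. unit_leb))" if "e \<in> P \<union> N" for e
    using that assms by (intro graphon_measurable_edge) (auto simp: vertex_pairs_def)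
  then show ?thesis
    unfolding pattern_weight_def case_prod_beta
    by (intro borel_measurable_times borel_measurable_prod borel_measurable_diff) auto
qed

lemma pattern_weight_range:
  assumes "graphon W" "P \<subseteq> vertex_pairs V" "N \<subseteq> vertex_pairs V" "x \<in> space (PiM V (\<lambda>_. unit_leb))"
  shows "0 \<le> pattern_weight P N W x" "pattern_weight P N W x \<le> 1"
proof -
  have *: "0 \<le> W (x (fst e)) (x (snd e)) \<and> W (x (fst e)) (x (snd e)) \<le> 1" if "e \<in> P \<union> N" for e
    using that assms graphon_range[OF assms(1,4)] by (auto simp: vertex_pairs_def)
  show "0 \<le> pattern_weight P N W x"
    unfolding pattern_weight_def case_prod_beta using * by (intro mult_nonneg_nonneg prod_nonneg) auto
  show "pattern_weight P N W x \<le> 1"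
    unfolding pattern_weight_def case_prod_beta using * by (intro mult_le_one prod_nonneg prod_le_1) auto
qed

lemma integrable_pattern_weight:
  assumes "graphon W" "P \<subseteq> vertex_pairs V" "N \<subseteq> vertex_pairs V"
  shows "integrable (PiM V (\<lambda>_. unit_leb)) (pattern_weight P N W)"
proof -
  interpret prob_space "PiM V (\<lambda>_. unit_leb)"
    by (intro prob_space_PiM prob_space_unit_leb)
  show ?thesis
    by (rule integrable_const_bound[where B=1])
      (use assms pattern_weight_range[OF assms] borel_measurable_pattern_weight[OF assms] in auto)
qed

text \<open>Convergence is given for homomorphism densities, the case of empty \<open>N\<close>. A
  non-edge \<open>e\<close> is traded by inclusion-exclusion: the maps avoiding \<open>e\<close> are
  all maps minus those that make \<open>e\<close> an edge, and the weight splits alike through the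
  factor \<open>1 - W\<close>. The induction varies \<open>P\<close>, which gains
  \<open>e\<close>.\<close>

lemma pattern_maps_tendsto:
  assumes "represents W \<Gamma>" "converges_to G \<Gamma>" "\<And>n. pair_graph (G n)"
    and "finite V" "P \<subseteq> vertex_pairs V" "N \<subseteq> vertex_pairs V" "P \<inter> N = {}"
  shows "(\<lambda>n. real (card (pattern_maps V P N (G n))) / real (card (pverts (G n))) ^ card V)
           \<longlonglongrightarrow> (\<integral>x. pattern_weight P N W x \<partial>PiM V (\<lambda>_. unit_leb))"
proof -
  have "finite N" using assms finite_subset finite_vertex_pairs by blast
  then show ?thesis using assms(5-7)
  proof (induction N arbitrary: P rule: finite_induct)
    case empty
    have "(\<lambda>n. hom_density (pattern_graph V P) (G n)) \<longlonglongrightarrow> \<Gamma> (pattern_graph V P)"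
      using assms(2) pair_graph_pattern_graph[OF assms(4) empty.prems(1)] by (simp add: converges_to_def)
    moreover have "\<Gamma> (pattern_graph V P) = graphon_density (pattern_graph V P) W"
      using assms(1) pair_graph_pattern_graph[OF assms(4) empty(1)] by (simp add: represents_def)
    ultimately show ?case
      using empty.prems(1) by (simp add: hom_density_pattern_graph[OF assms(3)] graphon_density_pattern_graph)
  next
    case (insert e N)
    obtain u v where e: "e = (u, v)" by (cases e)
    have h: "finite N" "e \<notin> N" "e \<notin> P" "insert e P \<subseteq> vertex_pairs V" "insert e N \<subseteq> vertex_pairs V"
      "N \<subseteq> vertex_pairs V" "P \<subseteq> vertex_pairs V" "P \<inter> N = {}" "insert e P \<inter> N = {}"
      using insert.hyps insert.prems by auto
    have fP: "finite P" using h(7) assms(4) finite_subset finite_vertex_pairs by blast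
    have W: "graphon W" using assms(1) by (simp add: represents_def)
    have 1: "pattern_weight P (insert e N) W x = pattern_weight P N W x - pattern_weight (insert e P) N W x" for x
      using h(1-3) fP by (simp add: pattern_weight_def e algebra_simps)
    have I: "(\<integral>x. pattern_weight P (insert e N) W x \<partial>PiM V (\<lambda>_. unit_leb)) =
       (\<integral>x. pattern_weight P N W x \<partial>PiM V (\<lambda>_. unit_leb)) - (\<integral>x. pattern_weight (insert e P) N W x \<partial>PiM V (\<lambda>_. unit_leb))"
      unfolding 1 by (intro Bochner_Integration.integral_diff integrable_pattern_weight W h)
    have C: "real (card (pattern_maps V P (insert e N) (G n))) =
        real (card (pattern_maps V P N (G n))) - real (card (pattern_maps V (insert e P) N (G n)))" for n
    proof -
      have fin: "finite (V \<rightarrow>\<^sub>E pverts (G n))"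
        using assms(4) pair_graphD(1)[OF assms(3)] by (intro finite_PiE) auto
      have "pattern_maps V P N (G n) = pattern_maps V P (insert e N) (G n) \<union> pattern_maps V (insert e P) N (G n)"
        "pattern_maps V P (insert e N) (G n) \<inter> pattern_maps V (insert e P) N (G n) = {}"
        by (auto simp: pattern_maps_def e)
      moreover have "finite (pattern_maps V P N (G n))" for P N
        using fin by (rule finite_subset[rotated]) (auto simp: pattern_maps_def)
      ultimately show ?thesis by (simp add: card_Un_disjoint)
    qed
    have "(\<lambda>n. real (card (pattern_maps V P N (G n))) / real (card (pverts (G n))) ^ card V
             - real (card (pattern_maps V (insert e P) N (G n))) / real (card (pverts (G n))) ^ card V)
       \<longlonglongrightarrow> (\<integral>x. pattern_weight P N W x \<partial>PiM V (\<lambda>_. unit_leb)) - (\<integral>x. pattern_weight (insert e P) N W x \<partial>PiM V (\<lambda>_. unit_leb))"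
      by (intro tendsto_diff insert.IH h)
    then show ?case
      unfolding C I by (simp add: diff_divide_distrib)
  qed
qed

text \<open>The densities are 0, so the integral of the nonnegative weight is 0 and the weight
  vanishes almost everywhere. A product vanishes only with one of its factors, so the conclusion
  sees just the sets \<open>W > 0\<close> and \<open>W < 1\<close>, and a value strictly between
  lies in both.\<close>

lemma class_limits_AE_no_pattern:
  assumes "represents W \<Gamma>" "\<Gamma> \<in> class_limits C" "\<And>G. G \<in> C \<Longrightarrow> pair_graph G"
    and "finite V" "P \<subseteq> vertex_pairs V" "N \<subseteq> vertex_pairs V" "P \<inter> N = {}"
    and "\<And>G. G \<in> C \<Longrightarrow> pattern_maps V P N G = {}"
  shows "AE x in PiM V (\<lambda>_. unit_leb). \<not> ((\<forall>(u, v)\<in>P. 0 < W (x u) (x v)) \<and> (\<forall>(u, v)\<in>N. W (x u) (x v) < 1))"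
proof -
  obtain G where G: "\<And>n. G n \<in> C" "converges_to G \<Gamma>"
    using assms(2) by (auto simp: class_limits_def)
  have W: "graphon W" using assms by (simp add: represents_def)
  have "(\<lambda>n. 0) \<longlonglongrightarrow> (\<integral>x. pattern_weight P N W x \<partial>PiM V (\<lambda>_. unit_leb))"
    using pattern_maps_tendsto[OF assms(1) G(2) assms(3)[OF G(1)] assms(4-7)] assms(8)[OF G(1)] by simp
  then have "(\<integral>x. pattern_weight P N W x \<partial>PiM V (\<lambda>_. unit_leb)) = 0"
    by (simp add: LIMSEQ_const_iff)
  then have "AE x in PiM V (\<lambda>_. unit_leb). pattern_weight P N W x = 0"
    using integral_nonneg_eq_0_iff_AE[OF integrable_pattern_weight[OF W assms(5,6)]]
      pattern_weight_range(1)[OF W assms(5,6)] by (auto intro: AE_I2)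
  then show ?thesis
  proof (rule eventually_mono, intro notI)
    fix x assume 0: "pattern_weight P N W x = 0"
      and "(\<forall>(u, v)\<in>P. 0 < W (x u) (x v)) \<and> (\<forall>(u, v)\<in>N. W (x u) (x v) < 1)"
    then have "0 < pattern_weight P N W x"
      unfolding pattern_weight_def by (intro mult_pos_pos prod_pos) auto
    with 0 show False by simp
  qed
qed

section \<open>Forbidden patterns of incomparability graphs\<close>

lemma INC_order:
  assumes "G \<in> INC"
  obtains r where "\<And>x. x \<in> pverts G \<Longrightarrow> \<not> r x x"
    and "\<And>x y z. \<lbrakk>x \<in> pverts G; y \<in> pverts G; z \<in> pverts G; r x y; r y z\<rbrakk> \<Longrightarrow> r x z"
    and "\<And>x y. \<lbrakk>x \<in> pverts G; y \<in> pverts G\<rbrakk> \<Longrightarrow> (x, y) \<in> parcs G \<longleftrightarrow> x \<noteq> y \<and> \<not> r x y \<and> \<not> r y x"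
proof -
  obtain n r f where r: "irrefl_on {1..n} r" "trans_on {1..n} r"
    and f: "pre_digraph.digraph_isomorphism (with_proj (incomparability_graph n r)) f"
    and G: "with_proj G = app_iso f (with_proj (incomparability_graph n r))"
    using assms by (auto simp: INC_def digraph_iso_def)
  let ?H = "incomparability_graph n r"
  let ?v = "iso_verts f"
  have V: "pverts G = ?v ` {1..n}"
    using arg_cong[OF G, of verts] by (simp add: incomparability_graph_def)
  have A: "parcs G = iso_arcs f ` parcs ?H"
    using arg_cong[OF G, of arcs] by simp
  \<comment> \<open>Equality with a \<open>with_proj\<close> digraph forces the tail and head maps
    to be the projections, and with this the vertex map determines the arc map.\<close>
  have ht: "iso_tail f = fst" "iso_head f = snd"
    using arg_cong[OF G, of tail] arg_cong[OF G, of head] by simp_all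
  have inj: "inj_on ?v {1..n}"
    using f by (simp add: pre_digraph.digraph_isomorphism_def incomparability_graph_def)
  have arc: "iso_arcs f (x, y) = (?v x, ?v y)" if "(x, y) \<in> parcs ?H" for x y
    using f that by (auto simp: pre_digraph.digraph_isomorphism_def ht prod_eq_iff)
  have A': "parcs G = (\<lambda>(x, y). (?v x, ?v y)) ` parcs ?H"
    unfolding A using arc by (auto intro!: image_cong)
  define g where "g = the_inv_into {1..n} ?v"
  have g: "g (?v x) = x" if "x \<in> {1..n}" for x
    using that inj by (simp add: g_def the_inv_into_f_f)
  show thesis
  proof (rule that[of "\<lambda>x y. (g x, g y) \<in> r"])
    fix x y z assume *: "x \<in> pverts G" "y \<in> pverts G"
    then obtain x' y' where 1: "x = ?v x'" "x' \<in> {1..n}" "y = ?v y'" "y' \<in> {1..n}"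
      using V by auto
    then show "(x, y) \<in> parcs G \<longleftrightarrow> x \<noteq> y \<and> (g x, g y) \<notin> r \<and> (g y, g x) \<notin> r"
      using inj_onD[OF inj] by (auto simp: A' g incomparability_graph_def image_iff)
  next
    fix x assume "x \<in> pverts G"
    then show "(g x, g x) \<notin> r" using V r g by (auto simp: irrefl_on_def)
  next
    fix x y z assume "x \<in> pverts G" "y \<in> pverts G" "z \<in> pverts G" "(g x, g y) \<in> r" "(g y, g z) \<in> r"
    then show "(g x, g z) \<in> r" using V r(2) g by (auto dest: trans_onD)
  qed
qed

text \<open>If \<open>x\<close> were above one of \<open>y\<close>, \<open>z\<close> and below the
  other, transitivity would make \<open>y\<close> and \<open>z\<close> comparable. So if the
  non-neighbours of \<open>x\<close> are connected by edges, \<open>x\<close> is a source or a sink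
  of the order. The adjacency conditions exclude coincidences among \<open>x\<close>,
  \<open>y\<close>, \<open>z\<close>, which covers maps that identify vertices.\<close>

lemma INC_forcing:
  assumes "G \<in> INC"
  obtains r where "\<forall>x\<in>pverts G. \<forall>y\<in>pverts G. \<forall>z\<in>pverts G. (x, y) \<notin> parcs G \<and> (x, z) \<notin> parcs G \<and> (y, z) \<in> parcs G \<longrightarrow>
      (r x y \<longleftrightarrow> r x z) \<and> (r y x \<longleftrightarrow> \<not> r x y) \<and> (r z x \<longleftrightarrow> \<not> r x z)"
proof -
  obtain r where r: "\<And>x. x \<in> pverts G \<Longrightarrow> \<not> r x x"
    and t: "\<And>x y z. \<lbrakk>x \<in> pverts G; y \<in> pverts G; z \<in> pverts G; r x y; r y z\<rbrakk> \<Longrightarrow> r x z"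
    and a: "\<And>x y. \<lbrakk>x \<in> pverts G; y \<in> pverts G\<rbrakk> \<Longrightarrow> (x, y) \<in> parcs G \<longleftrightarrow> x \<noteq> y \<and> \<not> r x y \<and> \<not> r y x"
    using INC_order[OF assms] by blast
  have "(r x y \<longleftrightarrow> r x z) \<and> (r y x \<longleftrightarrow> \<not> r x y) \<and> (r z x \<longleftrightarrow> \<not> r x z)"
    if "x \<in> pverts G" "y \<in> pverts G" "z \<in> pverts G" "(x, y) \<notin> parcs G" "(x, z) \<notin> parcs G" "(y, z) \<in> parcs G" for x y z
    using that r t a by metis
  then show thesis using that[of r] by blast
qed

text \<open>The two non-neighbours of each vertex are adjacent, so each vertex is a source or a
  sink. The comparabilities form a 5-cycle, along which sources and sinks would have to
  alternate.\<close>

lemma no_C5_pattern: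
  assumes "G \<in> INC"
  shows "pattern_maps {..<5} {(0,1),(0,4),(1,2),(2,3),(3,4)}
    {(0,2),(0,3),(1,3),(1,4),(2,4)} G = {}"
proof (rule ccontr)
  assume "\<not> ?thesis"
  then obtain f :: "nat \<Rightarrow> nat" where f: "f \<in> {..<5} \<rightarrow>\<^sub>E pverts G"
    and e: "(f 0, f 1) \<in> parcs G" "(f 0, f 4) \<in> parcs G" "(f 1, f 2) \<in> parcs G" "(f 2, f 3) \<in> parcs G" "(f 3, f 4) \<in> parcs G"
    and n: "(f 0, f 2) \<notin> parcs G" "(f 0, f 3) \<notin> parcs G" "(f 1, f 3) \<notin> parcs G" "(f 1, f 4) \<notin> parcs G" "(f 2, f 4) \<notin> parcs G"
    by (auto simp: pattern_maps_def)
  have V: "f i \<in> pverts G" if "i < 5" for i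
    using f that by (auto intro: PiE_mem)
  obtain r where force: "\<forall>x\<in>pverts G. \<forall>y\<in>pverts G. \<forall>z\<in>pverts G. (x, y) \<notin> parcs G \<and> (x, z) \<notin> parcs G \<and> (y, z) \<in> parcs G \<longrightarrow>
      (r x y \<longleftrightarrow> r x z) \<and> (r y x \<longleftrightarrow> \<not> r x y) \<and> (r z x \<longleftrightarrow> \<not> r x z)"
    using INC_forcing[OF assms] .
  have ns: "(f j, f i) \<notin> parcs G" if "(f i, f j) \<notin> parcs G" "i < 5" "j < 5" for i j
    using that pair_graphD(4)[of G] assms by (auto simp: INC_def)
  have F: "(r (f 0) (f 2) \<longleftrightarrow> r (f 0) (f 3)) \<and> (r (f 2) (f 0) \<longleftrightarrow> \<not> r (f 0) (f 2)) \<and> (r (f 3) (f 0) \<longleftrightarrow> \<not> r (f 0) (f 3))"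
    "(r (f 1) (f 3) \<longleftrightarrow> r (f 1) (f 4)) \<and> (r (f 3) (f 1) \<longleftrightarrow> \<not> r (f 1) (f 3)) \<and> (r (f 4) (f 1) \<longleftrightarrow> \<not> r (f 1) (f 4))"
    "(r (f 2) (f 0) \<longleftrightarrow> r (f 2) (f 4)) \<and> (r (f 0) (f 2) \<longleftrightarrow> \<not> r (f 2) (f 0)) \<and> (r (f 4) (f 2) \<longleftrightarrow> \<not> r (f 2) (f 4))"
    "(r (f 3) (f 0) \<longleftrightarrow> r (f 3) (f 1)) \<and> (r (f 0) (f 3) \<longleftrightarrow> \<not> r (f 3) (f 0)) \<and> (r (f 1) (f 3) \<longleftrightarrow> \<not> r (f 3) (f 1))"
    "(r (f 4) (f 1) \<longleftrightarrow> r (f 4) (f 2)) \<and> (r (f 1) (f 4) \<longleftrightarrow> \<not> r (f 4) (f 1)) \<and> (r (f 2) (f 4) \<longleftrightarrow> \<not> r (f 4) (f 2))"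
    by (rule force[rule_format, OF V V V]; (simp; fail | intro conjI n e ns; simp))+
  show False
    using F by argo
qed

text \<open>The three non-neighbours of each vertex form a path, so each vertex is a source or a
  sink. But \<open>f 0\<close>, \<open>f 2\<close>, \<open>f 4\<close> are pairwise comparable, and
  one of three such vertices lies between the others.\<close>

lemma no_C6_pattern:
  assumes "G \<in> INC"
  shows "pattern_maps {..<6} {(0,1),(0,5),(1,2),(2,3),(3,4),(4,5)}
    {(0,2),(0,3),(0,4),(1,3),(1,4),(1,5),(2,4),(2,5),(3,5)} G = {}"
proof (rule ccontr)
  assume "\<not> ?thesis"
  then obtain f :: "nat \<Rightarrow> nat" where f: "f \<in> {..<6} \<rightarrow>\<^sub>E pverts G"
    and e: "(f 0, f 1) \<in> parcs G" "(f 0, f 5) \<in> parcs G" "(f 1, f 2) \<in> parcs G" "(f 2, f 3) \<in> parcs G" "(f 3, f 4) \<in> parcs G" "(f 4, f 5) \<in> parcs G"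
    and n: "(f 0, f 2) \<notin> parcs G" "(f 0, f 3) \<notin> parcs G" "(f 0, f 4) \<notin> parcs G" "(f 1, f 3) \<notin> parcs G" "(f 1, f 4) \<notin> parcs G" "(f 1, f 5) \<notin> parcs G" "(f 2, f 4) \<notin> parcs G" "(f 2, f 5) \<notin> parcs G" "(f 3, f 5) \<notin> parcs G"
    by (auto simp: pattern_maps_def)
  have V: "f i \<in> pverts G" if "i < 6" for i
    using f that by (auto intro: PiE_mem)
  obtain r where force: "\<forall>x\<in>pverts G. \<forall>y\<in>pverts G. \<forall>z\<in>pverts G. (x, y) \<notin> parcs G \<and> (x, z) \<notin> parcs G \<and> (y, z) \<in> parcs G \<longrightarrow>
      (r x y \<longleftrightarrow> r x z) \<and> (r y x \<longleftrightarrow> \<not> r x y) \<and> (r z x \<longleftrightarrow> \<not> r x z)"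
    using INC_forcing[OF assms] .
  have ns: "(f j, f i) \<notin> parcs G" if "(f i, f j) \<notin> parcs G" "i < 6" "j < 6" for i j
    using that pair_graphD(4)[of G] assms by (auto simp: INC_def)
  have F: "(r (f 0) (f 2) \<longleftrightarrow> r (f 0) (f 3)) \<and> (r (f 2) (f 0) \<longleftrightarrow> \<not> r (f 0) (f 2)) \<and> (r (f 3) (f 0) \<longleftrightarrow> \<not> r (f 0) (f 3))"
    "(r (f 0) (f 3) \<longleftrightarrow> r (f 0) (f 4)) \<and> (r (f 3) (f 0) \<longleftrightarrow> \<not> r (f 0) (f 3)) \<and> (r (f 4) (f 0) \<longleftrightarrow> \<not> r (f 0) (f 4))"
    "(r (f 1) (f 3) \<longleftrightarrow> r (f 1) (f 4)) \<and> (r (f 3) (f 1) \<longleftrightarrow> \<not> r (f 1) (f 3)) \<and> (r (f 4) (f 1) \<longleftrightarrow> \<not> r (f 1) (f 4))"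
    "(r (f 1) (f 4) \<longleftrightarrow> r (f 1) (f 5)) \<and> (r (f 4) (f 1) \<longleftrightarrow> \<not> r (f 1) (f 4)) \<and> (r (f 5) (f 1) \<longleftrightarrow> \<not> r (f 1) (f 5))"
    "(r (f 2) (f 0) \<longleftrightarrow> r (f 2) (f 5)) \<and> (r (f 0) (f 2) \<longleftrightarrow> \<not> r (f 2) (f 0)) \<and> (r (f 5) (f 2) \<longleftrightarrow> \<not> r (f 2) (f 5))"
    "(r (f 2) (f 4) \<longleftrightarrow> r (f 2) (f 5)) \<and> (r (f 4) (f 2) \<longleftrightarrow> \<not> r (f 2) (f 4)) \<and> (r (f 5) (f 2) \<longleftrightarrow> \<not> r (f 2) (f 5))"
    "(r (f 3) (f 0) \<longleftrightarrow> r (f 3) (f 1)) \<and> (r (f 0) (f 3) \<longleftrightarrow> \<not> r (f 3) (f 0)) \<and> (r (f 1) (f 3) \<longleftrightarrow> \<not> r (f 3) (f 1))"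
    "(r (f 3) (f 0) \<longleftrightarrow> r (f 3) (f 5)) \<and> (r (f 0) (f 3) \<longleftrightarrow> \<not> r (f 3) (f 0)) \<and> (r (f 5) (f 3) \<longleftrightarrow> \<not> r (f 3) (f 5))"
    "(r (f 4) (f 0) \<longleftrightarrow> r (f 4) (f 1)) \<and> (r (f 0) (f 4) \<longleftrightarrow> \<not> r (f 4) (f 0)) \<and> (r (f 1) (f 4) \<longleftrightarrow> \<not> r (f 4) (f 1))"
    "(r (f 4) (f 1) \<longleftrightarrow> r (f 4) (f 2)) \<and> (r (f 1) (f 4) \<longleftrightarrow> \<not> r (f 4) (f 1)) \<and> (r (f 2) (f 4) \<longleftrightarrow> \<not> r (f 4) (f 2))"
    "(r (f 5) (f 1) \<longleftrightarrow> r (f 5) (f 2)) \<and> (r (f 1) (f 5) \<longleftrightarrow> \<not> r (f 5) (f 1)) \<and> (r (f 2) (f 5) \<longleftrightarrow> \<not> r (f 5) (f 2))"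
    "(r (f 5) (f 2) \<longleftrightarrow> r (f 5) (f 3)) \<and> (r (f 2) (f 5) \<longleftrightarrow> \<not> r (f 5) (f 2)) \<and> (r (f 3) (f 5) \<longleftrightarrow> \<not> r (f 5) (f 3))"
    by (rule force[rule_format, OF V V V]; (simp; fail | intro conjI n e ns; simp))+
  show False
    using F by argo
qed

text \<open>The non-neighbours of a pendant vertex form a path, for \<open>f 3\<close> the path
  \<open>f 4\<close>, \<open>f 1\<close>, \<open>f 2\<close>, \<open>f 5\<close>, so each pendant
  vertex is a source or a sink. The three pendant vertices are pairwise comparable, which puts one
  of them between the others.\<close>

lemma no_net_pattern:
  assumes "G \<in> INC"
  shows "pattern_maps {..<6} {(0,1),(0,2),(0,3),(1,2),(1,4),(2,5)}
    {(0,4),(0,5),(1,3),(1,5),(2,3),(2,4),(3,4),(3,5),(4,5)} G = {}"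
proof (rule ccontr)
  assume "\<not> ?thesis"
  then obtain f :: "nat \<Rightarrow> nat" where f: "f \<in> {..<6} \<rightarrow>\<^sub>E pverts G"
    and e: "(f 0, f 1) \<in> parcs G" "(f 0, f 2) \<in> parcs G" "(f 0, f 3) \<in> parcs G" "(f 1, f 2) \<in> parcs G" "(f 1, f 4) \<in> parcs G" "(f 2, f 5) \<in> parcs G"
    and n: "(f 0, f 4) \<notin> parcs G" "(f 0, f 5) \<notin> parcs G" "(f 1, f 3) \<notin> parcs G" "(f 1, f 5) \<notin> parcs G" "(f 2, f 3) \<notin> parcs G" "(f 2, f 4) \<notin> parcs G" "(f 3, f 4) \<notin> parcs G" "(f 3, f 5) \<notin> parcs G" "(f 4, f 5) \<notin> parcs G"
    by (auto simp: pattern_maps_def)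
  have V: "f i \<in> pverts G" if "i < 6" for i
    using f that by (auto intro: PiE_mem)
  obtain r where force: "\<forall>x\<in>pverts G. \<forall>y\<in>pverts G. \<forall>z\<in>pverts G. (x, y) \<notin> parcs G \<and> (x, z) \<notin> parcs G \<and> (y, z) \<in> parcs G \<longrightarrow>
      (r x y \<longleftrightarrow> r x z) \<and> (r y x \<longleftrightarrow> \<not> r x y) \<and> (r z x \<longleftrightarrow> \<not> r x z)"
    using INC_forcing[OF assms] .
  have ns: "(f j, f i) \<notin> parcs G" if "(f i, f j) \<notin> parcs G" "i < 6" "j < 6" for i j
    using that pair_graphD(4)[of G] assms by (auto simp: INC_def)
  have F: "(r (f 3) (f 1) \<longleftrightarrow> r (f 3) (f 2)) \<and> (r (f 1) (f 3) \<longleftrightarrow> \<not> r (f 3) (f 1)) \<and> (r (f 2) (f 3) \<longleftrightarrow> \<not> r (f 3) (f 2))"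
    "(r (f 3) (f 1) \<longleftrightarrow> r (f 3) (f 4)) \<and> (r (f 1) (f 3) \<longleftrightarrow> \<not> r (f 3) (f 1)) \<and> (r (f 4) (f 3) \<longleftrightarrow> \<not> r (f 3) (f 4))"
    "(r (f 3) (f 2) \<longleftrightarrow> r (f 3) (f 5)) \<and> (r (f 2) (f 3) \<longleftrightarrow> \<not> r (f 3) (f 2)) \<and> (r (f 5) (f 3) \<longleftrightarrow> \<not> r (f 3) (f 5))"
    "(r (f 4) (f 0) \<longleftrightarrow> r (f 4) (f 2)) \<and> (r (f 0) (f 4) \<longleftrightarrow> \<not> r (f 4) (f 0)) \<and> (r (f 2) (f 4) \<longleftrightarrow> \<not> r (f 4) (f 2))"
    "(r (f 4) (f 0) \<longleftrightarrow> r (f 4) (f 3)) \<and> (r (f 0) (f 4) \<longleftrightarrow> \<not> r (f 4) (f 0)) \<and> (r (f 3) (f 4) \<longleftrightarrow> \<not> r (f 4) (f 3))"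
    "(r (f 4) (f 2) \<longleftrightarrow> r (f 4) (f 5)) \<and> (r (f 2) (f 4) \<longleftrightarrow> \<not> r (f 4) (f 2)) \<and> (r (f 5) (f 4) \<longleftrightarrow> \<not> r (f 4) (f 5))"
    "(r (f 5) (f 0) \<longleftrightarrow> r (f 5) (f 1)) \<and> (r (f 0) (f 5) \<longleftrightarrow> \<not> r (f 5) (f 0)) \<and> (r (f 1) (f 5) \<longleftrightarrow> \<not> r (f 5) (f 1))"
    "(r (f 5) (f 0) \<longleftrightarrow> r (f 5) (f 3)) \<and> (r (f 0) (f 5) \<longleftrightarrow> \<not> r (f 5) (f 0)) \<and> (r (f 3) (f 5) \<longleftrightarrow> \<not> r (f 5) (f 3))"
    "(r (f 5) (f 1) \<longleftrightarrow> r (f 5) (f 4)) \<and> (r (f 1) (f 5) \<longleftrightarrow> \<not> r (f 5) (f 1)) \<and> (r (f 4) (f 5) \<longleftrightarrow> \<not> r (f 5) (f 4))"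
    by (rule force[rule_format, OF V V V]; (simp; fail | intro conjI n e ns; simp))+
  show False
    using F by argo
qed

section \<open>Mantel's theorem for measurable graphs\<close>

lemma (in prob_space) integrable_bounded:
  fixes f :: "'a \<Rightarrow> real"
  assumes "f \<in> borel_measurable M" "\<And>x. x \<in> space M \<Longrightarrow> \<bar>f x\<bar> \<le> B"
  shows "integrable M f"
  using assms by (intro integrable_const_bound[where B=B]) auto

locale measurable_graph = prob_space M for M :: "'a measure" +
  fixes E :: "'a \<Rightarrow> 'a \<Rightarrow> bool"
  assumes measurable_E: "Measurable.pred (M \<Otimes>\<^sub>M M) (\<lambda>z. E (fst z) (snd z))"
    and E_sym: "\<And>x y. x \<in> space M \<Longrightarrow> y \<in> space M \<Longrightarrow> E x y \<Longrightarrow> E y x"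
begin

definition edge :: "'a \<Rightarrow> 'a \<Rightarrow> real" where
  "edge x y = (if E x y then 1 else 0)"

definition deg :: "'a \<Rightarrow> real" where
  "deg x = (\<integral>y. edge x y \<partial>M)"

sublocale MM: pair_sigma_finite M M ..

sublocale MM: prob_space "M \<Otimes>\<^sub>M M"
  by (rule prob_space_pair) (rule prob_space_axioms)+

lemma edge_range: "0 \<le> edge x y" "edge x y \<le> 1"
  by (auto simp: edge_def)

lemma edge_sym: "x \<in> space M \<Longrightarrow> y \<in> space M \<Longrightarrow> edge x y = edge y x"
  using E_sym by (auto simp: edge_def)

lemma measurable_edge: "(\<lambda>z. edge (fst z) (snd z)) \<in> borel_measurable (M \<Otimes>\<^sub>M M)"
  unfolding edge_def using measurable_E by measurable

lemma measurable_edge1: "x \<in> space M \<Longrightarrow> edge x \<in> borel_measurable M"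
  using measurable_compose[OF measurable_Pair1' measurable_edge, of x] by simp

lemma integrable_edge: "x \<in> space M \<Longrightarrow> integrable M (edge x)"
  using edge_range by (intro integrable_bounded[where B=1] measurable_edge1) (simp_all add: edge_range)

lemma measurable_deg: "deg \<in> borel_measurable M"
  unfolding deg_def using measurable_edge
  by (intro borel_measurable_lebesgue_integral) (simp add: case_prod_beta')

lemma deg_range: "x \<in> space M \<Longrightarrow> 0 \<le> deg x" "x \<in> space M \<Longrightarrow> deg x \<le> 1"
proof -
  show "0 \<le> deg x" unfolding deg_def using edge_range by (intro integral_nonneg_AE) auto
  assume "x \<in> space M"
  then have "deg x \<le> (\<integral>y. 1 \<partial>M)"
    unfolding deg_def using edge_range by (intro integral_mono integrable_edge) auto
  then show "deg x \<le> 1" by (simp add: prob_space)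
qed

lemma integrable_deg: "integrable M deg" "integrable M (\<lambda>x. deg x * deg x)"
proof -
  show "integrable M deg"
    using deg_range measurable_deg by (intro integrable_bounded[where B=1]) simp_all
  show "integrable M (\<lambda>x. deg x * deg x)"
    using deg_range measurable_deg
    by (intro integrable_bounded[where B=1] borel_measurable_times) (auto simp: abs_mult mult_le_one)
qed

lemma nbhd_sets: "x \<in> space M \<Longrightarrow> {y \<in> space M. E x y} \<in> sets M"
proof -
  assume "x \<in> space M"
  from measurable_edge1[OF this] have "{y \<in> space M. edge x y = 1} \<in> sets M" by measurable
  moreover have "{y \<in> space M. edge x y = 1} = {y \<in> space M. E x y}" by (auto simp: edge_def)
  ultimately show ?thesis by simp
qed

lemma deg_eq_prob: "x \<in> space M \<Longrightarrow> deg x = prob {y \<in> space M. E x y}"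
proof -
  assume x: "x \<in> space M"
  have "deg x = (\<integral>y. indicator {y \<in> space M. E x y} y \<partial>M)"
    unfolding deg_def by (intro Bochner_Integration.integral_cong) (auto simp: edge_def)
  then show ?thesis using nbhd_sets[OF x] by simp
qed

lemma integral_edge_deg: "(\<integral>x. (\<integral>y. edge x y * deg y \<partial>M) \<partial>M) = (\<integral>x. deg x * deg x \<partial>M)"
proof -
  have "integrable (M \<Otimes>\<^sub>M M) (\<lambda>z. edge (fst z) (snd z) * deg (snd z))"
  proof (rule MM.integrable_bounded[where B=1])
    show "(\<lambda>z. edge (fst z) (snd z) * deg (snd z)) \<in> borel_measurable (M \<Otimes>\<^sub>M M)"
      using measurable_edge measurable_deg by measurable
  qed (use edge_range deg_range in \<open>auto simp: abs_mult space_pair_measure intro!: mult_le_one\<close>)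
  then have "(\<integral>x. (\<integral>y. edge x y * deg y \<partial>M) \<partial>M) = (\<integral>y. (\<integral>x. edge x y * deg y \<partial>M) \<partial>M)"
    by (intro MM.Fubini_integral[symmetric]) (simp add: case_prod_beta')
  also have "\<dots> = (\<integral>y. (\<integral>x. edge y x * deg y \<partial>M) \<partial>M)"
    using edge_sym by (intro Bochner_Integration.integral_cong refl) auto
  also have "\<dots> = (\<integral>x. deg x * deg x \<partial>M)"
    by (simp add: deg_def)
  finally show ?thesis .
qed

text \<open>Adjacent points have essentially disjoint neighbourhoods, so their degrees sum to at most 1;
  averaging this over the edges bounds the second moment of the degree.\<close>

lemma triangle_free_deg_second_moment:
  assumes tri: "AE x in M. AE y in M. AE z in M. \<not> (E x y \<and> E y z \<and> E x z)"
  shows "2 * (\<integral>x. deg x * deg x \<partial>M) \<le> (\<integral>x. deg x \<partial>M)"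
proof -
  have 1: "AE x in M. AE y in M. edge x y * (deg x + deg y) \<le> edge x y"
    using tri AE_space
  proof eventually_elim
    case x': (elim x)
    then have x: "x \<in> space M" by simp
    from x'(1) AE_space show ?case
    proof eventually_elim
      case (elim y)
      then have n: "AE z in M. \<not> (E x y \<and> E y z \<and> E x z)" and y: "y \<in> space M" by auto
      show ?case
      proof (cases "E x y")
        case True
        have "deg x + deg y = (\<integral>z. edge x z + edge y z \<partial>M)"
          unfolding deg_def using x y by (simp add: integrable_edge)
        also have "\<dots> \<le> (\<integral>z. 1 \<partial>M)"
          using n True x y
          by (intro integral_mono_AE Bochner_Integration.integrable_add integrable_edge)
            (auto simp: edge_def elim!: eventually_mono)
        finally show ?thesis using True by (simp add: edge_def prob_space)
      qed (simp add: edge_def)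
    qed
  qed
  have m: "(\<lambda>y. edge x y * deg y) \<in> borel_measurable M" if "x \<in> space M" for x
    using measurable_edge1[OF that] measurable_deg by measurable
  have i: "integrable M (\<lambda>y. edge x y * deg y)" if "x \<in> space M" for x
    using edge_range deg_range
    by (intro integrable_bounded[where B=1] m that) (auto simp: abs_mult intro!: mult_le_one)
  have m2: "(\<lambda>x. \<integral>y. edge x y * deg y \<partial>M) \<in> borel_measurable M"
    using measurable_edge measurable_deg
    by (intro borel_measurable_lebesgue_integral) (simp add: case_prod_beta')
  have i2: "integrable M (\<lambda>x. \<integral>y. edge x y * deg y \<partial>M)"
  proof (rule integrable_bounded[OF m2, where B=1])
    fix x assume x: "x \<in> space M"
    have "\<bar>\<integral>y. edge x y * deg y \<partial>M\<bar> = (\<integral>y. edge x y * deg y \<partial>M)"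
      using edge_range deg_range by (intro abs_of_nonneg integral_nonneg_AE) (auto intro!: AE_I2)
    also have "\<dots> \<le> (\<integral>y. 1 \<partial>M)"
      using edge_range deg_range by (intro integral_mono i x) (auto intro!: mult_le_one)
    finally show "\<bar>\<integral>y. edge x y * deg y \<partial>M\<bar> \<le> 1" by (simp add: prob_space)
  qed
  have s: "(\<integral>y. edge x y * (deg x + deg y) \<partial>M) = deg x * deg x + (\<integral>y. edge x y * deg y \<partial>M)" if "x \<in> space M" for x
  proof -
    have "(\<integral>y. edge x y * (deg x + deg y) \<partial>M) = (\<integral>y. deg x * edge x y + edge x y * deg y \<partial>M)"
      by (simp add: algebra_simps)
    also have "\<dots> = deg x * deg x + (\<integral>y. edge x y * deg y \<partial>M)"
      using that by (subst Bochner_Integration.integral_add) (simp_all add: i integrable_edge deg_def[of x, symmetric])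
    finally show ?thesis .
  qed
  have "(\<integral>x. deg x * deg x + (\<integral>y. edge x y * deg y \<partial>M) \<partial>M) \<le> (\<integral>x. deg x \<partial>M)"
  proof (rule integral_mono_AE)
    show "AE x in M. deg x * deg x + (\<integral>y. edge x y * deg y \<partial>M) \<le> deg x"
      using 1
    proof (rule AE_mp, intro AE_I2 impI)
      fix x assume x: "x \<in> space M" and a: "AE y in M. edge x y * (deg x + deg y) \<le> edge x y"
      have "(\<integral>y. edge x y * (deg x + deg y) \<partial>M) \<le> (\<integral>y. edge x y \<partial>M)"
      proof (rule integral_mono_AE)
        have "integrable M (\<lambda>y. deg x * edge x y + edge x y * deg y)"
          using x i integrable_edge by simp
        then show "integrable M (\<lambda>y. edge x y * (deg x + deg y))" by (simp add: algebra_simps)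
      qed (use a x integrable_edge in auto)
      then show "deg x * deg x + (\<integral>y. edge x y * deg y \<partial>M) \<le> deg x"
        using s[OF x] by (simp add: deg_def)
    qed
  qed (use i2 integrable_deg in auto)
  then show ?thesis
    using i2 integrable_deg integral_edge_deg by simp
qed

lemma variance_deg: "(\<integral>x. (deg x - 1/2) * (deg x - 1/2) \<partial>M) = (\<integral>x. deg x * deg x \<partial>M) - (\<integral>x. deg x \<partial>M) + 1/4"
proof -
  have "(deg x - 1/2) * (deg x - 1/2) = deg x * deg x - deg x + 1/4" for x
    by (simp add: algebra_simps)
  then show ?thesis using integrable_deg by (simp add: prob_space)
qed

text \<open>The integral of \<open>(deg x - 1/2)^2\<close> is nonnegative, and by the second moment
  bound it is at most \<open>1/4\<close> minus half the integral of the degree.\<close>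

lemma mantel:
  assumes "AE x in M. AE y in M. AE z in M. \<not> (E x y \<and> E y z \<and> E x z)"
  shows "(\<integral>x. deg x \<partial>M) \<le> 1/2"
proof -
  have "0 \<le> (\<integral>x. (deg x - 1/2) * (deg x - 1/2) \<partial>M)" by simp
  then show ?thesis
    using triangle_free_deg_second_moment[OF assms] variance_deg by linarith
qed

text \<open>Equality leaves no variance, so almost all degrees are \<open>1/2\<close>. Take for
  \<open>A\<close> the neighbourhood of a typical point \<open>x0\<close>. A neighbour of
  \<open>x0\<close> has essentially no neighbours in \<open>A\<close>, and its degree
  \<open>1/2\<close> then fills the complement. Points outside \<open>A\<close> are reached by
  symmetry of the edges.\<close>

lemma mantel_extremal:
  assumes tri: "AE x in M. AE y in M. AE z in M. \<not> (E x y \<and> E y z \<and> E x z)"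
    and "(\<integral>x. deg x \<partial>M) = 1/2"
  obtains A where "A \<in> sets M" "prob A = 1/2" "AE x in M. AE y in M. E x y \<longleftrightarrow> (x \<in> A) \<noteq> (y \<in> A)"
proof -
  have "(\<integral>x. (deg x - 1/2) * (deg x - 1/2) \<partial>M) \<le> 0"
    using triangle_free_deg_second_moment[OF tri] variance_deg assms(2) by linarith
  moreover have "integrable M (\<lambda>x. (deg x - 1/2) * (deg x - 1/2))"
    using integrable_deg by (simp add: algebra_simps)
  moreover have "0 \<le> (\<integral>x. (deg x - 1/2) * (deg x - 1/2) \<partial>M)" by simp
  ultimately have half: "AE x in M. deg x = 1/2"
    using integral_nonneg_eq_0_iff_AE[of M "\<lambda>x. (deg x - 1/2) * (deg x - 1/2)"] by simp
  have "AE x in M. deg x = 1/2 \<and> (AE y in M. AE z in M. \<not> (E x y \<and> E y z \<and> E x z)) \<and> x \<in> space M"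
    using half tri AE_space by eventually_elim simp
  then obtain x0 where x0: "x0 \<in> space M" "deg x0 = 1/2" "AE y in M. AE z in M. \<not> (E x0 y \<and> E y z \<and> E x0 z)"
    using eventually_happens'[OF ae_filter_bot] by blast
  define A where "A = {y \<in> space M. E x0 y}"
  have A: "A \<in> sets M" and pA: "prob A = 1/2"
    using x0 nbhd_sets deg_eq_prob by (auto simp: A_def)
  have pB: "prob (space M - A) = 1/2"
    using A pA by (simp add: prob_compl)
  have full: "AE z in M. z \<in> B \<longrightarrow> E y z"
    if "y \<in> space M" "deg y = 1/2" "AE z in M. E y z \<longrightarrow> z \<in> B" "B \<in> sets M" "prob B = 1/2" for y B
  proof -
    let ?N = "{z \<in> space M. E y z}"
    have N: "?N \<in> sets M" "prob ?N = 1/2"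
      using that nbhd_sets deg_eq_prob by auto
    have "prob (B \<inter> ?N) = prob ?N"
      using that N by (intro measure_eq_AE) (auto elim!: eventually_mono)
    then have "prob (B - ?N) = 0"
      using finite_measure_Diff'[of B ?N] that N by simp
    then have "AE z in M. z \<notin> B - ?N"
      using that N AE_iff_measurable[of "B - ?N" M] prob_eq_0 by simp
    then show ?thesis by auto
  qed
  have 1: "AE y in M. y \<in> A \<longrightarrow> (AE z in M. E y z \<longleftrightarrow> z \<notin> A)"
    using half x0(3) AE_space
  proof eventually_elim
    case (elim y)
    show ?case
    proof
      assume y: "y \<in> A"
      have sub: "AE z in M. E y z \<longrightarrow> z \<in> space M - A"
        using elim(2) AE_space by eventually_elim (use y in \<open>auto simp: A_def\<close>)
      have "AE z in M. z \<in> space M - A \<longrightarrow> E y z"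
        using elim sub A pB by (intro full) auto
      then show "AE z in M. E y z \<longleftrightarrow> z \<notin> A"
        using sub AE_space by eventually_elim auto
    qed
  qed
  \<comment> \<open>With the quantifiers exchanged, almost every point outside \<open>A\<close> is
    joined to almost all of \<open>A\<close>, and its degree \<open>1/2\<close> leaves no room for
    other neighbours.\<close>
  have "AE z in M. AE y in M. y \<in> A \<longrightarrow> (E y z \<longleftrightarrow> z \<notin> A)"
  proof (subst MM.AE_commute[symmetric])
    show "AE y in M. AE z in M. y \<in> A \<longrightarrow> (E y z \<longleftrightarrow> z \<notin> A)"
      using 1 by eventually_elim auto
    show "{x \<in> space (M \<Otimes>\<^sub>M M). fst x \<in> A \<longrightarrow> E (fst x) (snd x) = (snd x \<notin> A)} \<in> sets (M \<Otimes>\<^sub>M M)"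
      using A measurable_E by measurable
  qed
  then have 2: "AE y in M. y \<notin> A \<longrightarrow> (AE z in M. E y z \<longleftrightarrow> z \<in> A)"
    using half AE_space
  proof eventually_elim
    case (elim y)
    show ?case
    proof
      assume y: "y \<notin> A"
      have sup: "AE z in M. z \<in> A \<longrightarrow> E y z"
        using elim(1) AE_space by eventually_elim (use y elim E_sym in blast)
      let ?N = "{z \<in> space M. E y z}"
      have N: "?N \<in> sets M" "prob ?N = 1/2"
        using elim nbhd_sets deg_eq_prob by auto
      have "prob (A \<inter> ?N) = prob A"
        using sup A N AE_space by (intro measure_eq_AE) (auto elim!: eventually_mono)
      then have "prob (?N - A) = 0"
        using finite_measure_Diff'[of ?N A] A N pA by (simp add: Int_commute)
      then have "AE z in M. z \<notin> ?N - A"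
        using A N AE_iff_measurable[of "?N - A" M] prob_eq_0 by simp
      then show "AE z in M. E y z \<longleftrightarrow> z \<in> A"
        using sup AE_space by eventually_elim auto
    qed
  qed
  have "AE x in M. AE y in M. E x y \<longleftrightarrow> (x \<in> A) \<noteq> (y \<in> A)"
    using 1 2
  proof eventually_elim
    case (elim x) then show ?case by (cases "x \<in> A") auto
  qed
  then show thesis using that A pA by blast
qed

end

section \<open>Weights without forbidden patterns\<close>

definition realizes :: "(nat \<times> nat) set \<Rightarrow> (nat \<times> nat) set \<Rightarrow> (nat \<Rightarrow> nat \<Rightarrow> real) \<Rightarrow> bool" where
  "realizes P N w \<longleftrightarrow> (\<forall>(u, v)\<in>P. 0 < w u v) \<and> (\<forall>(u, v)\<in>N. w u v < 1)"

text \<open>The three patterns are the 5-cycle, the 6-cycle and the net. A weight strictly between 0 and 1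
  may serve both as an edge and as a non-edge.\<close>

definition inc_weights :: "nat set \<Rightarrow> (nat \<Rightarrow> nat \<Rightarrow> real) \<Rightarrow> bool" where
  "inc_weights I w \<longleftrightarrow> (\<forall>l. distinct l \<and> set l \<subseteq> I \<longrightarrow>
     (length l = 5 \<longrightarrow> \<not> realizes {(0,1),(0,4),(1,2),(2,3),(3,4)} {(0,2),(0,3),(1,3),(1,4),(2,4)}
        (\<lambda>i j. w (l ! i) (l ! j))) \<and>
     (length l = 6 \<longrightarrow> \<not> realizes {(0,1),(0,5),(1,2),(2,3),(3,4),(4,5)}
        {(0,2),(0,3),(0,4),(1,3),(1,4),(1,5),(2,4),(2,5),(3,5)} (\<lambda>i j. w (l ! i) (l ! j))) \<and>
     (length l = 6 \<longrightarrow> \<not> realizes {(0,1),(0,2),(0,3),(1,2),(1,4),(2,5)}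
        {(0,4),(0,5),(1,3),(1,5),(2,3),(2,4),(3,4),(3,5),(4,5)} (\<lambda>i j. w (l ! i) (l ! j))))"

lemma AE_not_realizes:
  assumes "AE y in PiM {..<k} (\<lambda>_. unit_leb). \<not> ((\<forall>(u, v)\<in>P. 0 < W (y u) (y v)) \<and> (\<forall>(u, v)\<in>N. W (y u) (y v) < 1))"
    and "P \<subseteq> vertex_pairs {..<k}" "N \<subseteq> vertex_pairs {..<k}" "distinct l" "length l = k" "set l \<subseteq> I"
  shows "AE x in PiM I (\<lambda>_. unit_leb). \<not> realizes P N (\<lambda>i j. W (x (l ! i)) (x (l ! j)))"
proof -
  have inj: "inj_on ((!) l) {..<k}" "(!) l ` {..<k} \<subseteq> I"
    using assms by (auto simp: inj_on_def nth_eq_iff_index_eq)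
  have eq: "((\<forall>(u, v)\<in>P. 0 < W ((\<lambda>v\<in>{..<k}. x (l ! v)) u) ((\<lambda>v\<in>{..<k}. x (l ! v)) v)) \<and>
         (\<forall>(u, v)\<in>N. W ((\<lambda>v\<in>{..<k}. x (l ! v)) u) ((\<lambda>v\<in>{..<k}. x (l ! v)) v) < 1)) \<longleftrightarrow>
       realizes P N (\<lambda>i j. W (x (l ! i)) (x (l ! j)))" for x
    unfolding realizes_def using assms(2,3)
    by (intro conj_cong ball_cong refl) (auto simp: vertex_pairs_def)
  show ?thesis
    using AE_PiM_reindex[OF prob_space_unit_leb inj assms(1)] unfolding eq .
qed

text \<open>There are countably many lists of indices, so the exceptional sets of all placements of
  the three patterns form one null set.\<close>

lemma AE_inc_weights:
  assumes W: "represents W \<Gamma>" "\<Gamma> \<in> class_limits INC"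
  shows "AE x in PiM I (\<lambda>_. unit_leb). inc_weights I (\<lambda>i j. W (x i) (x j))"
proof -
  have INC: "\<And>G. G \<in> INC \<Longrightarrow> pair_graph G" by (simp add: INC_def)
  note pat = class_limits_AE_no_pattern[OF W INC finite_lessThan]
  note C5 = pat[OF _ _ _ _ no_C5_pattern] and C6 = pat[OF _ _ _ _ no_C6_pattern] and net = pat[OF _ _ _ _ no_net_pattern]
  show ?thesis
    unfolding inc_weights_def AE_all_countable
  proof (intro allI)
    fix l :: "nat list"
    show "AE x in PiM I (\<lambda>_. unit_leb). distinct l \<and> set l \<subseteq> I \<longrightarrow>
     (length l = 5 \<longrightarrow> \<not> realizes {(0,1),(0,4),(1,2),(2,3),(3,4)} {(0,2),(0,3),(1,3),(1,4),(2,4)}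
        (\<lambda>i j. W (x (l ! i)) (x (l ! j)))) \<and>
     (length l = 6 \<longrightarrow> \<not> realizes {(0,1),(0,5),(1,2),(2,3),(3,4),(4,5)}
        {(0,2),(0,3),(0,4),(1,3),(1,4),(1,5),(2,4),(2,5),(3,5)} (\<lambda>i j. W (x (l ! i)) (x (l ! j)))) \<and>
     (length l = 6 \<longrightarrow> \<not> realizes {(0,1),(0,2),(0,3),(1,2),(1,4),(2,5)}
        {(0,4),(0,5),(1,3),(1,5),(2,3),(2,4),(3,4),(3,5),(4,5)} (\<lambda>i j. W (x (l ! i)) (x (l ! j))))"
    proof (cases "distinct l \<and> set l \<subseteq> I")
      case True
      have "AE x in PiM I (\<lambda>_. unit_leb). \<not> realizes {(0,1),(0,4),(1,2),(2,3),(3,4)} {(0,2),(0,3),(1,3),(1,4),(2,4)}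
        (\<lambda>i j. W (x (l ! i)) (x (l ! j)))" if "length l = 5"
        by (rule AE_not_realizes[OF C5]) (use that True in \<open>auto simp: vertex_pairs_def\<close>)
      moreover have "AE x in PiM I (\<lambda>_. unit_leb). \<not> realizes {(0,1),(0,5),(1,2),(2,3),(3,4),(4,5)}
        {(0,2),(0,3),(0,4),(1,3),(1,4),(1,5),(2,4),(2,5),(3,5)} (\<lambda>i j. W (x (l ! i)) (x (l ! j)))" if "length l = 6"
        by (rule AE_not_realizes[OF C6]) (use that True in \<open>auto simp: vertex_pairs_def\<close>)
      moreover have "AE x in PiM I (\<lambda>_. unit_leb). \<not> realizes {(0,1),(0,2),(0,3),(1,2),(1,4),(2,5)}
        {(0,4),(0,5),(1,3),(1,5),(2,3),(2,4),(3,4),(3,5),(4,5)} (\<lambda>i j. W (x (l ! i)) (x (l ! j)))" if "length l = 6"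
        by (rule AE_not_realizes[OF net]) (use that True in \<open>auto simp: vertex_pairs_def\<close>)
      ultimately show ?thesis by (cases "length l = 5"; cases "length l = 6") auto
    qed auto
  qed
qed

lemma inc_weights_C5:
  assumes "inc_weights I w" "distinct [a, b, c, d, e]" "{a, b, c, d, e} \<subseteq> I"
    "0 < w a b" "0 < w b c" "0 < w c d" "0 < w d e" "0 < w a e"
    "w a c < 1" "w a d < 1" "w b d < 1" "w b e < 1" "w c e < 1"
  shows False
  using assms(1)[unfolded inc_weights_def, rule_format, of "[a, b, c, d, e]"] assms(2-)
  by (simp add: realizes_def)

lemma inc_weights_C6:
  assumes "inc_weights I w" "distinct [a, b, c, d, e, f]" "{a, b, c, d, e, f} \<subseteq> I"
    "0 < w a b" "0 < w b c" "0 < w c d" "0 < w d e" "0 < w e f" "0 < w a f"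
    "w a c < 1" "w a d < 1" "w a e < 1" "w b d < 1" "w b e < 1" "w b f < 1" "w c e < 1" "w c f < 1" "w d f < 1"
  shows False
  using assms(1)[unfolded inc_weights_def, rule_format, of "[a, b, c, d, e, f]"] assms(2-)
  by (simp add: realizes_def)

lemma inc_weights_net:
  assumes "inc_weights I w" "distinct [a, b, c, d, e, f]" "{a, b, c, d, e, f} \<subseteq> I"
    "0 < w a b" "0 < w a c" "0 < w b c" "0 < w a d" "0 < w b e" "0 < w c f"
    "w a e < 1" "w a f < 1" "w b d < 1" "w b f < 1" "w c d < 1" "w c e < 1" "w d e < 1" "w d f < 1" "w e f < 1"
  shows False
  using assms(1)[unfolded inc_weights_def, rule_format, of "[a, b, c, d, e, f]"] assms(2-)
  by (simp add: realizes_def)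

section \<open>Contradictions from clone classes with free pairs between them\<close>

locale inc_weighting =
  fixes I :: "nat set" and w :: "nat \<Rightarrow> nat \<Rightarrow> real"
  assumes weights: "inc_weights I w"
    and sym: "\<And>i j. i \<in> I \<Longrightarrow> j \<in> I \<Longrightarrow> w i j = w j i"
begin

text \<open>Any pattern can be prescribed between \<open>X\<close> and \<open>Y\<close>. Both orders
  of arguments occur because a pattern lists each of its pairs in one order only.\<close>

definition free :: "nat set \<Rightarrow> nat set \<Rightarrow> bool" where
  "free X Y \<longleftrightarrow> (\<forall>x\<in>X. \<forall>y\<in>Y. 0 < w x y \<and> w x y < 1 \<and> 0 < w y x \<and> w y x < 1)"

lemma free_sym: "free X Y \<Longrightarrow> free Y X"
  by (auto simp: free_def)

text \<open>A net: the clique is its triangle and the stable triple supplies its pendant vertices.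
  Here and below, stable refers to weights less than 1 and clique to positive weights.\<close>

lemma stable_clique:
  assumes "X \<subseteq> I" "Y \<subseteq> I" "X \<inter> Y = {}" "free X Y"
    and "x1 \<in> X" "x2 \<in> X" "x3 \<in> X" "distinct [x1, x2, x3]" "y1 \<in> Y" "y2 \<in> Y" "y3 \<in> Y" "distinct [y1, y2, y3]"
    and "w x1 x2 < 1" "w x1 x3 < 1" "w x2 x3 < 1" "0 < w y1 y2" "0 < w y1 y3" "0 < w y2 y3"
  shows False
  by (rule inc_weights_net[OF weights, of y1 y2 y3 x1 x2 x3])
    (use assms in \<open>auto simp: free_def disjoint_iff\<close>)

text \<open>A 6-cycle that alternates between the two triples.\<close>

lemma stable_stable:
  assumes "X \<subseteq> I" "Y \<subseteq> I" "X \<inter> Y = {}" "free X Y"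
    and "x1 \<in> X" "x2 \<in> X" "x3 \<in> X" "distinct [x1, x2, x3]" "y1 \<in> Y" "y2 \<in> Y" "y3 \<in> Y" "distinct [y1, y2, y3]"
    and "w x1 x2 < 1" "w x1 x3 < 1" "w x2 x3 < 1" "w y1 y2 < 1" "w y1 y3 < 1" "w y2 y3 < 1"
  shows False
  by (rule inc_weights_C6[OF weights, of x1 y1 x2 y2 x3 y3])
    (use assms in \<open>auto simp: free_def disjoint_iff\<close>)

text \<open>The 5-cycle \<open>x1\<close>, \<open>x2\<close>, \<open>y1\<close>, \<open>y2\<close>,
  \<open>z\<close>: all its pairs other than \<open>x1 x2\<close> and \<open>y1 y2\<close> are
  free.\<close>

lemma cliques_point_false:
  assumes "X \<subseteq> I" "Y \<subseteq> I" "z \<in> I" "X \<inter> Y = {}" "z \<notin> X" "z \<notin> Y" "free X Y" "free X {z}" "free Y {z}"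
    and "x1 \<in> X" "x2 \<in> X" "x1 \<noteq> x2" "y1 \<in> Y" "y2 \<in> Y" "y1 \<noteq> y2" "0 < w x1 x2" "0 < w y1 y2"
  shows False
  by (rule inc_weights_C5[OF weights, of x1 x2 y1 y2 z])
    (use assms in \<open>auto simp: free_def disjoint_iff\<close>)

lemma stable_pair_point_false:
  assumes "X \<subseteq> I" "Y \<subseteq> I" "z \<in> I" "X \<inter> Y = {}" "z \<notin> X" "z \<notin> Y" "free X Y" "free X {z}" "free Y {z}"
    and "x1 \<in> X" "x2 \<in> X" "x3 \<in> X" "distinct [x1, x2, x3]" "y1 \<in> Y" "y2 \<in> Y" "y1 \<noteq> y2"
    and "w x1 x2 < 1" "w x1 x3 < 1" "w x2 x3 < 1"
  shows False
proof -
  \<comment> \<open>The point \<open>z\<close> joins \<open>Y\<close> as a third member. Its pairs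
    with \<open>y1\<close> and \<open>y2\<close> are free, so the new triple is a clique or stable
    according to the value of \<open>w y1 y2\<close>.\<close>
  have *: "X \<subseteq> I" "insert z Y \<subseteq> I" "X \<inter> insert z Y = {}" "free X (insert z Y)"
    "x1 \<in> X" "x2 \<in> X" "x3 \<in> X" "distinct [x1, x2, x3]"
    "y1 \<in> insert z Y" "y2 \<in> insert z Y" "z \<in> insert z Y" "distinct [y1, y2, z]"
    using assms by (auto simp: free_def)
  have z: "0 < w y1 z" "w y1 z < 1" "0 < w y2 z" "w y2 z < 1"
    using assms by (auto simp: free_def)
  show False
    using stable_clique[OF * assms(17-19)] stable_stable[OF * assms(17-19)] z
    by (cases "0 < w y1 y2") auto
qed

text \<open>Three clones in each of two classes force a decision: a class without a positive pair is
  a stable triple, refuted by \<open>stable_pair_point_false\<close>, and a positive pair in both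
  classes gives a 5-cycle through \<open>z\<close>.\<close>

lemma free_triangle_false:
  assumes XY: "X \<subseteq> I" "Y \<subseteq> I" "z \<in> I" "X \<inter> Y = {}" "z \<notin> X" "z \<notin> Y" "free X Y" "free X {z}" "free Y {z}"
    and x: "x1 \<in> X" "x2 \<in> X" "x3 \<in> X" "distinct [x1, x2, x3]"
    and y: "y1 \<in> Y" "y2 \<in> Y" "y3 \<in> Y" "distinct [y1, y2, y3]"
  shows False
proof -
  have YX: "Y \<inter> X = {}" "free Y X" using XY free_sym by auto
  have ne: "x1 \<noteq> x2" "x1 \<noteq> x3" "x2 \<noteq> x3" "y1 \<noteq> y2" "y1 \<noteq> y3" "y2 \<noteq> y3"
    using x y by auto
  have "0 < w x1 x2 \<or> 0 < w x1 x3 \<or> 0 < w x2 x3"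
  proof (rule ccontr)
    assume "\<not> ?thesis"
    then have "w x1 x2 < 1" "w x1 x3 < 1" "w x2 x3 < 1" by auto
    then show False by (rule stable_pair_point_false[OF XY x y(1,2) ne(4)])
  qed
  moreover have "0 < w y1 y2 \<or> 0 < w y1 y3 \<or> 0 < w y2 y3"
  proof (rule ccontr)
    assume "\<not> ?thesis"
    then have "w y1 y2 < 1" "w y1 y3 < 1" "w y2 y3 < 1" by auto
    then show False by (rule stable_pair_point_false[OF XY(2,1,3) YX(1) XY(6,5) YX(2) XY(9,8) y x(1,2) ne(1)])
  qed
  ultimately show False
    using cliques_point_false[OF XY] x(1-3) y(1-3) ne by blast
qed

text \<open>Six is the Ramsey number for triangles in two colours. A homogeneous triple in
  \<open>Y\<close> is a clique or stable, and completes the stable triple in \<open>X\<close> to a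
  net or a 6-cycle.\<close>

lemma stable_ramsey_false:
  assumes XY: "X \<subseteq> I" "Y \<subseteq> I" "X \<inter> Y = {}" "free X Y"
    and x: "x1 \<in> X" "x2 \<in> X" "x3 \<in> X" "distinct [x1, x2, x3]" "w x1 x2 < 1" "w x1 x3 < 1" "w x2 x3 < 1"
    and Y: "finite Y" "6 \<le> card Y"
    and w01: "\<And>b b'. b \<in> Y \<Longrightarrow> b' \<in> Y \<Longrightarrow> b \<noteq> b' \<Longrightarrow> w b b' = 0 \<or> w b b' = 1"
  shows False
proof -
  have mono: False if "b1 \<in> Y" "b2 \<in> Y" "b3 \<in> Y" "distinct [b1, b2, b3]" "w b1 b2 = c" "w b1 b3 = c" "w b2 b3 = c" "c = 0 \<or> c = 1" for b1 b2 b3 c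
    using stable_clique[OF XY x(1-4) that(1-4) x(5-7)] stable_stable[OF XY x(1-4) that(1-4) x(5-7)] that(5-8)
    by auto
  obtain b where b: "b \<in> Y" using Y by fastforce
  define N where "N c = {b' \<in> Y - {b}. w b b' = c}" for c
  have "Y - {b} = N 0 \<union> N 1"
    using w01[OF b] by (auto simp: N_def)
  moreover have "5 \<le> card (Y - {b})" using Y b by simp
  ultimately have "5 \<le> card (N 0 \<union> N 1)" by simp
  then have "5 \<le> card (N 0) + card (N 1)" using card_Un_le order_trans by blast
  then have "3 \<le> card (N 0) \<or> 3 \<le> card (N 1)" by linarith
  then obtain c :: real where c: "c = 0 \<or> c = 1" "3 \<le> card (N c)" by blast
  obtain T where T: "T \<subseteq> N c" "card T = 3" using obtain_subset_with_card_n[OF c(2)] by blast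
  from T(2)[unfolded card_3_iff] obtain b1 b2 b3
    where t: "T = {b1, b2, b3}" "b1 \<noteq> b2" "b1 \<noteq> b3" "b2 \<noteq> b3"
    by blast
  have B: "b1 \<in> Y" "b2 \<in> Y" "b3 \<in> Y" "b1 \<noteq> b" "b2 \<noteq> b" "b3 \<noteq> b" "w b b1 = c" "w b b2 = c" "w b b3 = c"
    using T t by (auto simp: N_def)
  have "w b1 b2 \<noteq> c" "w b1 b3 \<noteq> c" "w b2 b3 \<noteq> c"
    using mono[of b b1 b2 c] mono[of b b1 b3 c] mono[of b b2 b3 c] b B t c(1) by auto
  then have "w b1 b2 = 1 - c" "w b1 b3 = 1 - c" "w b2 b3 = 1 - c" "1 - c = 0 \<or> 1 - c = 1"
    using w01[OF B(1,2) t(2)] w01[OF B(1,3) t(3)] w01[OF B(2,3) t(4)] c(1) by auto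
  then show False using mono[OF B(1-3), of "1 - c"] t by auto
qed

text \<open>The path in \<open>X\<close> closes up through the edge in \<open>Y\<close> to the
  5-cycle \<open>x1\<close>, \<open>y1\<close>, \<open>y2\<close>, \<open>x3\<close>,
  \<open>x2\<close>.\<close>

lemma path_edge_false:
  assumes "X \<subseteq> I" "Y \<subseteq> I" "X \<inter> Y = {}" "free X Y"
    and "x1 \<in> X" "x2 \<in> X" "x3 \<in> X" "distinct [x1, x2, x3]" "y1 \<in> Y" "y2 \<in> Y" "y1 \<noteq> y2"
    and "0 < w x1 x2" "0 < w x2 x3" "w x1 x3 < 1" "0 < w y1 y2"
  shows False
proof -
  have "w x3 x2 = w x2 x3" using sym[of x3 x2] assms by blast
  then show False
    by (intro inc_weights_C5[OF weights, of x1 y1 y2 x3 x2]) (use assms in \<open>auto simp: free_def disjoint_iff\<close>)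
qed

text \<open>The 5-cycle \<open>x1\<close>, \<open>x2\<close>, \<open>y1\<close>, \<open>x3\<close>,
  \<open>y2\<close>: the two points of \<open>Y\<close> are linked on one side by \<open>x3\<close>
  and on the other by the edge \<open>x1 x2\<close>.\<close>

lemma copath_nonedge_false:
  assumes "X \<subseteq> I" "Y \<subseteq> I" "X \<inter> Y = {}" "free X Y"
    and "x1 \<in> X" "x2 \<in> X" "x3 \<in> X" "distinct [x1, x2, x3]" "y1 \<in> Y" "y2 \<in> Y" "y1 \<noteq> y2"
    and "0 < w x1 x2" "w x1 x3 < 1" "w x2 x3 < 1" "w y1 y2 < 1"
  shows False
  by (intro inc_weights_C5[OF weights, of x1 x2 y1 x3 y2]) (use assms in \<open>auto simp: free_def disjoint_iff\<close>)

end

section \<open>Cloning the points of a non-null set of free triangles\<close>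

lemma AE_PiM_union:
  assumes "prob_space M" "finite I" "finite J" "I \<inter> J = {}" "AE f in PiM (I \<union> J) (\<lambda>_. M). P f"
  shows "AE f in PiM I (\<lambda>_. M). AE g in PiM J (\<lambda>_. M). P (merge I J (f, g))"
proof -
  interpret M: prob_space M by fact
  interpret product_sigma_finite "\<lambda>_. M" by unfold_locales
  interpret I: prob_space "PiM I (\<lambda>_. M)" by (intro prob_space_PiM assms)
  interpret J: prob_space "PiM J (\<lambda>_. M)" by (intro prob_space_PiM assms)
  interpret pair_sigma_finite "PiM I (\<lambda>_. M)" "PiM J (\<lambda>_. M)" ..
  have eq: "distr (PiM I (\<lambda>_. M) \<Otimes>\<^sub>M PiM J (\<lambda>_. M)) (PiM (I \<union> J) (\<lambda>_. M)) (merge I J) = PiM (I \<union> J) (\<lambda>_. M)"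
    by (rule distr_merge[OF assms(4,2,3)])
  have "AE z in PiM I (\<lambda>_. M) \<Otimes>\<^sub>M PiM J (\<lambda>_. M). P (merge I J z)"
    by (rule AE_distrD[OF measurable_merge], unfold eq, rule assms(5))
  from AE_pair[OF this] show ?thesis .
qed

text \<open>The first premise says that \<open>P\<close> is not null without asking for
  measurability; in such a set an almost sure property can still be met.\<close>

lemma not_AE_obtain:
  assumes "\<not> (AE x in M. \<not> P x)" "AE x in M. R x"
  obtains x where "x \<in> space M" "P x" "R x"
proof -
  have "\<not> (AE x in M. \<not> (P x \<and> R x))"
  proof
    assume "AE x in M. \<not> (P x \<and> R x)"
    with assms(2) have "AE x in M. \<not> P x" by eventually_elim auto
    with assms(1) show False by simp
  qed
  then show thesis using that by (metis (mono_tags, lifting) AE_I2)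
qed

lemma not_AE_triple:
  assumes "\<not> (AE x in M. \<not> P x)"
  shows "\<not> (AE x in M. AE y in M. AE z in M. \<not> (P x \<and> P y \<and> P z))"
proof
  assume 1: "AE x in M. AE y in M. AE z in M. \<not> (P x \<and> P y \<and> P z)"
  obtain x where x: "P x" "AE y in M. AE z in M. \<not> (P x \<and> P y \<and> P z)"
    using not_AE_obtain[OF assms 1] by blast
  obtain y where "P y" "AE z in M. \<not> (P x \<and> P y \<and> P z)"
    using not_AE_obtain[OF assms x(2)] by blast
  with x show False using assms by simp
qed

text \<open>Double counting, as for complete bipartite subgraphs of dense graphs. Fix a typical
  \<open>z\<close>. If the free triangles on \<open>z\<close> are not null, then a non-null set of
  points \<open>x\<close> sees a non-null set of triples of \<open>y\<close>. Exchanging the order,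
  some triple has a non-null set of common \<open>x\<close>, from which three are drawn one by
  one.\<close>

lemma AE_no_free_triangle:
  fixes W
  assumes "represents W \<Gamma>" "\<Gamma> \<in> class_limits INC"
  defines "E \<equiv> \<lambda>x y. 0 < W x y \<and> W x y < 1"
  shows "AE x in unit_leb. AE y in unit_leb. AE z in unit_leb. \<not> (E x y \<and> E y z \<and> E x z)"
proof -
  let ?M = unit_leb and ?J = "{3, 4, 5 :: nat}"
  interpret M: prob_space ?M by (rule prob_space_unit_leb)
  interpret J: prob_space "PiM ?J (\<lambda>_. ?M)" by (intro prob_space_PiM prob_space_unit_leb)
  interpret MJ: pair_sigma_finite ?M "PiM ?J (\<lambda>_. ?M)" ..
  have W: "graphon W" using assms by (simp add: represents_def)
  have Wsym: "W x y = W y x" if "x \<in> {0..1}" "y \<in> {0..1}" for x y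
    using W that by (simp add: graphon_def)
  \<comment> \<open>Coordinates 0 to 2 hold the clones of \<open>x\<close>, 3 to 5 those of
    \<open>y\<close>, and 6 is \<open>z\<close>. The quantifiers are peeled off in the order
    \<open>z\<close>, then the triple of \<open>y\<close>, then the points \<open>x\<close>, in
    which the points are chosen.\<close>
  define good where "good f \<longleftrightarrow> inc_weights {..<7} (\<lambda>i j. W (f i) (f j)) \<and> (\<forall>i<7. f i \<in> {0..1})" for f :: "nat \<Rightarrow> real"
  have "AE f in PiM {..<7} (\<lambda>_. ?M). good f"
    using AE_inc_weights[OF assms(1,2), of "{..<7}"] AE_space
  proof eventually_elim
    case (elim f)
    have "f i \<in> {0..1}" if "i < 7" for i
      using elim(2) that PiE_mem[of f "{..<7}" "\<lambda>_. {0..1}" i] by (simp add: space_PiM)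
    with elim(1) show ?case by (simp only: good_def) blast
  qed
  moreover have "{..<7} = insert 6 (?J \<union> {..<3})"
    by (intro set_eqI) (simp, presburger)
  ultimately have "AE f in PiM (insert 6 (?J \<union> {..<3})) (\<lambda>_. ?M). good f" by (simp only:)
  then have "AE z in ?M. AE f in PiM (?J \<union> {..<3}) (\<lambda>_. ?M). good (f(6 := z))"
    by (rule AE_PiM_insert[OF prob_space_unit_leb])
  then have "AE z in ?M. AE y in PiM ?J (\<lambda>_. ?M). AEs ?M 3 (\<lambda>x. good ((merge ?J {..<3} (y, x))(6 := z)))"
  proof eventually_elim
    case (elim z)
    have "AE y in PiM ?J (\<lambda>_. ?M). AE x in PiM {..<3} (\<lambda>_. ?M). good ((merge ?J {..<3} (y, x))(6 := z))"
      by (rule AE_PiM_union[OF prob_space_unit_leb _ _ _ elim]) auto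
    then show ?case
      by eventually_elim (rule AE_PiM_imp_AEs[OF prob_space_unit_leb])
  qed
  then have "AE z in ?M. AE x in ?M. AE y in ?M. \<not> (E z x \<and> E x y \<and> E z y)"
    using AE_space
  proof eventually_elim
    case (elim z)
    then have z: "z \<in> {0..1}" by simp
    define Q where "Q x y \<longleftrightarrow> E z x \<and> E x y \<and> E z y" for x y
    show ?case
    proof (rule ccontr)
      assume "\<not> (AE x in ?M. AE y in ?M. \<not> (E z x \<and> E x y \<and> E z y))"
      then have 0: "\<not> (AE x in ?M. AE y in ?M. \<not> Q x y)" by (simp add: Q_def)
      have 1: "\<not> (AE x in ?M. AE y in PiM ?J (\<lambda>_. ?M). \<not> (\<forall>j\<in>?J. Q x (y j)))"
      proof
        assume "AE x in ?M. AE y in PiM ?J (\<lambda>_. ?M). \<not> (\<forall>j\<in>?J. Q x (y j))"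
        then have "AE x in ?M. AE y in ?M. \<not> Q x y"
        proof eventually_elim
          case (elim x)
          have "AE a in ?M. AE b in ?M. AE f in PiM {3} (\<lambda>_. ?M). \<not> (\<forall>j\<in>?J. Q x ((f(4 := b, 5 := a)) j))"
          proof -
            have "AE f in PiM (insert 5 {3,4}) (\<lambda>_. ?M). \<not> (\<forall>j\<in>?J. Q x (f j))"
              using elim by (simp only: insert_commute)
            from AE_PiM_insert[OF prob_space_unit_leb this]
            show ?thesis
            proof eventually_elim
              case (elim a)
              have "AE f in PiM (insert 4 {3}) (\<lambda>_. ?M). \<not> (\<forall>j\<in>?J. Q x ((f(5 := a)) j))"
                using elim by (simp only: insert_commute)
              from AE_PiM_insert[OF prob_space_unit_leb this] show ?case .
            qed
          qed
          then have "AE a in ?M. AE b in ?M. AE c in ?M. \<not> (Q x a \<and> Q x b \<and> Q x c)"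
          proof eventually_elim
            case (elim a) then show ?case
            proof eventually_elim
              case (elim b)
              have "AE c in ?M. AE f in PiM {} (\<lambda>_. ?M). \<not> (\<forall>j\<in>?J. Q x (((f(3 := c))(4 := b, 5 := a)) j))"
                by (rule AE_PiM_insert[OF prob_space_unit_leb elim])
              then show ?case
              proof eventually_elim
                case (elim c)
                from AE_PiM_empty[OF this] show ?case by auto
              qed
            qed
          qed
          then show ?case using not_AE_triple[where M = ?M and P = "Q x"] by blast
        qed
        with 0 show False ..
      qed
      have Wm: "(\<lambda>p. W (f p) (g p)) \<in> borel_measurable N" if "f \<in> N \<rightarrow>\<^sub>M ?M" "g \<in> N \<rightarrow>\<^sub>M ?M" for f g and N :: "'z measure"
        using measurable_compose[OF measurable_Pair[OF that], of "\<lambda>(x, y). W x y" borel] W by (simp add: graphon_def)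
      have Em: "Measurable.pred N (\<lambda>p. E (f p) (g p))" if "f \<in> N \<rightarrow>\<^sub>M ?M" "g \<in> N \<rightarrow>\<^sub>M ?M" for f g and N :: "'z measure"
        using Wm[OF that] unfolding E_def by measurable
      \<comment> \<open>The exchange passes from triples seen by one \<open>x\<close> to common
        neighbours of one triple, and rests on the measurability of \<open>Q\<close>.\<close>
      have "\<not> (AE y in PiM ?J (\<lambda>_. ?M). AE x in ?M. \<not> (\<forall>j\<in>?J. Q x (y j)))"
      proof -
        have m: "Measurable.pred (?M \<Otimes>\<^sub>M PiM ?J (\<lambda>_. ?M)) (\<lambda>p. E z (fst p) \<and> E (fst p) (snd p j) \<and> E z (snd p j))" if "j \<in> ?J" for j
        proof -
          have c: "(\<lambda>_. z) \<in> ?M \<Otimes>\<^sub>M PiM ?J (\<lambda>_. ?M) \<rightarrow>\<^sub>M ?M"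
            using z by (intro measurable_const) simp
          have p: "(\<lambda>p. snd p j) \<in> ?M \<Otimes>\<^sub>M PiM ?J (\<lambda>_. ?M) \<rightarrow>\<^sub>M ?M"
            using that by (intro measurable_compose[OF measurable_snd] measurable_component_singleton)
          show ?thesis
            by (intro pred_intros_logic Em c p measurable_fst)
        qed
        have "Measurable.pred (?M \<Otimes>\<^sub>M PiM ?J (\<lambda>_. ?M)) (\<lambda>p. \<forall>j\<in>?J. Q (fst p) (snd p j))"
          unfolding Q_def by (intro pred_intros_finite m) auto
        then have "Measurable.pred (?M \<Otimes>\<^sub>M PiM ?J (\<lambda>_. ?M)) (\<lambda>p. \<not> (\<forall>j\<in>?J. Q (fst p) (snd p j)))"
          by (rule pred_intros_logic)
        then show ?thesis
          using 1 MJ.AE_commute[of "\<lambda>x y. \<not> (\<forall>j\<in>?J. Q x (y j))"] by (simp add: pred_def)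
      qed
      then have 2: "\<not> (AE y in PiM ?J (\<lambda>_. ?M). \<not> \<not> (AE x in ?M. \<not> (\<forall>j\<in>?J. Q x (y j))))"
        by simp
      obtain y where y: "y \<in> space (PiM ?J (\<lambda>_. ?M))" "\<not> (AE x in ?M. \<not> (\<forall>j\<in>?J. Q x (y j)))"
          "AEs ?M 3 (\<lambda>x. good ((merge ?J {..<3} (y, x))(6 := z)))"
        by (rule not_AE_obtain[OF 2 elim(1)])
      from y(3) have 3: "AE a in ?M. AE b in ?M. AE c in ?M. good ((merge ?J {..<3} (y, (\<lambda>_. undefined)(0 := c, 1 := b, 2 := a)))(6 := z))"
        by (simp add: AEs_numeral)
      obtain a where a: "\<forall>j\<in>?J. Q a (y j)"
        "AE b in ?M. AE c in ?M. good ((merge ?J {..<3} (y, (\<lambda>_. undefined)(0 := c, 1 := b, 2 := a)))(6 := z))"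
        by (rule not_AE_obtain[OF y(2) 3])
      obtain b where b: "\<forall>j\<in>?J. Q b (y j)"
        "AE c in ?M. good ((merge ?J {..<3} (y, (\<lambda>_. undefined)(0 := c, 1 := b, 2 := a)))(6 := z))"
        by (rule not_AE_obtain[OF y(2) a(2)])
      obtain c where c: "\<forall>j\<in>?J. Q c (y j)"
        "good ((merge ?J {..<3} (y, (\<lambda>_. undefined)(0 := c, 1 := b, 2 := a)))(6 := z))"
        by (rule not_AE_obtain[OF y(2) b(2)])
      define f where "f = (merge ?J {..<3} (y, (\<lambda>_. undefined)(0 := c, 1 := b, 2 := a)))(6 := z)"
      have f: "f 0 = c" "f 1 = b" "f 2 = a" "f 3 = y 3" "f 4 = y 4" "f 5 = y 5" "f 6 = z"
        by (simp_all add: f_def merge_def)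
      have good: "good f" using c(2) by (simp add: f_def)
      interpret inc_weighting "{..<7}" "\<lambda>i j. W (f i) (f j)"
        by unfold_locales (use good in \<open>auto simp: good_def intro!: Wsym\<close>)
      have r: "f i \<in> {0..1}" if "i < 7" for i using good that by (simp add: good_def)
      have "\<forall>i\<in>{0,1,2}. \<forall>j\<in>?J. Q (f i) (f j)"
        using a(1) b(1) c(1) f by auto
      then have q: "\<forall>i\<in>{0,1,2}. \<forall>j\<in>?J. E (f 6) (f i) \<and> E (f i) (f j) \<and> E (f 6) (f j)"
        using f(7) by (simp add: Q_def)
      have fr: "free {i} {j}" if "E (f i) (f j) \<or> E (f j) (f i)" "i < 7" "j < 7" for i j
        using that Wsym[OF r r, of i j] by (auto simp: free_def E_def)
      have fr': "free X Y" if "\<And>i j. i \<in> X \<Longrightarrow> j \<in> Y \<Longrightarrow> free {i} {j}" for X Y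
        using that unfolding free_def by blast
      have "free {0,1,2} {3,4,5}" "free {0,1,2} {6}" "free {3,4,5} {6}"
        by (rule fr', rule fr; use q in auto)+
      then show False
        by (intro free_triangle_false[of "{0,1,2}" "{3,4,5}" 6 0 1 2 3 4 5]) auto
    qed
  qed
  then show ?thesis .
qed

section \<open>Densities of step graphons\<close>

lemma AE_pair_of_iterated:
  assumes "AE y in unit_leb. AE z in unit_leb. R y z" "Measurable.pred (unit_leb \<Otimes>\<^sub>M unit_leb) (\<lambda>p. R (fst p) (snd p))"
  shows "AE p in unit_leb \<Otimes>\<^sub>M unit_leb. R (fst p) (snd p)"
proof -
  interpret M: prob_space unit_leb by (rule prob_space_unit_leb)
  interpret pair_sigma_finite unit_leb unit_leb ..
  show ?thesis
    using assms AE_pair_iff[of R] by (simp add: pred_def)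
qed

text \<open>Sorting the points of the cube by their labels splits it into boxes on which the
  integrand is almost everywhere constant. Only the measures of the steps and the matrix
  \<open>S\<close> survive, which is how different step graphons are seen to represent the same
  limit.\<close>

lemma graphon_density_step:
  fixes c :: "real \<Rightarrow> nat"
  assumes W: "graphon W" and F: "pair_graph F"
    and c: "c \<in> unit_leb \<rightarrow>\<^sub>M count_space UNIV" "c \<in> {0..1} \<rightarrow> L" "finite L"
    and step: "AE y in unit_leb. AE z in unit_leb. W y z = S (c y) (c z)"
  shows "graphon_density F W = (\<Sum>g\<in>pverts F \<rightarrow>\<^sub>E L.
    (\<Prod>v\<in>pverts F. measure unit_leb {x\<in>{0..1}. c x = g v}) * (\<Prod>(u, v)\<in>{(u, v). (u, v) \<in> parcs F \<and> u < v}. S (g u) (g v)))"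
proof -
  let ?V = "pverts F" and ?P = "{(u, v). (u, v) \<in> parcs F \<and> u < v}"
  let ?M = "PiM ?V (\<lambda>_. unit_leb)"
  let ?S = "\<lambda>g. \<Prod>(u, v)\<in>?P. S (g u) (g v)"
  have fV: "finite ?V" and fP: "finite ?P" and P: "?P \<subseteq> ?V \<times> ?V"
    using pair_graphD[OF F] finite_subset[of ?P "parcs F"] by auto
  interpret U: prob_space unit_leb by (rule prob_space_unit_leb)
  interpret M: finite_product_prob_space "\<lambda>_. unit_leb" ?V
    by unfold_locales (rule fV)
  have "AE p in unit_leb \<Otimes>\<^sub>M unit_leb. W (fst p) (snd p) = S (c (fst p)) (c (snd p))"
  proof (rule AE_pair_of_iterated[OF step])
    have [measurable]: "(\<lambda>p. W (fst p) (snd p)) \<in> borel_measurable (unit_leb \<Otimes>\<^sub>M unit_leb)"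
      using W by (simp add: graphon_def case_prod_beta')
    have [measurable]: "(\<lambda>p. S (c (fst p)) (c (snd p))) \<in> borel_measurable (unit_leb \<Otimes>\<^sub>M unit_leb)"
      by (rule measurable_compose_countable[where f = "\<lambda>i p. S i (c (snd p))" and g = "\<lambda>p. c (fst p)"],
          rule measurable_compose_countable[where f = "\<lambda>j p. S i j" and g = "\<lambda>p. c (snd p)" for i])
        (use c(1) in \<open>auto intro: measurable_compose[OF measurable_fst] measurable_compose[OF measurable_snd]\<close>)
    show "Measurable.pred (unit_leb \<Otimes>\<^sub>M unit_leb) (\<lambda>p. W (fst p) (snd p) = S (c (fst p)) (c (snd p)))"
      by measurable
  qed
  then have "AE x in ?M. W (x (fst e)) (x (snd e)) = S (c (x (fst e))) (c (x (snd e)))" if "e \<in> ?P" for e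
    using that P by (intro AE_PiM_pair[OF prob_space_unit_leb]) auto
  then have 1: "AE x in ?M. \<forall>e\<in>?P. W (x (fst e)) (x (snd e)) = S (c (x (fst e))) (c (x (snd e)))"
    by (intro AE_finite_allI fP)
  define D where "D g = {x \<in> {0..1::real}. c x = g}" for g
  have D: "D g \<in> sets unit_leb" for g
    using measurable_sets[OF c(1), of "{g}"] by (simp add: D_def vimage_def Int_def conj_commute)
  let ?I = "\<lambda>x. \<Sum>g\<in>?V \<rightarrow>\<^sub>E L. indicator (Pi\<^sub>E ?V (\<lambda>v. D (g v))) x * ?S g"
  have Dm: "Pi\<^sub>E ?V (\<lambda>v. D (g v)) \<in> sets ?M" for g
    using D by (intro sets_PiM_I_finite fV) auto
  have eq: "?I x = (\<Prod>(u, v)\<in>?P. S (c (x u)) (c (x v)))" if x: "x \<in> space ?M" for x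
  proof -
    let ?g = "\<lambda>v\<in>?V. c (x v)"
    have x01: "x v \<in> {0..1}" if "v \<in> ?V" for v
      using x that by (auto simp: space_PiM dest: PiE_mem)
    have g: "?g \<in> ?V \<rightarrow>\<^sub>E L"
      using c(2) x01 by auto
    have "indicator (Pi\<^sub>E ?V (\<lambda>v. D (g v))) x = (if g = ?g then 1 else (0::real))" if "g \<in> ?V \<rightarrow>\<^sub>E L" for g
    proof -
      have "x \<in> Pi\<^sub>E ?V (\<lambda>v. D (g v)) \<longleftrightarrow> (\<forall>v\<in>?V. g v = c (x v))"
        using x x01 by (auto simp: PiE_iff D_def space_PiM)
      also have "\<dots> \<longleftrightarrow> g = ?g"
        using that by (auto simp: PiE_iff extensional_def fun_eq_iff)
      finally show ?thesis by (simp add: indicator_def)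
    qed
    then have "?I x = (\<Sum>g\<in>?V \<rightarrow>\<^sub>E L. if g = ?g then ?S g else 0)"
      by (intro sum.cong refl) auto
    also have "\<dots> = ?S ?g"
      using g fV c(3) by (simp add: finite_PiE)
    also have "\<dots> = (\<Prod>(u, v)\<in>?P. S (c (x u)) (c (x v)))"
      using P by (intro prod.cong refl) auto
    finally show ?thesis .
  qed
  have "graphon_density F W = (\<integral>x. (\<Prod>e\<in>?P. W (x (fst e)) (x (snd e))) \<partial>?M)"
    by (simp add: graphon_density_def case_prod_beta')
  also have "\<dots> = (\<integral>x. ?I x \<partial>?M)"
  proof (rule integral_cong_AE)
    show "(\<lambda>x. \<Prod>e\<in>?P. W (x (fst e)) (x (snd e))) \<in> borel_measurable ?M"
      using P by (intro borel_measurable_prod graphon_measurable_edge W) auto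
    show "?I \<in> borel_measurable ?M"
      using Dm by measurable
    show "AE x in ?M. (\<Prod>e\<in>?P. W (x (fst e)) (x (snd e))) = ?I x"
      using 1 AE_space
    proof eventually_elim
      case (elim x)
      then show ?case unfolding eq[OF elim(2)] by (intro prod.cong refl) auto
    qed
  qed
  also have "\<dots> = (\<Sum>g\<in>?V \<rightarrow>\<^sub>E L. (\<integral>x. indicator (Pi\<^sub>E ?V (\<lambda>v. D (g v))) x * ?S g \<partial>?M))"
    using Dm by (intro Bochner_Integration.integral_sum integrable_mult_left integrable_real_indicator)
      (auto simp: less_top[symmetric] M.emeasure_finite)
  also have "\<dots> = (\<Sum>g\<in>?V \<rightarrow>\<^sub>E L. (\<Prod>v\<in>?V. measure unit_leb (D (g v))) * ?S g)"
    using Dm D by (intro sum.cong refl) (simp add: M.prob_times)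
  finally show ?thesis by (simp add: D_def)
qed

section \<open>Kleitman--Rothschild orders\<close>

text \<open>Labels 0 and 1 stand for the pieces \<open>[0, a/2)\<close> and
  \<open>[a/2, 1/2)\<close>, label 2 for \<open>[1/2, 1)\<close>. In the orders below they are the
  bottom, top and middle layers: layers are antichains, hence cliques, and the whole bottom lies
  below the whole top, hence the value 0.\<close>

definition block_weight :: "nat \<Rightarrow> nat \<Rightarrow> real" where
  "block_weight i j = (if (i = 2) \<noteq> (j = 2) then 1/2 else if i = j then 1 else 0)"

definition block_measure :: "real \<Rightarrow> nat \<Rightarrow> real" where
  "block_measure a j = (if j = 0 then a/2 else if j = 1 then (1 - a)/2 else 1/2)"

definition block_density :: "nat pair_pre_digraph \<Rightarrow> real \<Rightarrow> real" where
  "block_density F a = (\<Sum>l\<in>pverts F \<rightarrow>\<^sub>E {0, 1, 2}. (\<Prod>v\<in>pverts F. block_measure a (l v)) *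
     (\<Prod>(u, v)\<in>{(u, v). (u, v) \<in> parcs F \<and> u < v}. block_weight (l u) (l v)))"

type_synonym kr_vertex = "(bool \<times> nat) \<times> nat set"

text \<open>A Kleitman--Rothschild order with three layers: the vertices \<open>((True, i), T)\<close> with \<open>i < m\<close> form
  the bottom layer and those with \<open>m \<le> i\<close> the top layer; the vertices \<open>((False, i), T)\<close> form the middle
  layer and are incomparable to the outer vertices whose index lies in \<open>T\<close>. The unused third
  coordinates blow up the layers to their proper sizes, so that comparabilities of a vertex with
  distinct indices become independent fair bits.\<close>

definition kr_less :: "nat \<Rightarrow> kr_vertex \<Rightarrow> kr_vertex \<Rightarrow> bool" where
  "kr_less m p q \<longleftrightarrow>
     (if fst (fst p) then
        snd (fst p) < m \<and> (if fst (fst q) then m \<le> snd (fst q) else snd (fst p) \<notin> snd q)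
      else fst (fst q) \<and> m \<le> snd (fst q) \<and> snd (fst q) \<notin> snd p)"

definition kr_adj :: "nat \<Rightarrow> kr_vertex \<Rightarrow> kr_vertex \<Rightarrow> bool" where
  "kr_adj m p q \<longleftrightarrow> p \<noteq> q \<and> \<not> kr_less m p q \<and> \<not> kr_less m q p"

definition kr_index :: "nat \<Rightarrow> (bool \<times> nat) set" where
  "kr_index k = UNIV \<times> {..<k}"

definition kr_vertices :: "nat \<Rightarrow> kr_vertex set" where
  "kr_vertices k = kr_index k \<times> Pow {..<k}"

definition kr_label :: "nat \<Rightarrow> bool \<times> nat \<Rightarrow> nat" where
  "kr_label m p = (if fst p then if snd p < m then 0 else 1 else 2)"

lemma kr_finite [simp]: "finite (kr_index k)" "finite (kr_vertices k)"
  by (simp_all add: kr_index_def kr_vertices_def)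

lemma kr_card: "card (kr_index k) = 2 * k" "card (kr_vertices k) = 2 * k * 2 ^ k"
  by (simp_all add: kr_index_def kr_vertices_def card_cartesian_product card_Pow)

lemma kr_less_irrefl: "\<not> kr_less m p p"
  by (auto simp: kr_less_def)

text \<open>A chain of three vertices runs through bottom, middle and top, and bottom and top are
  always comparable.\<close>

lemma kr_less_trans: "kr_less m p q \<Longrightarrow> kr_less m q r \<Longrightarrow> kr_less m p r"
  by (auto simp: kr_less_def split: if_splits)

lemma digraph_iso_refl:
  assumes "pair_graph G"
  shows "digraph_iso (with_proj G) (with_proj G)"
proof -
  interpret pair_graph G by fact
  let ?f = "\<lparr>iso_verts = id, iso_arcs = id, iso_head = snd, iso_tail = fst\<rparr>"
  have "pre_digraph.digraph_isomorphism (with_proj G) ?f"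
    using wf_digraph_axioms by (auto simp: pre_digraph.digraph_isomorphism_def)
  moreover have "with_proj G = app_iso ?f (with_proj G)"
    by (simp add: app_iso_def with_proj_def)
  ultimately show ?thesis unfolding digraph_iso_def by blast
qed

lemma incomparability_graph_in_INC:
  assumes "irrefl_on {1..n} r" "trans_on {1..n} r"
  shows "incomparability_graph n r \<in> INC"
proof -
  have G: "pair_graph (incomparability_graph n r)"
    by (rule pair_graphI) (auto simp: incomparability_graph_def)
  show ?thesis
    unfolding INC_def using G digraph_iso_refl[OF G] assms by blast
qed

text \<open>The order is transported to an initial segment of the naturals, as \<open>INC\<close>
  demands, while homomorphisms are still counted on the structured vertices.\<close>

lemma kr_graph_exists:
  obtains G where "G \<in> INC" "card (pverts G) = 2 * k * 2 ^ k"
    "\<And>F. hom_density F G =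
       real (card {f \<in> pverts F \<rightarrow>\<^sub>E kr_vertices k. \<forall>(u, v)\<in>parcs F. u \<in> pverts F \<and> v \<in> pverts F \<and> kr_adj m (f u) (f v)})
         / real (2 * k * 2 ^ k) ^ card (pverts F) \<or> \<not> pair_graph F"
proof -
  let ?n = "2 * k * 2 ^ k" and ?X = "kr_vertices k"
  obtain e where e: "bij_betw e {1..?n} ?X"
    using ex_bij_betw_nat_finite_1[of ?X] by (auto simp: kr_card)
  define r where "r = {(p, q). kr_less m (e p) (e q)}"
  define G where "G = incomparability_graph ?n r"
  have V: "pverts G = {1..?n}" by (simp add: G_def incomparability_graph_def)
  have arc: "(p, q) \<in> parcs G \<longleftrightarrow> kr_adj m (e p) (e q)" if "p \<in> {1..?n}" "q \<in> {1..?n}" for p q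
    using that e unfolding G_def incomparability_graph_def kr_adj_def r_def
    by (auto simp: bij_betw_def inj_on_def)
  have "G \<in> INC"
    unfolding G_def
  proof (rule incomparability_graph_in_INC)
    show "irrefl_on {1..?n} r" by (simp add: irrefl_on_def r_def kr_less_irrefl)
    show "trans_on {1..?n} r" unfolding trans_on_def r_def using kr_less_trans by blast
  qed
  moreover have "card (pverts G) = ?n" by (simp add: V)
  moreover have "hom_density F G =
       real (card {f \<in> pverts F \<rightarrow>\<^sub>E ?X. \<forall>(u, v)\<in>parcs F. u \<in> pverts F \<and> v \<in> pverts F \<and> kr_adj m (f u) (f v)}) / real ?n ^ card (pverts F)"
    if F: "pair_graph F" for F
  proof -
    let ?V = "pverts F"
    let ?H = "{f \<in> ?V \<rightarrow>\<^sub>E pverts G. \<forall>(u, v)\<in>parcs F. (f u, f v) \<in> parcs G}"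
    let ?K = "{f \<in> ?V \<rightarrow>\<^sub>E ?X. \<forall>(u, v)\<in>parcs F. u \<in> pverts F \<and> v \<in> pverts F \<and> kr_adj m (f u) (f v)}"
    define d where "d = the_inv_into {1..?n} e"
    have d: "\<And>p. p \<in> {1..?n} \<Longrightarrow> d (e p) = p" "\<And>x. x \<in> ?X \<Longrightarrow> e (d x) = x" "\<And>x. x \<in> ?X \<Longrightarrow> d x \<in> {1..?n}"
      "\<And>p. p \<in> {1..?n} \<Longrightarrow> e p \<in> ?X"
      using e unfolding d_def bij_betw_def
      by (auto simp: the_inv_into_f_f f_the_inv_into_f dest: the_inv_into_into[OF _ _ subset_refl])
    have FV: "u \<in> ?V" "v \<in> ?V" if "(u, v) \<in> parcs F" for u v
      using pair_graphD(3)[OF F that] by auto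
    have "bij_betw (\<lambda>f. \<lambda>v\<in>?V. e (f v)) ?H ?K"
    proof (rule bij_betw_byWitness[where f' = "\<lambda>f. \<lambda>v\<in>?V. d (f v)"])
      show "\<forall>f\<in>?H. (\<lambda>v\<in>?V. d ((\<lambda>v\<in>?V. e (f v)) v)) = f"
      proof
        fix f assume "f \<in> ?H"
        then have f: "f \<in> ?V \<rightarrow>\<^sub>E {1..?n}" using V by simp
        show "(\<lambda>v\<in>?V. d ((\<lambda>v\<in>?V. e (f v)) v)) = f"
        proof
          fix v show "(\<lambda>v\<in>?V. d ((\<lambda>v\<in>?V. e (f v)) v)) v = f v"
            using f d(1) PiE_mem[OF f] PiE_arb[OF f] by (cases "v \<in> ?V") simp_all
        qed
      qed
      show "\<forall>f\<in>?K. (\<lambda>v\<in>?V. e ((\<lambda>v\<in>?V. d (f v)) v)) = f"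
      proof
        fix f assume "f \<in> ?K"
        then have f: "f \<in> ?V \<rightarrow>\<^sub>E ?X" by simp
        show "(\<lambda>v\<in>?V. e ((\<lambda>v\<in>?V. d (f v)) v)) = f"
        proof
          fix v show "(\<lambda>v\<in>?V. e ((\<lambda>v\<in>?V. d (f v)) v)) v = f v"
            using f d(2) PiE_mem[OF f] PiE_arb[OF f] by (cases "v \<in> ?V") simp_all
        qed
      qed
      show "(\<lambda>f. \<lambda>v\<in>?V. e (f v)) ` ?H \<subseteq> ?K"
      proof
        fix h assume "h \<in> (\<lambda>f. \<lambda>v\<in>?V. e (f v)) ` ?H"
        then obtain f where h: "h = (\<lambda>v\<in>?V. e (f v))" and "f \<in> ?H" by blast
        then have f: "f \<in> ?V \<rightarrow>\<^sub>E {1..?n}" and fa: "\<And>u v. (u, v) \<in> parcs F \<Longrightarrow> (f u, f v) \<in> parcs G"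
          using V by auto
        have "h \<in> ?V \<rightarrow>\<^sub>E ?X"
          unfolding h using PiE_mem[OF f] d(4) by (intro restrict_PiE_iff[THEN iffD2]) blast
        moreover have "kr_adj m (h u) (h v)" if "(u, v) \<in> parcs F" for u v
          using FV[OF that] fa[OF that] arc[of "f u" "f v"] PiE_mem[OF f] by (simp add: h)
        ultimately show "h \<in> ?K" using FV by blast
      qed
      show "(\<lambda>f. \<lambda>v\<in>?V. d (f v)) ` ?K \<subseteq> ?H"
      proof
        fix h assume "h \<in> (\<lambda>f. \<lambda>v\<in>?V. d (f v)) ` ?K"
        then obtain f where h: "h = (\<lambda>v\<in>?V. d (f v))" and "f \<in> ?K" by blast
        then have f: "f \<in> ?V \<rightarrow>\<^sub>E ?X" and fa: "\<And>u v. (u, v) \<in> parcs F \<Longrightarrow> kr_adj m (f u) (f v)"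
          by auto
        have "h \<in> ?V \<rightarrow>\<^sub>E {1..?n}"
          unfolding h using PiE_mem[OF f] d(3) by (intro restrict_PiE_iff[THEN iffD2]) blast
        moreover have "(h u, h v) \<in> parcs G" if "(u, v) \<in> parcs F" for u v
          using FV[OF that] fa[OF that] arc[of "d (f u)" "d (f v)"] PiE_mem[OF f] d(2,3) by (simp add: h)
        ultimately show "h \<in> ?H" using V by auto
      qed
    qed
    then have "card ?H = card ?K" by (rule bij_betw_same_card)
    then show ?thesis by (simp add: hom_density_def V)
  qed
  ultimately show thesis using that by blast
qed

section \<open>Counting maps into Kleitman--Rothschild orders\<close>

lemma sum_PiE_Times:
  "(\<Sum>f\<in>V \<rightarrow>\<^sub>E Y \<times> Z. \<phi> f) = (\<Sum>g\<in>V \<rightarrow>\<^sub>E Y. \<Sum>T\<in>V \<rightarrow>\<^sub>E Z. \<phi> (\<lambda>v\<in>V. (g v, T v)))"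
proof -
  have "(\<Sum>f\<in>V \<rightarrow>\<^sub>E Y \<times> Z. \<phi> f) = (\<Sum>p\<in>(V \<rightarrow>\<^sub>E Y) \<times> (V \<rightarrow>\<^sub>E Z). \<phi> (\<lambda>v\<in>V. (fst p v, snd p v)))"
  proof (rule sum.reindex_bij_witness[where i = "\<lambda>p. \<lambda>v\<in>V. (fst p v, snd p v)"
        and j = "\<lambda>f. (\<lambda>v\<in>V. fst (f v), \<lambda>v\<in>V. snd (f v))"])
    fix f assume f: "f \<in> V \<rightarrow>\<^sub>E Y \<times> Z"
    show eq: "(\<lambda>v\<in>V. (fst (\<lambda>v\<in>V. fst (f v), \<lambda>v\<in>V. snd (f v)) v, snd (\<lambda>v\<in>V. fst (f v), \<lambda>v\<in>V. snd (f v)) v)) = f"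
      using PiE_arb[OF f] by (auto simp: fun_eq_iff)
    then show "\<phi> (\<lambda>v\<in>V. (fst (\<lambda>v\<in>V. fst (f v), \<lambda>v\<in>V. snd (f v)) v, snd (\<lambda>v\<in>V. fst (f v), \<lambda>v\<in>V. snd (f v)) v)) = \<phi> f"
      by simp
    show "(\<lambda>v\<in>V. fst (f v), \<lambda>v\<in>V. snd (f v)) \<in> (V \<rightarrow>\<^sub>E Y) \<times> (V \<rightarrow>\<^sub>E Z)"
      using PiE_mem[OF f] by (auto simp: mem_Times_iff)
  next
    fix p assume "p \<in> (V \<rightarrow>\<^sub>E Y) \<times> (V \<rightarrow>\<^sub>E Z)"
    then have p: "fst p \<in> V \<rightarrow>\<^sub>E Y" "snd p \<in> V \<rightarrow>\<^sub>E Z" by auto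
    show "(\<lambda>v\<in>V. (fst p v, snd p v)) \<in> V \<rightarrow>\<^sub>E Y \<times> Z"
      using PiE_mem[OF p(1)] PiE_mem[OF p(2)] by auto
    show "(\<lambda>v\<in>V. fst ((\<lambda>v\<in>V. (fst p v, snd p v)) v), \<lambda>v\<in>V. snd ((\<lambda>v\<in>V. (fst p v, snd p v)) v)) = p"
      using PiE_arb[OF p(1)] PiE_arb[OF p(2)] by (auto simp: fun_eq_iff prod_eq_iff)
  qed
  then show ?thesis by (simp add: sum.cartesian_product case_prod_beta')
qed

lemma sum_PiE_label:
  fixes H :: "('v \<Rightarrow> 'l) \<Rightarrow> real"
  assumes "finite V" "finite Y" "finite L" "c \<in> Y \<rightarrow> L"
  shows "(\<Sum>g\<in>V \<rightarrow>\<^sub>E Y. H (\<lambda>v\<in>V. c (g v))) = (\<Sum>l\<in>V \<rightarrow>\<^sub>E L. (\<Prod>v\<in>V. real (card {y \<in> Y. c y = l v})) * H l)"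
proof -
  let ?c = "\<lambda>g. \<lambda>v\<in>V. c (g v)"
  have "(\<Sum>g\<in>V \<rightarrow>\<^sub>E Y. H (?c g)) = (\<Sum>l\<in>V \<rightarrow>\<^sub>E L. \<Sum>g\<in>{g \<in> V \<rightarrow>\<^sub>E Y. ?c g = l}. H (?c g))"
    using assms by (intro sum.group[symmetric] finite_PiE) auto
  also have "\<dots> = (\<Sum>l\<in>V \<rightarrow>\<^sub>E L. (\<Prod>v\<in>V. real (card {y \<in> Y. c y = l v})) * H l)"
  proof (rule sum.cong[OF refl])
    fix l assume l: "l \<in> V \<rightarrow>\<^sub>E L"
    have "{g \<in> V \<rightarrow>\<^sub>E Y. ?c g = l} = (\<Pi>\<^sub>E v\<in>V. {y \<in> Y. c y = l v})"
    proof (intro set_eqI iffI)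
      fix g assume "g \<in> {g \<in> V \<rightarrow>\<^sub>E Y. ?c g = l}"
      then show "g \<in> (\<Pi>\<^sub>E v\<in>V. {y \<in> Y. c y = l v})" by (auto simp: PiE_iff)
    next
      fix g assume g: "g \<in> (\<Pi>\<^sub>E v\<in>V. {y \<in> Y. c y = l v})"
      then have "?c g v = l v" for v
        using PiE_arb[OF l, of v] by (cases "v \<in> V") (auto simp: PiE_iff)
      then show "g \<in> {g \<in> V \<rightarrow>\<^sub>E Y. ?c g = l}" using g by (auto simp: PiE_iff fun_eq_iff)
    qed
    then have "card {g \<in> V \<rightarrow>\<^sub>E Y. ?c g = l} = (\<Prod>v\<in>V. card {y \<in> Y. c y = l v})"
      using assms(1) by (simp add: card_PiE)
    moreover have "(\<Sum>g\<in>{g \<in> V \<rightarrow>\<^sub>E Y. ?c g = l}. H (?c g)) = real (card {g \<in> V \<rightarrow>\<^sub>E Y. ?c g = l}) * H l"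
      by simp
    ultimately show "(\<Sum>g\<in>{g \<in> V \<rightarrow>\<^sub>E Y. ?c g = l}. H (?c g)) = (\<Prod>v\<in>V. real (card {y \<in> Y. c y = l v})) * H l"
      by simp
  qed
  finally show ?thesis .
qed

lemma card_supersets:
  assumes "finite A" "J \<subseteq> A"
  shows "card {T \<in> Pow A. J \<subseteq> T} = 2 ^ (card A - card J)"
proof -
  have "bij_betw (\<lambda>T. T \<union> J) (Pow (A - J)) {T \<in> Pow A. J \<subseteq> T}"
    by (rule bij_betw_byWitness[where f' = "\<lambda>T. T - J"]) (use assms in auto)
  from bij_betw_same_card[OF this] show ?thesis
    using assms by (simp add: card_Pow card_Diff_subset finite_subset)
qed

text \<open>The index at \<open>u\<close> repeats the one at \<open>v\<close>, so \<open>g\<close>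
  is determined by one bit and its restriction off \<open>u\<close>. This saves a factor
  \<open>k\<close>.\<close>

lemma card_PiE_coincidence:
  assumes "finite V" "u \<in> V" "v \<in> V" "u \<noteq> v"
  shows "card {g \<in> V \<rightarrow>\<^sub>E kr_index k. snd (g u) = snd (g v)} * k \<le> (2 * k) ^ card V"
proof -
  let ?G = "{g \<in> V \<rightarrow>\<^sub>E kr_index k. snd (g u) = snd (g v)}"
  let ?h = "\<lambda>g. (fst (g u), restrict g (V - {u}))"
  have "inj_on ?h ?G"
  proof (rule inj_onI)
    fix g g' assume g: "g \<in> ?G" "g' \<in> ?G" "?h g = ?h g'"
    have eq: "g w = g' w" if "w \<in> V - {u}" for w
      using g(3) that by (metis Pair_inject restrict_apply')
    have "g u = g' u"
      using g eq[of v] assms by (auto simp: prod_eq_iff)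
    with eq have "g w = g' w" if "w \<in> V" for w using that by (cases "w = u") auto
    then show "g = g'"
      using g by (auto intro!: PiE_ext[of g V "\<lambda>_. kr_index k" g'])
  qed
  moreover have "?h ` ?G \<subseteq> (UNIV :: bool set) \<times> (V - {u} \<rightarrow>\<^sub>E kr_index k)"
  proof (rule image_subsetI)
    fix g assume "g \<in> ?G"
    then have "g w \<in> kr_index k" if "w \<in> V" for w using that PiE_mem[of g V "\<lambda>_. kr_index k" w] by simp
    then have "restrict g (V - {u}) \<in> V - {u} \<rightarrow>\<^sub>E kr_index k"
      by (intro restrict_PiE_iff[THEN iffD2]) auto
    then show "?h g \<in> (UNIV :: bool set) \<times> (V - {u} \<rightarrow>\<^sub>E kr_index k)" by simp
  qed
  moreover have "finite ((UNIV :: bool set) \<times> (V - {u} \<rightarrow>\<^sub>E kr_index k))"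
    using assms(1) by (intro finite_cartesian_product finite_PiE) auto
  ultimately have "card ?G \<le> card ((UNIV :: bool set) \<times> (V - {u} \<rightarrow>\<^sub>E kr_index k))"
    by (rule card_inj_on_le)
  also have "\<dots> = 2 * (2 * k) ^ (card V - 1)"
    using assms by (simp add: card_cartesian_product card_PiE kr_card)
  finally have "card ?G * k \<le> 2 * (2 * k) ^ (card V - 1) * k" by simp
  also have "\<dots> = (2 * k) ^ card V"
  proof -
    have "card V \<noteq> 0" using assms by auto
    then obtain n where "card V = Suc n" using not0_implies_Suc by blast
    then show ?thesis by simp
  qed
  finally show ?thesis .
qed

text \<open>A union bound over at most \<open>(card V)^2\<close> ordered pairs; maps with a repeated
  index form a fraction of order \<open>1 / k\<close>.\<close>

lemma card_non_injective_index:
  assumes "finite V"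
  shows "real (card {g \<in> V \<rightarrow>\<^sub>E kr_index k. \<not> inj_on (\<lambda>v. snd (g v)) V}) * k \<le> (real (card V))\<^sup>2 * (2 * real k) ^ card V"
proof -
  let ?G = "\<lambda>u v. {g \<in> V \<rightarrow>\<^sub>E kr_index k. snd (g u) = snd (g v)}"
  let ?D = "{p \<in> V \<times> V. fst p \<noteq> snd p}"
  have "{g \<in> V \<rightarrow>\<^sub>E kr_index k. \<not> inj_on (\<lambda>v. snd (g v)) V} \<subseteq> (\<Union>p\<in>?D. ?G (fst p) (snd p))"
    by (fastforce simp: inj_on_def)
  then have "card {g \<in> V \<rightarrow>\<^sub>E kr_index k. \<not> inj_on (\<lambda>v. snd (g v)) V} \<le> card (\<Union>p\<in>?D. ?G (fst p) (snd p))"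
    using assms by (intro card_mono finite_UN_I finite_subset[of "?G _ _" "V \<rightarrow>\<^sub>E kr_index k"] finite_PiE) auto
  also have "\<dots> \<le> (\<Sum>p\<in>?D. card (?G (fst p) (snd p)))"
    using assms by (intro card_UN_le) auto
  finally have "card {g \<in> V \<rightarrow>\<^sub>E kr_index k. \<not> inj_on (\<lambda>v. snd (g v)) V} * k \<le> (\<Sum>p\<in>?D. card (?G (fst p) (snd p))) * k"
    by simp
  also have "\<dots> = (\<Sum>p\<in>?D. card (?G (fst p) (snd p)) * k)"
    by (simp add: sum_distrib_right)
  also have "\<dots> \<le> (\<Sum>p\<in>?D. (2 * k) ^ card V)"
    using assms by (intro sum_mono card_PiE_coincidence) auto
  also have "\<dots> = card ?D * (2 * k) ^ card V" by simp
  also have "\<dots> \<le> card (V \<times> V) * (2 * k) ^ card V"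
    using assms by (intro mult_right_mono card_mono) auto
  also have "\<dots> = (card V)\<^sup>2 * (2 * k) ^ card V"
    by (simp add: card_cartesian_product power2_eq_square)
  finally have "real (card {g \<in> V \<rightarrow>\<^sub>E kr_index k. \<not> inj_on (\<lambda>v. snd (g v)) V} * k) \<le> real ((card V)\<^sup>2 * (2 * k) ^ card V)"
    by (rule of_nat_mono)
  then show ?thesis by simp
qed

text \<open>For distinct indices the adjacencies between the middle layer and the outer layers are
  independent fair bits, so the average over the third coordinates is exactly the block weight.\<close>

lemma kr_average:
  fixes F :: "nat pair_pre_digraph"
  assumes F: "pair_graph F" and g: "g \<in> pverts F \<rightarrow>\<^sub>E kr_index k" and inj: "inj_on (\<lambda>v. snd (g v)) (pverts F)"
  shows "real (card {T \<in> pverts F \<rightarrow>\<^sub>E Pow {..<k}. \<forall>(u, v)\<in>parcs F. kr_adj m (g u, T u) (g v, T v)})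
     = (2 ^ k) ^ card (pverts F) * (\<Prod>(u, v)\<in>{(u, v). (u, v) \<in> parcs F \<and> u < v}. block_weight (kr_label m (g u)) (kr_label m (g v)))"
proof -
  let ?V = "pverts F" and ?P = "{(u, v). (u, v) \<in> parcs F \<and> u < v}"
  have fV: "finite ?V" and fA: "finite (parcs F)"
    and A: "\<And>u v. (u, v) \<in> parcs F \<Longrightarrow> u \<in> ?V \<and> v \<in> ?V \<and> u \<noteq> v"
    and As: "\<And>u v. (u, v) \<in> parcs F \<Longrightarrow> (v, u) \<in> parcs F"
    using pair_graphD[OF F] by auto
  have lt: "v < u" if "(u, v) \<in> parcs F" "\<not> u < v" for u v
    using A[OF that(1)] that(2) by linarith
  have fP: "finite ?P" by (rule finite_subset[OF _ fA]) auto
  define s where "s v = fst (g v)" for v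
  define i where "i v = snd (g v)" for v
  have i: "i v < k" if "v \<in> ?V" for v
    using PiE_mem[OF g that] by (auto simp: i_def kr_index_def)
  have ne: "g u \<noteq> g v" if "(u, v) \<in> parcs F" for u v
    using inj_onD[OF inj, of u v] A[OF that] by auto
  \<comment> \<open>An edge of \<open>F\<close> between an outer and a middle vertex asks one thing:
    the index of its outer end belongs to the set at its middle end. All requests to the set at
    \<open>v\<close> are collected in \<open>J v\<close>.\<close>
  define Q where "Q = {(u, v). (u, v) \<in> parcs F \<and> s u \<and> \<not> s v}"
  define J where "J v = i ` {u. (u, v) \<in> Q}" for v
  have adj: "kr_adj m (g u, T u) (g v, T v) \<longleftrightarrow>
      (if s u then if s v then (i u < m) = (i v < m) else i u \<in> T v else s v \<longrightarrow> i v \<in> T u)"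
    if "(u, v) \<in> parcs F" for u v and T :: "nat \<Rightarrow> nat set"
    using ne[OF that] by (auto simp: kr_adj_def kr_less_def s_def i_def)
  define C where "C \<longleftrightarrow> (\<forall>(u, v)\<in>parcs F. s u \<and> s v \<longrightarrow> (i u < m) = (i v < m))"
  have all: "(\<forall>(u, v)\<in>parcs F. kr_adj m (g u, T u) (g v, T v)) \<longleftrightarrow> C \<and> (\<forall>v\<in>?V. J v \<subseteq> T v)" for T :: "nat \<Rightarrow> nat set"
  proof (intro iffI conjI)
    assume *: "\<forall>(u, v)\<in>parcs F. kr_adj m (g u, T u) (g v, T v)"
    show C unfolding C_def using * adj by fastforce
    show "\<forall>v\<in>?V. J v \<subseteq> T v"
    proof (intro ballI subsetI)
      fix v x assume "v \<in> ?V" "x \<in> J v"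
      then obtain u where "(u, v) \<in> parcs F" "s u" "\<not> s v" "x = i u" by (auto simp: J_def Q_def)
      then show "x \<in> T v" using * adj[of u v T] by auto
    qed
  next
    assume *: "C \<and> (\<forall>v\<in>?V. J v \<subseteq> T v)"
    show "\<forall>(u, v)\<in>parcs F. kr_adj m (g u, T u) (g v, T v)"
    proof (intro ballI, unfold split_paired_all prod.case)
      fix u v assume uv: "(u, v) \<in> parcs F"
      have 1: "i u \<in> T v" if "s u" "\<not> s v"
      proof -
        have "i u \<in> J v" using uv that by (auto simp: J_def Q_def)
        then show ?thesis using * A[OF uv] by blast
      qed
      have 2: "i v \<in> T u" if "s v" "\<not> s u"
      proof -
        have "i v \<in> J u" using As[OF uv] that by (auto simp: J_def Q_def)
        then show ?thesis using * A[OF uv] by blast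
      qed
      have 3: "(i u < m) = (i v < m)" if "s u" "s v"
        using * uv that by (auto simp: C_def)
      show "kr_adj m (g u, T u) (g v, T v)"
        unfolding adj[OF uv] using 1 2 3 by auto
    qed
  qed
  have weight: "block_weight (kr_label m (g u)) (kr_label m (g v)) =
      (if s u \<noteq> s v then 1/2 else if s u \<and> (i u < m) \<noteq> (i v < m) then 0 else 1)" for u v
    by (auto simp: block_weight_def kr_label_def s_def i_def)
  show ?thesis
  proof (cases C)
    case False
    then obtain u v where uv: "(u, v) \<in> parcs F" "s u" "s v" "(i u < m) \<noteq> (i v < m)"
      by (auto simp: C_def)
    define e where "e = (if u < v then (u, v) else (v, u))"
    have "e \<in> ?P" using uv(1) As[OF uv(1)] A[OF uv(1)] by (auto simp: e_def)
    moreover have "(case e of (u, v) \<Rightarrow> block_weight (kr_label m (g u)) (kr_label m (g v))) = 0"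
      using uv by (auto simp: e_def weight)
    ultimately have "(\<Prod>(u, v)\<in>?P. block_weight (kr_label m (g u)) (kr_label m (g v))) = 0"
      using fP by (intro prod_zero) auto
    then show ?thesis using False by (simp add: all)
  next
    case True
    have JA: "J v \<subseteq> {..<k}" for v
      using i A by (auto simp: J_def Q_def)
    have "{T \<in> ?V \<rightarrow>\<^sub>E Pow {..<k}. \<forall>(u, v)\<in>parcs F. kr_adj m (g u, T u) (g v, T v)} = (\<Pi>\<^sub>E v\<in>?V. {T \<in> Pow {..<k}. J v \<subseteq> T})"
      unfolding all using True by (auto simp: PiE_iff extensional_def)
    then have "real (card {T \<in> ?V \<rightarrow>\<^sub>E Pow {..<k}. \<forall>(u, v)\<in>parcs F. kr_adj m (g u, T u) (g v, T v)}) = (\<Prod>v\<in>?V. 2 ^ (k - card (J v)))"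
      using fV card_supersets[OF _ JA] by (simp add: card_PiE)
    also have "\<dots> = (\<Prod>v\<in>?V. 2 ^ k * (1/2) ^ card (J v))"
    proof (intro prod.cong refl)
      fix v
      have "card (J v) \<le> k" using card_mono[OF _ JA, of v] by simp
      then show "2 ^ (k - card (J v)) = 2 ^ k * (1/2 :: real) ^ card (J v)"
        by (simp add: power_diff power_one_over field_simps)
    qed
    also have "\<dots> = (2 ^ k) ^ card ?V * (1/2) ^ (\<Sum>v\<in>?V. card (J v))"
      by (simp add: prod.distrib power_sum)
    also have "(\<Sum>v\<in>?V. card (J v)) = (\<Sum>v\<in>?V. card {u. (u, v) \<in> Q})"
    proof (intro sum.cong refl)
      fix v
      \<comment> \<open>Distinct indices keep the requests at \<open>v\<close> distinct, so each
        such edge costs exactly one factor \<open>1/2\<close>.\<close>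
      have "inj_on i {u. (u, v) \<in> Q}"
        using inj A by (auto simp: inj_on_def i_def Q_def)
      then show "card (J v) = card {u. (u, v) \<in> Q}" by (simp add: J_def card_image)
    qed
    also have "\<dots> = card (SIGMA v:?V. {u. (u, v) \<in> Q})"
    proof (rule card_SigmaI[symmetric])
      show "\<forall>v\<in>?V. finite {u. (u, v) \<in> Q}"
      proof
        fix v
        have "{u. (u, v) \<in> Q} \<subseteq> ?V" using A by (auto simp: Q_def)
        then show "finite {u. (u, v) \<in> Q}" by (rule finite_subset[OF _ fV])
      qed
    qed (rule fV)
    also have "\<dots> = card {(u, v). (u, v) \<in> ?P \<and> s u \<noteq> s v}"
    proof (rule bij_betw_same_card)
      show "bij_betw (\<lambda>(v, u). if u < v then (u, v) else (v, u)) (SIGMA v:?V. {u. (u, v) \<in> Q}) {(u, v). (u, v) \<in> ?P \<and> s u \<noteq> s v}"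
        by (rule bij_betw_byWitness[where f' = "\<lambda>(u, v). if s u then (v, u) else (u, v)"])
          (auto simp: Q_def split: if_splits dest: A lt intro: As)
    qed
    also have "(1/2 :: real) ^ card {(u, v). (u, v) \<in> ?P \<and> s u \<noteq> s v} = (\<Prod>e\<in>?P. if s (fst e) \<noteq> s (snd e) then 1/2 else 1)"
    proof -
      have "{(u, v). (u, v) \<in> ?P \<and> s u \<noteq> s v} = {e \<in> ?P. s (fst e) \<noteq> s (snd e)}" by auto
      then show ?thesis using fP by (simp add: prod.inter_filter[symmetric])
    qed
    also have "\<dots> = (\<Prod>(u, v)\<in>?P. block_weight (kr_label m (g u)) (kr_label m (g v)))"
      using True by (intro prod.cong refl) (auto simp: weight C_def)
    finally show ?thesis .
  qed
qed

lemma card_kr_label: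
  assumes "m \<le> k" "0 < k"
  shows "real (card {p \<in> kr_index k. kr_label m p = j}) = (if j \<in> {0, 1, 2} then block_measure (real m / real k) j * real (2 * k) else 0)"
proof -
  have 0: "{p \<in> kr_index k. kr_label m p = 0} = {True} \<times> {..<m}"
    and 1: "{p \<in> kr_index k. kr_label m p = 1} = {True} \<times> {m..<k}"
    and 2: "{p \<in> kr_index k. kr_label m p = 2} = {False} \<times> {..<k}"
    using assms by (auto simp: kr_index_def kr_label_def split: if_splits)
  consider "j = 0" | "j = 1" | "j = 2" | "j \<notin> {0, 1, 2}" by auto
  then show ?thesis
  proof cases
    case 4
    then have "{p \<in> kr_index k. kr_label m p = j} = {}" by (auto simp: kr_label_def)
    with 4 show ?thesis by simp
  qed (use assms in \<open>simp_all add: 0 1 2[simplified] 1[simplified] block_measure_def field_simps of_nat_diff\<close>)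
qed

text \<open>The averages are exact for index maps without repetition. Each remaining map is off by
  at most the number of choices of third coordinates, and such maps are rare.\<close>

lemma kr_density_bound:
  fixes F :: "nat pair_pre_digraph"
  assumes F: "pair_graph F" and k: "0 < k" "m \<le> k"
  shows "\<bar>real (card {f \<in> pverts F \<rightarrow>\<^sub>E kr_vertices k. \<forall>(u, v)\<in>parcs F. u \<in> pverts F \<and> v \<in> pverts F \<and> kr_adj m (f u) (f v)})
         / real (2 * k * 2 ^ k) ^ card (pverts F) - block_density F (real m / real k)\<bar> \<le> (real (card (pverts F)))\<^sup>2 / real k"
proof -
  let ?V = "pverts F" and ?P = "{(u, v). (u, v) \<in> parcs F \<and> u < v}"
  let ?Y = "kr_index k" and ?Z = "Pow {..<k}"
  let ?hom = "\<lambda>f. \<forall>(u, v)\<in>parcs F. u \<in> ?V \<and> v \<in> ?V \<and> kr_adj m (f u) (f v)"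
  let ?w = "\<lambda>l. \<Prod>(u, v)\<in>?P. block_weight (l u) (l v)"
  let ?l = "\<lambda>g. \<lambda>v\<in>?V. kr_label m (g v)"
  let ?n = "card ?V"
  have fV: "finite ?V" and A: "\<And>u v. (u, v) \<in> parcs F \<Longrightarrow> u \<in> ?V \<and> v \<in> ?V"
    using pair_graphD[OF F] by auto
  have fP: "finite ?P" by (rule finite_subset[OF _ pair_graphD(2)[OF F]]) auto
  have w_label: "?w (?l g) = (\<Prod>(u, v)\<in>?P. block_weight (kr_label m (g u)) (kr_label m (g v)))" for g
    using A by (intro prod.cong refl) auto
  have w01: "0 \<le> ?w l" "?w l \<le> 1" for l
    by (auto intro!: prod_nonneg prod_le_1 simp: block_weight_def)
  define a where "a g = real (card {T \<in> ?V \<rightarrow>\<^sub>E ?Z. \<forall>(u, v)\<in>parcs F. kr_adj m (g u, T u) (g v, T v)})" for g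
  have cZ: "real (card (?V \<rightarrow>\<^sub>E ?Z)) = (2 ^ k) ^ ?n"
    using fV by (simp add: card_PiE card_Pow)
  have a: "0 \<le> a g" "a g \<le> (2 ^ k) ^ ?n" for g
    unfolding a_def cZ[symmetric] using fV by (auto intro!: card_mono finite_PiE)
  have "real (card {f \<in> ?V \<rightarrow>\<^sub>E kr_vertices k. ?hom f}) = (\<Sum>f\<in>?V \<rightarrow>\<^sub>E ?Y \<times> ?Z. if ?hom f then 1 else 0)"
    using fV by (simp add: kr_vertices_def sum.If_cases finite_PiE Int_def)
  also have "\<dots> = (\<Sum>g\<in>?V \<rightarrow>\<^sub>E ?Y. \<Sum>T\<in>?V \<rightarrow>\<^sub>E ?Z. if ?hom (\<lambda>v\<in>?V. (g v, T v)) then 1 else 0)"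
    by (rule sum_PiE_Times)
  also have "\<dots> = (\<Sum>g\<in>?V \<rightarrow>\<^sub>E ?Y. a g)"
  proof (intro sum.cong refl)
    fix g
    have "?hom (\<lambda>v\<in>?V. (g v, T v)) \<longleftrightarrow> (\<forall>(u, v)\<in>parcs F. kr_adj m (g u, T u) (g v, T v))" for T
      using A by (intro ball_cong refl) auto
    then show "(\<Sum>T\<in>?V \<rightarrow>\<^sub>E ?Z. if ?hom (\<lambda>v\<in>?V. (g v, T v)) then 1 else 0) = a g"
      using fV by (simp add: a_def sum.If_cases finite_PiE Int_def)
  qed
  finally have N: "real (card {f \<in> ?V \<rightarrow>\<^sub>E kr_vertices k. ?hom f}) = (\<Sum>g\<in>?V \<rightarrow>\<^sub>E ?Y. a g)" .
  have D: "(\<Sum>g\<in>?V \<rightarrow>\<^sub>E ?Y. ?w (?l g)) = real (2 * k) ^ ?n * block_density F (real m / real k)"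
  proof -
    have "(\<Sum>g\<in>?V \<rightarrow>\<^sub>E ?Y. ?w (?l g)) = (\<Sum>l\<in>?V \<rightarrow>\<^sub>E {0,1,2}. (\<Prod>v\<in>?V. real (card {y \<in> ?Y. kr_label m y = l v})) * ?w l)"
      using fV by (intro sum_PiE_label) (auto simp: kr_label_def)
    also have "\<dots> = (\<Sum>l\<in>?V \<rightarrow>\<^sub>E {0,1,2}. real (2 * k) ^ ?n * ((\<Prod>v\<in>?V. block_measure (real m / real k) (l v)) * ?w l))"
    proof (intro sum.cong refl)
      fix l assume l: "l \<in> ?V \<rightarrow>\<^sub>E {0, 1, 2 :: nat}"
      have "(\<Prod>v\<in>?V. real (card {y \<in> ?Y. kr_label m y = l v})) = (\<Prod>v\<in>?V. block_measure (real m / real k) (l v) * real (2 * k))"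
        using PiE_mem[OF l] by (intro prod.cong refl) (simp only: card_kr_label[OF k(2,1)] if_True)
      then show "(\<Prod>v\<in>?V. real (card {y \<in> ?Y. kr_label m y = l v})) * ?w l =
          real (2 * k) ^ ?n * ((\<Prod>v\<in>?V. block_measure (real m / real k) (l v)) * ?w l)"
        by (simp add: prod.distrib)
    qed
    finally show ?thesis by (simp add: block_density_def sum_distrib_left)
  qed
  define B where "B = {g \<in> ?V \<rightarrow>\<^sub>E ?Y. \<not> inj_on (\<lambda>v. snd (g v)) ?V}"
  have fY: "finite (?V \<rightarrow>\<^sub>E ?Y)" using fV by (intro finite_PiE) auto
  have fB: "finite B" and BY: "B \<subseteq> ?V \<rightarrow>\<^sub>E ?Y" unfolding B_def using fY by auto
  have good: "a g - (2 ^ k) ^ ?n * ?w (?l g) = 0" if "g \<in> (?V \<rightarrow>\<^sub>E ?Y) - B" for g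
    using that kr_average[OF F, of g k m] unfolding a_def w_label B_def by simp
  have "(\<Sum>g\<in>?V \<rightarrow>\<^sub>E ?Y. a g) - (2 ^ k) ^ ?n * (\<Sum>g\<in>?V \<rightarrow>\<^sub>E ?Y. ?w (?l g)) = (\<Sum>g\<in>?V \<rightarrow>\<^sub>E ?Y. a g - (2 ^ k) ^ ?n * ?w (?l g))"
    by (simp add: sum_subtractf sum_distrib_left)
  also have "\<dots> = (\<Sum>g\<in>B. a g - (2 ^ k) ^ ?n * ?w (?l g))"
    using good by (intro sum.mono_neutral_right fY BY) auto
  finally have "\<bar>(\<Sum>g\<in>?V \<rightarrow>\<^sub>E ?Y. a g) - (2 ^ k) ^ ?n * (\<Sum>g\<in>?V \<rightarrow>\<^sub>E ?Y. ?w (?l g))\<bar> \<le> (\<Sum>g\<in>B. \<bar>a g - (2 ^ k) ^ ?n * ?w (?l g)\<bar>)"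
    by simp
  also have "\<dots> \<le> (\<Sum>g\<in>B. (2 ^ k) ^ ?n)"
  proof (rule sum_mono)
    fix g
    have "0 \<le> (2 ^ k) ^ ?n * ?w (?l g)" using w01(1)[of "?l g"] by (intro mult_nonneg_nonneg) auto
    moreover have "(2 ^ k) ^ ?n * ?w (?l g) \<le> (2 ^ k) ^ ?n * 1" using w01(2)[of "?l g"] by (intro mult_left_mono) auto
    ultimately show "\<bar>a g - (2 ^ k) ^ ?n * ?w (?l g)\<bar> \<le> (2 ^ k) ^ ?n"
      using a[of g] by linarith
  qed
  also have "\<dots> = real (card B) * (2 ^ k) ^ ?n" by simp
  also have "\<dots> \<le> (real ?n)\<^sup>2 * real (2 * k) ^ ?n / real k * (2 ^ k) ^ ?n"
    using card_non_injective_index[OF fV, of k] k(1)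
    by (intro mult_right_mono) (simp_all add: B_def pos_le_divide_eq)
  finally have "\<bar>(\<Sum>g\<in>?V \<rightarrow>\<^sub>E ?Y. a g) - (2 ^ k) ^ ?n * (\<Sum>g\<in>?V \<rightarrow>\<^sub>E ?Y. ?w (?l g))\<bar> \<le>
      (real ?n)\<^sup>2 / real k * (real (2 * k) ^ ?n * (2 ^ k) ^ ?n)"
    by (simp add: mult_ac)
  then have le: "\<bar>(\<Sum>g\<in>?V \<rightarrow>\<^sub>E ?Y. a g) - (real (2 * k) ^ ?n * (2 ^ k) ^ ?n) * block_density F (real m / real k)\<bar> \<le>
      (real ?n)\<^sup>2 / real k * (real (2 * k) ^ ?n * (2 ^ k) ^ ?n)"
    unfolding D by (simp add: mult_ac)
  have X: "real (2 * k * 2 ^ k) ^ ?n = real (2 * k) ^ ?n * (2 ^ k) ^ ?n"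
    by (simp add: power_mult_distrib)
  have X0: "0 < real (2 * k) ^ ?n * (2 ^ k) ^ ?n" using k by simp
  have *: "\<bar>S / T - d\<bar> \<le> e" if "\<bar>S - T * d\<bar> \<le> e * T" "0 < T" for S T d e :: real
  proof -
    have "S / T - d = (S - T * d) / T" using that(2) by (simp add: field_simps)
    then show ?thesis using that by (simp add: abs_divide pos_divide_le_eq)
  qed
  show ?thesis
    unfolding N X by (rule *[OF le X0])
qed

lemma block_density_limit:
  assumes a: "a \<in> {0..1}"
  obtains G where "\<forall>n. G n \<in> INC" "filterlim (\<lambda>n. card (pverts (G n))) at_top sequentially"
    "\<forall>F. pair_graph F \<longrightarrow> (\<lambda>n. hom_density F (G n)) \<longlonglongrightarrow> block_density F a"
proof -
  \<comment> \<open>\<open>k\<close> is positive for every \<open>n\<close>, and \<open>m\<close>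
    makes the bottom layer a share of the outer vertices that tends to \<open>a\<close>.\<close>
  define k where "k n = Suc n" for n :: nat
  define m where "m n = nat \<lfloor>a * real (k n)\<rfloor>" for n
  have m: "real (m n) \<le> a * real (k n)" "a * real (k n) < real (m n) + 1" for n
    using a by (simp_all add: m_def of_nat_nat)
  have mk: "m n \<le> k n" for n
  proof -
    have "a * real (k n) \<le> 1 * real (k n)" using a by (intro mult_right_mono) auto
    then have "real (m n) \<le> real (k n)" using m(1)[of n] by linarith
    then show ?thesis by simp
  qed
  have lim: "(\<lambda>n. real (m n) / real (k n)) \<longlonglongrightarrow> a"
  proof (rule real_tendsto_sandwich[where f = "\<lambda>n. a - 1 / real (Suc n)" and h = "\<lambda>n. a"])
    show "\<forall>\<^sub>F n in sequentially. a - 1 / real (Suc n) \<le> real (m n) / real (k n)"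
    proof (intro always_eventually allI)
      fix n
      have "(a * real (k n) - 1) / real (k n) \<le> real (m n) / real (k n)"
        using m(2)[of n] by (intro divide_right_mono) auto
      then show "a - 1 / real (Suc n) \<le> real (m n) / real (k n)"
        by (simp add: k_def diff_divide_distrib)
    qed
    show "\<forall>\<^sub>F n in sequentially. real (m n) / real (k n) \<le> a"
      using m(1) by (intro always_eventually allI) (simp add: k_def pos_divide_le_eq)
    show "(\<lambda>n. a - 1 / real (Suc n)) \<longlonglongrightarrow> a"
      using tendsto_diff[OF tendsto_const LIMSEQ_Suc[OF lim_1_over_n], of a] by simp
  qed simp
  have "\<forall>n. \<exists>G. G \<in> INC \<and> card (pverts G) = 2 * k n * 2 ^ k n \<and> (\<forall>F. pair_graph F \<longrightarrow> hom_density F G =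
       real (card {f \<in> pverts F \<rightarrow>\<^sub>E kr_vertices (k n). \<forall>(u, v)\<in>parcs F. u \<in> pverts F \<and> v \<in> pverts F \<and> kr_adj (m n) (f u) (f v)})
         / real (2 * k n * 2 ^ k n) ^ card (pverts F))"
  proof
    fix n
    show "\<exists>G. G \<in> INC \<and> card (pverts G) = 2 * k n * 2 ^ k n \<and> (\<forall>F. pair_graph F \<longrightarrow> hom_density F G =
       real (card {f \<in> pverts F \<rightarrow>\<^sub>E kr_vertices (k n). \<forall>(u, v)\<in>parcs F. u \<in> pverts F \<and> v \<in> pverts F \<and> kr_adj (m n) (f u) (f v)})
         / real (2 * k n * 2 ^ k n) ^ card (pverts F))"
      by (rule kr_graph_exists[of "k n" "m n"]) blast
  qed
  from choice[OF this] obtain G where G: "\<And>n. G n \<in> INC" "\<And>n. card (pverts (G n)) = 2 * k n * 2 ^ k n"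
    "\<And>n F. pair_graph F \<Longrightarrow> hom_density F (G n) =
       real (card {f \<in> pverts F \<rightarrow>\<^sub>E kr_vertices (k n). \<forall>(u, v)\<in>parcs F. u \<in> pverts F \<and> v \<in> pverts F \<and> kr_adj (m n) (f u) (f v)})
         / real (2 * k n * 2 ^ k n) ^ card (pverts F)"
    by blast
  have "filterlim (\<lambda>n. card (pverts (G n))) at_top sequentially"
  proof (rule filterlim_at_top_mono[OF filterlim_ident], intro always_eventually allI)
    fix n
    have "n * 1 \<le> (2 * k n) * 2 ^ k n" by (intro mult_le_mono) (auto simp: k_def)
    then show "n \<le> card (pverts (G n))" by (simp add: G(2))
  qed
  moreover have "(\<lambda>n. hom_density F (G n)) \<longlonglongrightarrow> block_density F a" if F: "pair_graph F" for F
  proof -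
    have 1: "(\<lambda>n. block_density F (real (m n) / real (k n))) \<longlonglongrightarrow> block_density F a"
    proof -
      have "(\<lambda>n. block_measure (real (m n) / real (k n)) j) \<longlonglongrightarrow> block_measure a j" for j
        using tendsto_divide[OF lim tendsto_const, of 2] tendsto_divide[OF tendsto_diff[OF tendsto_const lim] tendsto_const, of 2 1]
        by (simp add: block_measure_def)
      then show ?thesis unfolding block_density_def by (intro tendsto_sum tendsto_mult tendsto_prod tendsto_const)
    qed
    have 2: "(\<lambda>n. hom_density F (G n) - block_density F (real (m n) / real (k n))) \<longlonglongrightarrow> 0"
    proof (rule tendsto_0_le[where K = 1, of "\<lambda>n. (real (card (pverts F)))\<^sup>2 * (1 / real (Suc n))"])
      show "(\<lambda>n. (real (card (pverts F)))\<^sup>2 * (1 / real (Suc n))) \<longlonglongrightarrow> 0"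
        using tendsto_mult[OF tendsto_const LIMSEQ_Suc[OF lim_1_over_n], of "(real (card (pverts F)))\<^sup>2"] by simp
      show "\<forall>\<^sub>F n in sequentially. norm (hom_density F (G n) - block_density F (real (m n) / real (k n)))
          \<le> norm ((real (card (pverts F)))\<^sup>2 * (1 / real (Suc n))) * 1"
        using kr_density_bound[OF F _ mk] G(3)[OF F] by (intro always_eventually allI) (simp add: k_def)
    qed
    show ?thesis using tendsto_add[OF 2 1] by simp
  qed
  ultimately show thesis using that G(1) by blast
qed

section \<open>Entropy\<close>

lemma binary_entropy_0_1: "binary_entropy 0 = 0" "binary_entropy 1 = 0"
  by (simp_all add: binary_entropy_def)

text \<open>This is \<open>ln t \<le> t - 1\<close> at \<open>t = 1 / (2 * p)\<close>, with equality
  only at \<open>t = 1\<close>. Added for \<open>p\<close> and \<open>1 - p\<close>, the right-hand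
  sides cancel and the binary entropy is bounded by 1.\<close>

lemma ln_two_mult_lower:
  fixes p :: real
  assumes "0 < p"
  shows "- (p * ln p) - p * ln 2 \<le> 1/2 - p" "- (p * ln p) - p * ln 2 = 1/2 - p \<Longrightarrow> p = 1/2"
proof -
  have l: "- (p * ln p) - p * ln 2 = p * ln (1 / (2 * p))"
    using assms by (simp add: ln_div ln_mult algebra_simps)
  have r: "p * (1 / (2 * p) - 1) = 1/2 - p"
    using assms by (simp add: field_simps)
  have "p * ln (1 / (2 * p)) \<le> p * (1 / (2 * p) - 1)"
    using assms by (intro mult_left_mono ln_le_minus_one) auto
  then show "- (p * ln p) - p * ln 2 \<le> 1/2 - p" using l r by simp
  assume "- (p * ln p) - p * ln 2 = 1/2 - p"
  then have "p * ln (1 / (2 * p)) = p * (1 / (2 * p) - 1)"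
    using l r by simp
  then have "ln (1 / (2 * p)) = 1 / (2 * p) - 1" using assms by simp
  then have "1 / (2 * p) = 1" using assms by (intro ln_eq_minus_one) auto
  then show "p = 1/2" using assms by (simp add: field_simps)
qed

lemma binary_entropy_ln: "binary_entropy p * ln 2 = - (p * ln p) - (1 - p) * ln (1 - p)"
  by (simp add: binary_entropy_def log_def field_simps)

lemma binary_entropy_bounds:
  assumes "0 \<le> p" "p \<le> 1"
  shows "0 \<le> binary_entropy p" "binary_entropy p \<le> 1" "binary_entropy p = 1 \<Longrightarrow> p = 1/2"
proof -
  have ln2: "(0::real) < ln 2" by simp
  consider "p = 0" | "p = 1" | "0 < p" "p < 1" using assms by linarith
  then have "0 \<le> binary_entropy p \<and> binary_entropy p \<le> 1 \<and> (binary_entropy p = 1 \<longrightarrow> p = 1/2)"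
  proof cases
    case 3
    have n: "0 \<le> - (p * ln p)" "0 \<le> - ((1 - p) * ln (1 - p))"
      using 3 mult_nonneg_nonpos[of p "ln p"] mult_nonneg_nonpos[of "1 - p" "ln (1 - p)"] by simp_all
    then have "0 \<le> binary_entropy p * ln 2" unfolding binary_entropy_ln by simp
    then have "0 \<le> binary_entropy p" using ln2 by (simp add: zero_le_mult_iff)
    moreover have le: "- (p * ln p) - p * ln 2 \<le> 1/2 - p"
        "- ((1 - p) * ln (1 - p)) - (1 - p) * ln 2 \<le> 1/2 - (1 - p)"
      using ln_two_mult_lower(1)[of p] ln_two_mult_lower(1)[of "1 - p"] 3 by auto
    then have "binary_entropy p * ln 2 \<le> 1 * ln 2" unfolding binary_entropy_ln by (simp add: algebra_simps)
    then have "binary_entropy p \<le> 1" using ln2 by (simp add: mult_le_cancel_right)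
    moreover have "p = 1/2" if "binary_entropy p = 1"
    proof -
      have "- (p * ln p) - ((1 - p) * ln (1 - p)) = ln 2" using that binary_entropy_ln[of p] by simp
      then have "- (p * ln p) - p * ln 2 = 1/2 - p" using le by (simp add: algebra_simps)
      then show ?thesis using ln_two_mult_lower(2)[of p] 3 by simp
    qed
    ultimately show ?thesis by simp
  qed (simp_all add: binary_entropy_0_1)
  then show "0 \<le> binary_entropy p" "binary_entropy p \<le> 1" "binary_entropy p = 1 \<Longrightarrow> p = 1/2" by auto
qed

lemma measurable_binary_entropy [measurable]: "binary_entropy \<in> borel_measurable borel"
  unfolding binary_entropy_def by measurable

text \<open>The entropy integrand vanishes off \<open>E\<close> and is at most 1 on it, so the edge
  density of \<open>E\<close> bounds the entropy, and Mantel's bound applies. In case of equality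
  both estimates are tight: \<open>E\<close> is extremal, and almost everywhere on \<open>E\<close>
  the integrand is 1, which only the value \<open>1/2\<close> attains.\<close>

lemma entropy_bound:
  assumes W: "graphon W"
  defines "E \<equiv> \<lambda>x y. 0 < W x y \<and> W x y < 1"
  assumes tri: "AE x in unit_leb. AE y in unit_leb. AE z in unit_leb. \<not> (E x y \<and> E y z \<and> E x z)"
  shows "graphon_entropy W \<le> 1/2"
    and "graphon_entropy W = 1/2 \<Longrightarrow> \<exists>A\<in>sets unit_leb. measure unit_leb A = 1/2 \<and>
      (AE x in unit_leb. AE y in unit_leb. if (x \<in> A) \<noteq> (y \<in> A) then W x y = 1/2 else W x y = 0 \<or> W x y = 1)"
proof -
  have Wm [measurable]: "(\<lambda>p. W (fst p) (snd p)) \<in> borel_measurable (unit_leb \<Otimes>\<^sub>M unit_leb)"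
    using W by (simp add: graphon_def case_prod_beta')
  have W01: "0 \<le> W x y" "W x y \<le> 1" "W x y = W y x" if "x \<in> {0..1}" "y \<in> {0..1}" for x y
    using W that by (auto simp: graphon_def)
  interpret U: prob_space unit_leb by (rule prob_space_unit_leb)
  interpret measurable_graph unit_leb E
  proof
    show "Measurable.pred (unit_leb \<Otimes>\<^sub>M unit_leb) (\<lambda>z. E (fst z) (snd z))"
      unfolding E_def by measurable
    show "E y x" if "x \<in> space unit_leb" "y \<in> space unit_leb" "E x y" for x y
      using that W01(3)[of x y] by (simp add: E_def)
  qed
  let ?MM = "unit_leb \<Otimes>\<^sub>M unit_leb"
  let ?H = "\<lambda>p. binary_entropy (W (fst p) (snd p))" and ?e = "\<lambda>p. edge (fst p) (snd p)"
  have H: "0 \<le> binary_entropy (W x y)" "binary_entropy (W x y) \<le> edge x y"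
    if "x \<in> {0..1}" "y \<in> {0..1}" for x y
  proof -
    show "0 \<le> binary_entropy (W x y)" using W01[OF that] binary_entropy_bounds by simp
    have "W x y = 0 \<or> W x y = 1 \<or> E x y" using W01[OF that] by (auto simp: E_def)
    then show "binary_entropy (W x y) \<le> edge x y"
      using W01[OF that] binary_entropy_bounds(2) edge_range(1)[of x y] by (auto simp: binary_entropy_0_1 edge_def)
  qed
  have iH: "integrable ?MM ?H"
  proof (rule MM.integrable_bounded[where B = 1])
    show "?H \<in> borel_measurable ?MM" by measurable
    show "\<bar>?H p\<bar> \<le> 1" if "p \<in> space ?MM" for p
      using that H[of "fst p" "snd p"] edge_range(2)[of "fst p" "snd p"] by (auto simp: space_pair_measure)
  qed
  have ie: "integrable ?MM ?e"
    using edge_range by (intro MM.integrable_bounded[where B = 1] measurable_edge) simp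
  have sH: "graphon_entropy W = (\<integral>p. ?H p \<partial>?MM)"
    using MM.integral_fst[of "\<lambda>x y. binary_entropy (W x y)"] iH by (simp add: graphon_entropy_def case_prod_beta')
  have se: "(\<integral>x. deg x \<partial>unit_leb) = (\<integral>p. ?e p \<partial>?MM)"
    using MM.integral_fst[of edge] ie by (simp add: deg_def case_prod_beta')
  have le: "(\<integral>p. ?H p \<partial>?MM) \<le> (\<integral>p. ?e p \<partial>?MM)"
    using H by (intro integral_mono iH ie) (auto simp: space_pair_measure)
  show "graphon_entropy W \<le> 1/2"
    using le mantel[OF tri] sH se by linarith
  assume "graphon_entropy W = 1/2"
  then have half: "(\<integral>x. deg x \<partial>unit_leb) = 1/2" and "(\<integral>p. ?H p \<partial>?MM) = (\<integral>p. ?e p \<partial>?MM)"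
    using le mantel[OF tri] sH se by linarith+
  then have "(\<integral>p. ?e p - ?H p \<partial>?MM) = 0"
    using Bochner_Integration.integral_diff[OF ie iH] by simp
  moreover have nn: "AE p in ?MM. 0 \<le> ?e p - ?H p"
    using H by (intro AE_I2) (auto simp: space_pair_measure)
  ultimately have "AE p in ?MM. ?e p - ?H p = 0"
    using integral_nonneg_eq_0_iff_AE[OF Bochner_Integration.integrable_diff[OF ie iH] nn] by simp
  then have "AE p in ?MM. ?e p - ?H p = 0 \<and> p \<in> space ?MM" using AE_space by eventually_elim simp
  from MM.AE_pair[OF this]
  have eq: "AE x in unit_leb. AE y in unit_leb. edge x y - binary_entropy (W x y) = 0 \<and> (x, y) \<in> space ?MM" by simp
  obtain A where A: "A \<in> sets unit_leb" "measure unit_leb A = 1/2" "AE x in unit_leb. AE y in unit_leb. E x y \<longleftrightarrow> (x \<in> A) \<noteq> (y \<in> A)"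
    using mantel_extremal[OF tri half] by blast
  have "AE x in unit_leb. AE y in unit_leb. if (x \<in> A) \<noteq> (y \<in> A) then W x y = 1/2 else W x y = 0 \<or> W x y = 1"
    using A(3) eq
  proof eventually_elim
    case (elim x)
    then show ?case
    proof eventually_elim
      case (elim y)
      then have xy: "x \<in> {0..1}" "y \<in> {0..1}" by (auto simp: space_pair_measure)
      show ?case
      proof (cases "E x y")
        case True
        then have "binary_entropy (W x y) = 1" using elim by (simp add: edge_def)
        then show ?thesis using elim True binary_entropy_bounds(3)[OF W01(1,2)[OF xy]] by auto
      next
        case False
        then show ?thesis using elim W01[OF xy] by (auto simp: E_def)
      qed
    qed
  qed
  then show "\<exists>A\<in>sets unit_leb. measure unit_leb A = 1/2 \<and>
      (AE x in unit_leb. AE y in unit_leb. if (x \<in> A) \<noteq> (y \<in> A) then W x y = 1/2 else W x y = 0 \<or> W x y = 1)"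
    by (intro bexI[of _ A] conjI A)
qed

section \<open>Graphons of maximal entropy\<close>

lemma AEs_conj: "AEs M n P \<Longrightarrow> AEs M n Q \<Longrightarrow> AEs M n (\<lambda>f. P f \<and> Q f)"
proof (induction n arbitrary: P Q)
  case (Suc n)
  from Suc.prems have "AE x in M. AEs M n (\<lambda>f. P (f(n := x)))" "AE x in M. AEs M n (\<lambda>f. Q (f(n := x)))" by simp_all
  then have "AE x in M. AEs M n (\<lambda>f. P (f(n := x)) \<and> Q (f(n := x)))"
    by eventually_elim (rule Suc.IH)
  then show ?case by simp
qed simp

lemma AE_triple_mono:
  assumes "AE x in M. AE y in M. AE z in M. P x y z" "\<And>x y z. P x y z \<Longrightarrow> Q x y z"
  shows "AE x in M. AE y in M. AE z in M. Q x y z"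
  using assms(1)
proof eventually_elim
  case (elim x)
  then show ?case
  proof eventually_elim
    case (elim y)
    then show ?case by eventually_elim (rule assms(2))
  qed
qed

lemma AE_triple_mp:
  assumes "AE x in M. AE y in M. AE z in M. P x y z" "AE x in M. AE y in M. AE z in M. P' x y z"
    and "\<And>x y z. P x y z \<Longrightarrow> P' x y z \<Longrightarrow> Q x y z"
  shows "AE x in M. AE y in M. AE z in M. Q x y z"
  using assms(1,2)
proof eventually_elim
  case (elim x)
  then show ?case
  proof eventually_elim
    case (elim y)
    then show ?case by eventually_elim (rule assms(3))
  qed
qed

lemma AEs_triple:
  assumes "m1 = n + 1" "m2 = n + 2" "m3 = n + 3"
  shows "AEs M m3 P \<longleftrightarrow>
     (AE x in M. AE y in M. AE z in M. AEs M n (\<lambda>f. P (f(n := z, m1 := y, m2 := x))))"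
proof -
  have "m3 = Suc (Suc (Suc n))" "m2 = Suc (Suc n)" "m1 = Suc n" using assms by simp_all
  then show ?thesis by (simp only: AEs.simps)
qed

lemma AEs_2: "AEs M 2 P = (AE x in M. AE y in M. P ((\<lambda>_. undefined)(0 := y, 1 := x)))"
  by (simp add: numeral_2_eq_2)

lemma not_AE_pair_obtain:
  assumes "\<not> (AE x in M. AE y in M. P x y)" "AE x in M. AE y in M. R x y"
  obtains x y where "\<not> P x y" "R x y"
proof -
  have "\<not> (AE x in M. \<not> \<not> (AE y in M. P x y))" using assms(1) by simp
  then obtain x where x: "\<not> (AE y in M. P x y)" "AE y in M. R x y"
    by (rule not_AE_obtain) (rule assms(2))
  from x(1) have "\<not> (AE y in M. \<not> \<not> P x y)" by simp
  then obtain y where "\<not> P x y" "R x y"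
    by (rule not_AE_obtain) (rule x(2))
  then show thesis by (rule that)
qed

section \<open>The two sides of an extremal graphon\<close>

locale split_inc_graphon =
  fixes W :: "real \<Rightarrow> real \<Rightarrow> real" and \<Gamma> :: graph_limit and A :: "real set"
  assumes limit: "represents W \<Gamma>" "\<Gamma> \<in> class_limits INC"
    and A: "A \<in> sets unit_leb" "measure unit_leb A = 1/2"
    and split: "AE x in unit_leb. AE y in unit_leb. if (x \<in> A) \<noteq> (y \<in> A) then W x y = 1/2 else W x y = 0 \<or> W x y = 1"
begin

sublocale prob_space unit_leb by (rule prob_space_unit_leb)

lemma W: "graphon W"
  using limit(1) by (simp add: represents_def)

lemma W_sym: "x \<in> {0..1} \<Longrightarrow> y \<in> {0..1} \<Longrightarrow> W x y = W y x"
  using W by (simp add: graphon_def)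

text \<open>Both sides have measure \<open>1/2\<close>, so neither is null. The boolean
  \<open>s\<close> names a side, which lets one argument serve for both.\<close>

lemma pick_side:
  assumes "AE x in unit_leb. R x"
  obtains x where "(x \<in> A) = s" "R x"
proof -
  have "\<not> (AE x in unit_leb. x \<notin> A)"
    using prob_eq_0[OF A(1)] A(2) by simp
  moreover have "\<not> (AE x in unit_leb. x \<in> A)"
    using prob_eq_1[OF A(1)] A(2) by simp
  ultimately have "\<not> (AE x in unit_leb. \<not> (x \<in> A) = s)"
    by (cases s) auto
  from not_AE_obtain[OF this assms] that show thesis by blast
qed

lemma pick_sides:
  assumes "AEs unit_leb n P"
  obtains f where "\<forall>i<n. (f i \<in> A) = s" "P f"
proof -
  have "\<exists>f. (\<forall>i<n. (f i \<in> A) = s) \<and> P f"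
    using assms
  proof (induction n arbitrary: P)
    case (Suc n)
    from Suc.prems have "AE x in unit_leb. AEs unit_leb n (\<lambda>f. P (f(n := x)))" by simp
    then obtain x where x: "(x \<in> A) = s" "AEs unit_leb n (\<lambda>f. P (f(n := x)))" by (rule pick_side)
    from Suc.IH[OF x(2)] obtain f where f: "\<forall>i<n. (f i \<in> A) = s" "P (f(n := x))" by blast
    then have "\<forall>i<Suc n. ((f(n := x)) i \<in> A) = s" using x(1) by (simp add: less_Suc_eq)
    with f(2) show ?case by blast
  qed auto
  with that show thesis by blast
qed

text \<open>Collects what holds for almost every finite sample. Only distinct indices are
  constrained, since the diagonal is null and \<open>W\<close> is arbitrary there.\<close>

definition typical :: "nat \<Rightarrow> (nat \<Rightarrow> real) \<Rightarrow> bool" where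
  "typical n f \<longleftrightarrow> (\<forall>i<n. f i \<in> {0..1}) \<and> inc_weights {..<n} (\<lambda>i j. W (f i) (f j)) \<and>
     (\<forall>i<n. \<forall>j<n. i \<noteq> j \<longrightarrow>
        (if (f i \<in> A) \<noteq> (f j \<in> A) then W (f i) (f j) = 1/2 else W (f i) (f j) = 0 \<or> W (f i) (f j) = 1))"

lemma AEs_typical: "AEs unit_leb n (typical n)"
proof (rule AE_PiM_imp_AEs[OF prob_space_unit_leb])
  have Wm [measurable]: "(\<lambda>p. W (fst p) (snd p)) \<in> borel_measurable (unit_leb \<Otimes>\<^sub>M unit_leb)"
    using W by (simp add: graphon_def case_prod_beta')
  have [measurable]: "A \<in> sets unit_leb" by (rule A)
  have "AE p in unit_leb \<Otimes>\<^sub>M unit_leb. if (fst p \<in> A) \<noteq> (snd p \<in> A) then W (fst p) (snd p) = 1/2 else W (fst p) (snd p) = 0 \<or> W (fst p) (snd p) = 1"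
    by (rule AE_pair_of_iterated[OF split]) measurable
  moreover define R where "R f i j \<longleftrightarrow> (if (f i \<in> A) \<noteq> (f j \<in> A) then W (f i) (f j) = 1/2 else W (f i) (f j) = 0 \<or> W (f i) (f j) = 1)"
    for f :: "nat \<Rightarrow> real" and i j
  ultimately have R: "AE f in PiM {..<n} (\<lambda>_. unit_leb). R f i j" if "i < n" "j < n" "i \<noteq> j" for i j
    unfolding R_def using that by (intro AE_PiM_pair[OF prob_space_unit_leb, where u = i and v = j]) auto
  have "AE f in PiM {..<n} (\<lambda>_. unit_leb). \<forall>i\<in>{..<n}. \<forall>j\<in>{..<n}. i \<noteq> j \<longrightarrow> R f i j"
  proof (intro AE_finite_allI finite_lessThan)
    fix i j assume "i \<in> {..<n}" "j \<in> {..<n}"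
    then show "AE f in PiM {..<n} (\<lambda>_. unit_leb). i \<noteq> j \<longrightarrow> R f i j"
      using R[of i j] by (cases "i = j") auto
  qed
  with AE_inc_weights[OF limit, of "{..<n}"] AE_space
  show "AE f in PiM {..<n} (\<lambda>_. unit_leb). typical n f"
  proof eventually_elim
    case (elim f)
    have "f i \<in> {0..1}" if "i < n" for i
      using elim(2) that PiE_mem[of f "{..<n}" "\<lambda>_. {0..1}" i] by (simp add: space_PiM)
    with elim show ?case unfolding typical_def R_def by blast
  qed
qed

lemma typical_inc_weighting:
  assumes "typical n f"
  shows "inc_weighting {..<n} (\<lambda>i j. W (f i) (f j))"
  by unfold_locales (use assms W_sym in \<open>simp_all add: typical_def\<close>)

lemma typical_same:
  assumes "typical n f" "i < n" "j < n" "i \<noteq> j" "(f i \<in> A) = (f j \<in> A)"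
  shows "W (f i) (f j) = 0 \<or> W (f i) (f j) = 1"
  using assms unfolding typical_def by metis

lemma typical_half:
  assumes "typical n f" "i < n" "j < n" "(f i \<in> A) \<noteq> (f j \<in> A)"
  shows "W (f i) (f j) = 1/2"
  using assms unfolding typical_def by metis

lemma typical_free:
  assumes "typical n f" "X \<subseteq> {..<n}" "Y \<subseteq> {..<n}" "\<forall>i\<in>X. (f i \<in> A) = s" "\<forall>i\<in>Y. (f i \<in> A) = (\<not> s)"
  shows "inc_weighting.free (\<lambda>i j. W (f i) (f j)) X Y"
proof -
  interpret inc_weighting "{..<n}" "\<lambda>i j. W (f i) (f j)" using assms(1) by (rule typical_inc_weighting)
  show ?thesis
    unfolding free_def
  proof (intro ballI)
    fix i j assume "i \<in> X" "j \<in> Y"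
    then have "i < n" "j < n" "(f i \<in> A) \<noteq> (f j \<in> A)" using assms by auto
    then show "0 < W (f i) (f j) \<and> W (f i) (f j) < 1 \<and> 0 < W (f j) (f i) \<and> W (f j) (f i) < 1"
      using typical_half[OF assms(1), of i j] typical_half[OF assms(1), of j i] by simp
  qed
qed

text \<open>A stable triple on one side together with six points of the other side would contain a net
  or a 6-cycle.\<close>

lemma no_stable_triple:
  "AE x in unit_leb. AE y in unit_leb. AE z in unit_leb.
     (x \<in> A) = s \<and> (y \<in> A) = s \<and> (z \<in> A) = s \<longrightarrow> \<not> (W x y = 0 \<and> W x z = 0 \<and> W y z = 0)"
proof -
  have "AE x in unit_leb. AE y in unit_leb. AE z in unit_leb. AEs unit_leb 6 (\<lambda>f. typical 9 (f(6 := z, 7 := y, 8 := x)))"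
    by (rule AEs_triple[THEN iffD1, OF _ _ _ AEs_typical]) simp_all
  then show ?thesis
  proof (rule AE_triple_mono)
    fix x y z assume "AEs unit_leb 6 (\<lambda>f. typical 9 (f(6 := z, 7 := y, 8 := x)))"
    then obtain f where f: "\<forall>i<6. (f i \<in> A) = (\<not> s)" "typical 9 (f(6 := z, 7 := y, 8 := x))"
      by (rule pick_sides)
    define g where "g = f(6 := z, 7 := y, 8 := x)"
    have g: "g 8 = x" "g 7 = y" "g 6 = z" "\<And>i. i < 6 \<Longrightarrow> (g i \<in> A) = (\<not> s)"
      using f(1) by (simp_all add: g_def)
    have t: "typical 9 g" using f(2) by (simp add: g_def)
    interpret inc_weighting "{..<9}" "\<lambda>i j. W (g i) (g j)" using t by (rule typical_inc_weighting)
    show "(x \<in> A) = s \<and> (y \<in> A) = s \<and> (z \<in> A) = s \<longrightarrow> \<not> (W x y = 0 \<and> W x z = 0 \<and> W y z = 0)"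
    proof (intro impI notI)
      assume s: "(x \<in> A) = s \<and> (y \<in> A) = s \<and> (z \<in> A) = s" and w: "W x y = 0 \<and> W x z = 0 \<and> W y z = 0"
      have fr: "free {6, 7, 8} {..<6}"
        by (rule typical_free[OF t]) (use g s in auto)
      show False
      proof (rule stable_ramsey_false[OF _ _ _ fr, of 8 7 6])
        show "W (g b) (g b') = 0 \<or> W (g b) (g b') = 1" if "b \<in> {..<6}" "b' \<in> {..<6}" "b \<noteq> b'" for b b'
          by (rule typical_same[OF t]) (use that g(4)[of b] g(4)[of b'] in auto)
      qed (use g w in auto)
    qed
  qed
qed

text \<open>Sum 0 is a stable triple. Sum 2 is a path, which with an edge of the other side gives a
  5-cycle, and that edge exists because the other side has no stable triples either. So on each
  side, up to null sets, weight 1 is an equivalence relation with at most two classes.\<close>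

lemma triple_sum:
  "AE x in unit_leb. AE y in unit_leb. AE z in unit_leb. (x \<in> A) = s \<and> (y \<in> A) = s \<and> (z \<in> A) = s \<longrightarrow>
     (W x y = 0 \<or> W x y = 1) \<and> (W x z = 0 \<or> W x z = 1) \<and> (W y z = 0 \<or> W y z = 1) \<and>
     (W x y + W x z + W y z = 1 \<or> W x y + W x z + W y z = 3)"
proof -
  define Q where "Q f \<longleftrightarrow> (f 2 \<in> A) = (\<not> s) \<and> (f 1 \<in> A) = (\<not> s) \<and> (f 0 \<in> A) = (\<not> s) \<longrightarrow>
    \<not> (W (f 2) (f 1) = 0 \<and> W (f 2) (f 0) = 0 \<and> W (f 1) (f 0) = 0)" for f :: "nat \<Rightarrow> real"
  have Q: "AEs unit_leb 3 Q"
    by (rule AEs_triple[THEN iffD2, of 1 0 2]) (use no_stable_triple[of "\<not> s"] in \<open>simp_all add: Q_def\<close>)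
  have "AE x in unit_leb. AE y in unit_leb. AE z in unit_leb. AEs unit_leb 3 (\<lambda>f. typical 6 (f(3 := z, 4 := y, 5 := x)))"
    by (rule AEs_triple[THEN iffD1, OF _ _ _ AEs_typical]) simp_all
  then show ?thesis
    using no_stable_triple[of s]
  proof (rule AE_triple_mp)
    fix x y z assume 1: "AEs unit_leb 3 (\<lambda>f. typical 6 (f(3 := z, 4 := y, 5 := x)))"
      and ns: "(x \<in> A) = s \<and> (y \<in> A) = s \<and> (z \<in> A) = s \<longrightarrow> \<not> (W x y = 0 \<and> W x z = 0 \<and> W y z = 0)"
    obtain f where f: "\<forall>i<3. (f i \<in> A) = (\<not> s)" "typical 6 (f(3 := z, 4 := y, 5 := x)) \<and> Q f"
      using AEs_conj[OF 1 Q] by (rule pick_sides)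
    define g where "g = f(3 := z, 4 := y, 5 := x)"
    have g: "g 5 = x" "g 4 = y" "g 3 = z" "g 0 = f 0" "g 1 = f 1" "g 2 = f 2"
      by (auto simp: g_def)
    have gs: "(g 0 \<in> A) = (\<not> s)" "(g 1 \<in> A) = (\<not> s)" "(g 2 \<in> A) = (\<not> s)"
      using f(1)[rule_format, of 0] f(1)[rule_format, of 1] f(1)[rule_format, of 2] g by simp_all
    have t: "typical 6 g" using f(2) by (simp add: g_def)
    interpret inc_weighting "{..<6}" "\<lambda>i j. W (g i) (g j)" using t by (rule typical_inc_weighting)
    show "(x \<in> A) = s \<and> (y \<in> A) = s \<and> (z \<in> A) = s \<longrightarrow>
     (W x y = 0 \<or> W x y = 1) \<and> (W x z = 0 \<or> W x z = 1) \<and> (W y z = 0 \<or> W y z = 1) \<and>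
     (W x y + W x z + W y z = 1 \<or> W x y + W x z + W y z = 3)"
    proof
      assume s: "(x \<in> A) = s \<and> (y \<in> A) = s \<and> (z \<in> A) = s"
      have fr: "free {3, 4, 5} {0, 1, 2}"
        by (rule typical_free[OF t]) (use g(1-3) gs s in auto)
      have vals: "W x y = 0 \<or> W x y = 1" "W x z = 0 \<or> W x z = 1" "W y z = 0 \<or> W y z = 1"
        using typical_same[OF t, of 5 4] typical_same[OF t, of 5 3] typical_same[OF t, of 4 3] g s by auto
      have sy: "W y x = W x y" "W z x = W x z" "W z y = W y z"
        using sym[of 4 5] sym[of 3 5] sym[of 3 4] g(1-3) by auto
      have "0 < W (g 2) (g 1) \<or> 0 < W (g 2) (g 0) \<or> 0 < W (g 1) (g 0)"
        using typical_same[OF t, of 2 1] typical_same[OF t, of 2 0] typical_same[OF t, of 1 0] gs f(2) g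
        by (auto simp: Q_def)
      then obtain i j where ij: "i \<in> {0,1,2}" "j \<in> {0,1,2}" "i \<noteq> j" "0 < W (g i) (g j)"
        by (metis insertCI zero_neq_one zero_neq_numeral one_eq_numeral_iff semiring_norm(83))
      have path: False if "a \<in> {3,4,5}" "b \<in> {3,4,5}" "c \<in> {3,4,5}" "distinct [a, b, c]"
        "W (g a) (g b) = 1" "W (g b) (g c) = 1" "W (g a) (g c) = 0" for a b c
        by (rule path_edge_false[OF _ _ _ fr that(1-4) ij(1-3)]) (use that(5-7) ij(4) in auto)
      have "\<not> (W x y = 1 \<and> W y z = 1 \<and> W x z = 0)"
        using path[of 5 4 3] g(1-3) by auto
      moreover have "\<not> (W x z = 1 \<and> W y z = 1 \<and> W x y = 0)"
        using path[of 5 3 4] g(1-3) sy by auto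
      moreover have "\<not> (W x y = 1 \<and> W x z = 1 \<and> W y z = 0)"
        using path[of 4 5 3] g(1-3) sy by auto
      ultimately show "(W x y = 0 \<or> W x y = 1) \<and> (W x z = 0 \<or> W x z = 1) \<and> (W y z = 0 \<or> W y z = 1) \<and>
          (W x y + W x z + W y z = 1 \<or> W x y + W x z + W y z = 3)"
        using vals ns s by auto
    qed
  qed
qed

text \<open>Otherwise both sides have non-null sets of non-adjacent pairs. By
  \<open>triple_sum\<close> a third point of \<open>A\<close> is adjacent to exactly one end of such
  a pair in \<open>A\<close>, and this configuration together with a non-edge of the other side is a
  5-cycle.\<close>

lemma one_side_complete:
  obtains s where "AE x in unit_leb. AE y in unit_leb. (x \<in> A) = s \<and> (y \<in> A) = s \<longrightarrow> W x y = 1"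
proof (rule ccontr)
  assume "\<not> thesis"
  then have N: "\<not> (AE x in unit_leb. AE y in unit_leb. (x \<in> A) = s \<and> (y \<in> A) = s \<longrightarrow> W x y = 1)" for s
    using that by blast
  have "AE x in unit_leb. AE y in unit_leb. AE z in unit_leb. AEs unit_leb 2 (\<lambda>f. typical 5 (f(2 := z, 3 := y, 4 := x)))"
    by (rule AEs_triple[THEN iffD1, OF _ _ _ AEs_typical]) simp_all
  then have "AE x in unit_leb. AE y in unit_leb. AE z in unit_leb. AEs unit_leb 2 (\<lambda>f. typical 5 (f(2 := z, 3 := y, 4 := x))) \<and>
     ((x \<in> A) = True \<and> (y \<in> A) = True \<and> (z \<in> A) = True \<longrightarrow> (W x y = 0 \<or> W x y = 1) \<and> (W x z = 0 \<or> W x z = 1) \<and> (W y z = 0 \<or> W y z = 1) \<and>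
     (W x y + W x z + W y z = 1 \<or> W x y + W x z + W y z = 3))"
    using triple_sum[of True] by (rule AE_triple_mp) (rule conjI)
  then obtain x y where xy: "\<not> ((x \<in> A) = True \<and> (y \<in> A) = True \<longrightarrow> W x y = 1)"
    and 1: "AE z in unit_leb. AEs unit_leb 2 (\<lambda>f. typical 5 (f(2 := z, 3 := y, 4 := x))) \<and>
     ((x \<in> A) = True \<and> (y \<in> A) = True \<and> (z \<in> A) = True \<longrightarrow> (W x y = 0 \<or> W x y = 1) \<and> (W x z = 0 \<or> W x z = 1) \<and> (W y z = 0 \<or> W y z = 1) \<and>
     (W x y + W x z + W y z = 1 \<or> W x y + W x z + W y z = 3))"
    by (rule not_AE_pair_obtain[OF N[of True]])
  obtain z where z: "(z \<in> A) = True"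
    and 2: "AEs unit_leb 2 (\<lambda>f. typical 5 (f(2 := z, 3 := y, 4 := x))) \<and>
     ((x \<in> A) = True \<and> (y \<in> A) = True \<and> (z \<in> A) = True \<longrightarrow> (W x y = 0 \<or> W x y = 1) \<and> (W x z = 0 \<or> W x z = 1) \<and> (W y z = 0 \<or> W y z = 1) \<and>
     (W x y + W x z + W y z = 1 \<or> W x y + W x z + W y z = 3))"
    using 1 by (rule pick_side)
  have W3: "W x y = 0" "W x z = 0 \<or> W x z = 1" "W y z = 0 \<or> W y z = 1" "W x z + W y z = 1"
    using xy z 2 by auto
  have "AE u in unit_leb. AE v in unit_leb. typical 5 ((\<lambda>_. undefined)(0 := v, 1 := u, 2 := z, 3 := y, 4 := x))"
    using conjunct1[OF 2] by (simp only: AEs_2)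
  then obtain u v where uv: "\<not> ((u \<in> A) = False \<and> (v \<in> A) = False \<longrightarrow> W u v = 1)"
    and t': "typical 5 ((\<lambda>_. undefined)(0 := v, 1 := u, 2 := z, 3 := y, 4 := x))"
    by (rule not_AE_pair_obtain[OF N[of False]])
  define g :: "nat \<Rightarrow> real" where "g = (\<lambda>_. undefined)(0 := v, 1 := u, 2 := z, 3 := y, 4 := x)"
  have g: "g 0 = v" "g 1 = u" "g 2 = z" "g 3 = y" "g 4 = x" by (simp_all add: g_def)
  have t: "typical 5 g" using t' by (simp add: g_def)
  interpret inc_weighting "{..<5}" "\<lambda>i j. W (g i) (g j)" using t by (rule typical_inc_weighting)
  have fr: "free {2, 3, 4} {0, 1}"
    by (rule typical_free[OF t, of _ _ True]) (use g xy z uv in auto)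
  have sy: "W y x = W x y" "W z x = W x z" "W z y = W y z"
    using sym[of 3 4] sym[of 2 4] sym[of 2 3] g by auto
  have "W u v < 1"
    using typical_same[OF t, of 1 0] uv g by auto
  then have uv1: "W (g 1) (g 0) < 1" using g by simp
  show False
  proof (cases "W x z = 1")
    case True
    then have "W y z = 0" using W3 by simp
    show False
      by (rule copath_nonedge_false[OF _ _ _ fr, of 4 2 3 1 0]) (use True \<open>W y z = 0\<close> W3 sy g uv1 in auto)
  next
    case False
    then have "W x z = 0" "W y z = 1" using W3 by auto
    show False
      by (rule copath_nonedge_false[OF _ _ _ fr, of 3 2 4 1 0]) (use \<open>W x z = 0\<close> \<open>W y z = 1\<close> W3 sy g uv1 in auto)
  qed
qed

text \<open>One typical point \<open>x\<close> of the side not yet known to be complete reveals its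
  classes. The three weights among \<open>x\<close>, \<open>y\<close>, \<open>z\<close> sum to 1 or
  3, so \<open>W y z\<close> is 1 exactly if \<open>y\<close> and \<open>z\<close> are both adjacent
  or both non-adjacent to \<open>x\<close>.\<close>

lemma block_structure:
  obtains c where "c \<in> unit_leb \<rightarrow>\<^sub>M count_space UNIV" "c \<in> {0..1} \<rightarrow> {0, 1, 2}"
    "measure unit_leb {x \<in> {0..1}. c x = 2} = 1/2"
    "AE y in unit_leb. AE z in unit_leb. W y z = block_weight (c y) (c z)"
proof -
  obtain s where s: "AE x in unit_leb. AE y in unit_leb. (x \<in> A) = s \<and> (y \<in> A) = s \<longrightarrow> W x y = 1"
    by (rule one_side_complete)
  have "AE x in unit_leb. (AE y in unit_leb. AE z in unit_leb. (x \<in> A) = (\<not> s) \<and> (y \<in> A) = (\<not> s) \<and> (z \<in> A) = (\<not> s) \<longrightarrow>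
     (W x y = 0 \<or> W x y = 1) \<and> (W x z = 0 \<or> W x z = 1) \<and> (W y z = 0 \<or> W y z = 1) \<and>
     (W x y + W x z + W y z = 1 \<or> W x y + W x z + W y z = 3)) \<and> x \<in> space unit_leb"
    using triple_sum[of "\<not> s"] AE_space by eventually_elim (rule conjI)
  then obtain x where x: "(x \<in> A) = (\<not> s)"
    and x': "(AE y in unit_leb. AE z in unit_leb. (x \<in> A) = (\<not> s) \<and> (y \<in> A) = (\<not> s) \<and> (z \<in> A) = (\<not> s) \<longrightarrow>
     (W x y = 0 \<or> W x y = 1) \<and> (W x z = 0 \<or> W x z = 1) \<and> (W y z = 0 \<or> W y z = 1) \<and>
     (W x y + W x z + W y z = 1 \<or> W x y + W x z + W y z = 3)) \<and> x \<in> space unit_leb"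
    by (rule pick_side)
  define c where "c y = (if (y \<in> A) = s then 2 else if W x y = 1 then 0 else 1 :: nat)" for y
  have "Pair x \<in> unit_leb \<rightarrow>\<^sub>M unit_leb \<Otimes>\<^sub>M unit_leb"
    by (rule measurable_Pair1') (rule conjunct2[OF x'])
  from measurable_compose[OF this, of "\<lambda>(x, y). W x y" borel] W
  have [measurable]: "(\<lambda>y. W x y) \<in> borel_measurable unit_leb" by (simp add: graphon_def)
  have [measurable]: "A \<in> sets unit_leb" by (rule A)
  have "c \<in> unit_leb \<rightarrow>\<^sub>M count_space UNIV" unfolding c_def by measurable
  moreover have "c \<in> {0..1} \<rightarrow> {0, 1, 2}" by (auto simp: c_def)
  moreover have "measure unit_leb {x \<in> {0..1}. c x = 2} = 1/2"
  proof -
    have sub: "A \<subseteq> {0..1}" using sets.sets_into_space[OF A(1)] by simp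
    have "{x \<in> {0..1}. c x = 2} = (if s then A else space unit_leb - A)"
      using sub by (auto simp: c_def)
    then show ?thesis using A prob_compl[OF A(1)] by simp
  qed
  moreover have "AE y in unit_leb. AE z in unit_leb. W y z = block_weight (c y) (c z)"
    using s split conjunct1[OF x']
  proof eventually_elim
    case (elim y)
    then show ?case
    proof eventually_elim
      case (elim z)
      consider "(y \<in> A) = s" "(z \<in> A) = s" | "(y \<in> A) \<noteq> (z \<in> A)" | "(y \<in> A) = (\<not> s)" "(z \<in> A) = (\<not> s)" by blast
      then show ?case
      proof cases
        case 1
        then show ?thesis using elim(1) by (simp add: c_def block_weight_def)
      next
        case 2
        then have "(c y = 2) \<noteq> (c z = 2)" by (auto simp: c_def)
        then show ?thesis using elim(2) 2 by (simp add: block_weight_def)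
      next
        case 3
        then have "(W x y = 0 \<or> W x y = 1) \<and> (W x z = 0 \<or> W x z = 1) \<and> (W y z = 0 \<or> W y z = 1) \<and>
          (W x y + W x z + W y z = 1 \<or> W x y + W x z + W y z = 3)"
          using elim(3) x by simp
        then show ?thesis using 3 by (auto simp: c_def block_weight_def)
      qed
    qed
  qed
  ultimately show thesis by (rule that)
qed

end

section \<open>The standard graphons as step graphons\<close>

lemma measurable_unit_leb_borel: "(\<lambda>x. x) \<in> unit_leb \<rightarrow>\<^sub>M borel"
  unfolding unit_leb_def by (rule measurable_restrict_space1) simp

lemma measure_unit_leb:
  assumes "B \<in> sets borel" "B \<subseteq> {0..1}"
  shows "B \<in> sets unit_leb" "measure unit_leb B = measure lborel B"
  using assms by (auto simp: unit_leb_def sets_restrict_space_iff measure_restrict_space)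

lemma AE_unit_leb_less_1: "AE x in unit_leb. x < 1"
proof -
  have "AE x in lborel. x \<noteq> (1::real)" by (rule AE_lborel_singleton)
  then have "AE x in lborel. x \<in> {0..1::real} \<longrightarrow> x < 1" by eventually_elim auto
  then show ?thesis unfolding unit_leb_def by (subst AE_restrict_space_iff) auto
qed

lemma W_graphon_2:
  "W_graphon 2 a x y =
     (if 0 \<le> x \<and> x < 1/2 \<and> 1/2 \<le> y \<and> y < 1 \<or> 1/2 \<le> x \<and> x < 1 \<and> 0 \<le> y \<and> y < 1/2 then 1/2
      else if 1/2 \<le> x \<and> x < 1 \<and> 1/2 \<le> y \<and> y < 1 then 1
      else if 0 \<le> x \<and> x < a/2 \<and> 0 \<le> y \<and> y < a/2 \<or> a/2 \<le> x \<and> x < 1/2 \<and> a/2 \<le> y \<and> y < 1/2 then 1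
      else 0)"
proof -
  have p: "part 2 1 = {0..<1/2}" "part 2 (Suc 0) = {0..<1/2}" "part 2 2 = {1/2..<1}" by (simp_all add: part_def)
  have i: "{1..2::nat} = {1, 2}" "{2..2::nat} = {2}" by auto
  show ?thesis unfolding W_graphon_def i by (simp add: p)
qed

text \<open>The point 1 receives label 2 although \<open>W_graphon\<close> vanishes when a
  coordinate is 1, so labels and graphon are compared on \<open>[0, 1)\<close> only.\<close>

definition W_label :: "real \<Rightarrow> real \<Rightarrow> nat" where
  "W_label a x = (if x < a/2 then 0 else if x < 1/2 then 1 else 2)"

lemma W_graphon_2_label:
  assumes "a \<in> {0..1}" "x \<in> {0..<1}" "y \<in> {0..<1}"
  shows "W_graphon 2 a x y = block_weight (W_label a x) (W_label a y)"
proof -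
  have "x < a/2 \<or> a/2 \<le> x \<and> x < 1/2 \<or> 1/2 \<le> x" "y < a/2 \<or> a/2 \<le> y \<and> y < 1/2 \<or> 1/2 \<le> y" by linarith+
  then show ?thesis
    using assms unfolding W_graphon_2 W_label_def block_weight_def
    by (elim disjE conjE) simp_all
qed

lemma graphon_W_graphon_2:
  assumes "a \<in> {0..1}"
  shows "graphon (W_graphon 2 a)"
proof -
  have [measurable]: "fst \<in> borel_measurable (unit_leb \<Otimes>\<^sub>M unit_leb)" "snd \<in> borel_measurable (unit_leb \<Otimes>\<^sub>M unit_leb)"
    using measurable_compose[OF measurable_fst measurable_unit_leb_borel] measurable_compose[OF measurable_snd measurable_unit_leb_borel]
    by auto
  have "(\<lambda>p. W_graphon 2 a (fst p) (snd p)) \<in> borel_measurable (unit_leb \<Otimes>\<^sub>M unit_leb)"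
    unfolding W_graphon_2 by measurable
  moreover have "W_graphon 2 a x y = W_graphon 2 a y x" if "x \<in> {0..1}" "y \<in> {0..1}" for x y
  proof (cases "x < 1 \<and> y < 1")
    case True
    then show ?thesis using that by (simp add: W_graphon_2_label[OF assms] block_weight_def)
  next
    case False
    then have "x = 1 \<or> y = 1" using that by auto
    then show ?thesis using assms by (auto simp: W_graphon_2)
  qed
  moreover have "0 \<le> W_graphon 2 a x y \<and> W_graphon 2 a x y \<le> 1" for x y
    unfolding W_graphon_2 by simp
  ultimately show ?thesis by (simp add: graphon_def case_prod_beta')
qed

text \<open>Label 1 has whatever measure remains, so the measure of label 0 decides all densities.
  This makes an extremal graphon and the standard one with the same parameter
  interchangeable.\<close>

lemma graphon_density_blocks:
  assumes W: "graphon W" and F: "pair_graph F"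
    and c: "c \<in> unit_leb \<rightarrow>\<^sub>M count_space UNIV" "c \<in> {0..1} \<rightarrow> {0, 1, 2}"
    and step: "AE y in unit_leb. AE z in unit_leb. W y z = block_weight (c y) (c z)"
    and half: "measure unit_leb {x \<in> {0..1}. c x = 2} = 1/2"
    and a: "measure unit_leb {x \<in> {0..1}. c x = 0} = a/2"
  shows "graphon_density F W = block_density F a"
proof -
  interpret prob_space unit_leb by (rule prob_space_unit_leb)
  let ?D = "\<lambda>j. {x \<in> {0..1}. c x = j}"
  have D: "?D j \<in> sets unit_leb" for j
    using measurable_sets[OF c(1), of "{j}"] by (simp add: vimage_def Int_def conj_commute)
  have "x \<in> ?D 0 \<union> (?D 1 \<union> ?D 2)" if "x \<in> {0..1}" for x
    using Pi_mem[OF c(2) that] that by auto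
  then have U: "?D 0 \<union> (?D 1 \<union> ?D 2) = space unit_leb" unfolding space_unit_leb by blast
  have "1 = measure unit_leb (?D 0 \<union> (?D 1 \<union> ?D 2))"
    unfolding U by (rule prob_space[symmetric])
  also have "\<dots> = measure unit_leb (?D 0) + (measure unit_leb (?D 1) + measure unit_leb (?D 2))"
    by (subst finite_measure_Union, use D in auto)+
  finally have "measure unit_leb (?D 1) = (1 - a)/2" using half a by (simp add: field_simps)
  then have "measure unit_leb (?D j) = block_measure a j" if "j \<in> {0, 1, 2}" for j
    using that half a by (auto simp: block_measure_def)
  then have "measure unit_leb (?D (g v)) = block_measure a (g v)" if "g \<in> pverts F \<rightarrow>\<^sub>E {0, 1, 2}" "v \<in> pverts F" for g v
    using PiE_mem[OF that] by blast
  then show ?thesis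
    unfolding block_density_def graphon_density_step[OF W F c _ step, simplified]
    by (intro sum.cong refl arg_cong2[where f = "(*)"] prod.cong) auto
qed

lemma graphon_density_W_graphon_2:
  assumes a: "a \<in> {0..1}" and F: "pair_graph F"
  shows "graphon_density F (W_graphon 2 a) = block_density F a"
proof (rule graphon_density_blocks[OF graphon_W_graphon_2[OF a] F])
  have [measurable]: "(\<lambda>x. x) \<in> borel_measurable unit_leb" by (rule measurable_unit_leb_borel)
  show "W_label a \<in> unit_leb \<rightarrow>\<^sub>M count_space UNIV" unfolding W_label_def by measurable
  show "W_label a \<in> {0..1} \<rightarrow> {0, 1, 2}" by (auto simp: W_label_def)
  have "{x \<in> {0..1}. W_label a x = 2} = {1/2..1}" using a by (auto simp: W_label_def)
  then show "measure unit_leb {x \<in> {0..1}. W_label a x = 2} = 1/2" by (simp add: measure_unit_leb)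
  have "{x \<in> {0..1}. W_label a x = 0} = {0..<a/2}" using a by (auto simp: W_label_def split: if_splits)
  moreover have "{0..<a/2} \<subseteq> {0..1}" using a by auto
  ultimately show "measure unit_leb {x \<in> {0..1}. W_label a x = 0} = a/2"
    using a measure_unit_leb(2)[of "{0..<a/2}"] by simp
  have "AE y in unit_leb. y < 1 \<and> 0 \<le> y" using AE_unit_leb_less_1 AE_space by eventually_elim simp
  then show "AE y in unit_leb. AE z in unit_leb. W_graphon 2 a y z = block_weight (W_label a y) (W_label a z)"
  proof eventually_elim
    case (elim y)
    from \<open>AE y in unit_leb. y < 1 \<and> 0 \<le> y\<close> show ?case
    proof eventually_elim
      case (elim z)
      then show ?case using \<open>y < 1 \<and> 0 \<le> y\<close> by (simp add: W_graphon_2_label[OF a])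
    qed
  qed
qed

text \<open>The parameter only moves values 0 and 1, which carry no entropy. The two blocks of value
  \<open>1/2\<close> have total area \<open>1/2\<close>.\<close>

lemma graphon_entropy_W_graphon_2: "graphon_entropy (W_graphon 2 a) = 1/2"
proof -
  have h: "binary_entropy (1/2) = 1" by (simp add: binary_entropy_def log_divide)
  have eq: "binary_entropy (W_graphon 2 a x y) =
      (if x < 1/2 then indicator {1/2..<1} y else if x < 1 then indicator {0..<1/2} y else 0)"
    if "x \<in> {0..1}" "y \<in> {0..1}" for x y
    using that unfolding W_graphon_2 by (auto simp: h binary_entropy_0_1 indicator_def)
  have inner: "(\<integral>y. binary_entropy (W_graphon 2 a x y) \<partial>unit_leb) = indicator {0..<1} x * (1/2)" if x: "x \<in> {0..1}" for x
  proof -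
    have "(\<integral>y. binary_entropy (W_graphon 2 a x y) \<partial>unit_leb) =
       (\<integral>y. (if x < 1/2 then indicator {1/2..<1} y else if x < 1 then indicator {0..<1/2} y else 0) \<partial>unit_leb)"
      using eq[OF x] by (intro Bochner_Integration.integral_cong refl) simp
    also have "\<dots> = indicator {0..<1} x * (1/2)"
    proof -
      have sub: "{1/2..<1} \<subseteq> {0..1::real}" "{0..<1/2} \<subseteq> {0..1::real}" by auto
      then have m: "{1/2..<1} \<in> sets unit_leb" "{0..<1/2} \<in> sets unit_leb"
        "measure unit_leb {1/2..<1} = 1/2" "measure unit_leb {0..<1/2} = 1/2"
        by (simp_all add: measure_unit_leb)
      consider "x < 1/2" | "1/2 \<le> x" "x < 1" | "x = 1" using x by fastforce
      then show ?thesis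
        using x m Int_absorb2[OF sub(1)] Int_absorb2[OF sub(2)] by cases simp_all
    qed
    finally show ?thesis .
  qed
  have "graphon_entropy (W_graphon 2 a) = (\<integral>x. indicator {0..<1} x * (1/2) \<partial>unit_leb)"
    unfolding graphon_entropy_def using inner by (intro Bochner_Integration.integral_cong refl) simp
  also have "\<dots> = 1/2"
  proof -
    have sub: "{0..<1} \<subseteq> {0..1::real}" by auto
    then show ?thesis using measure_unit_leb[of "{0..<1}"] Int_absorb2[OF sub] by simp
  qed
  finally show ?thesis .
qed

section \<open>The maximal entropy and the limits that attain it\<close>

lemma W_graphon_2_class_limit:
  assumes "a \<in> {0..1}" "\<And>F. pair_graph F \<Longrightarrow> \<Gamma> F = block_density F a"
  shows "\<Gamma> \<in> class_limits INC"
proof -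
  obtain G where "\<forall>n. G n \<in> INC" "filterlim (\<lambda>n. card (pverts (G n))) at_top sequentially"
    "\<forall>F. pair_graph F \<longrightarrow> (\<lambda>n. hom_density F (G n)) \<longlonglongrightarrow> block_density F a"
    by (rule block_density_limit[OF assms(1)])
  then show ?thesis
    using assms(2) unfolding class_limits_def converges_to_def by auto
qed

text \<open>The bound holds for each graphon representing the limit, whichever of them
  \<open>has_entropy\<close> refers to.\<close>

lemma INC_entropy_le:
  assumes "\<Gamma> \<in> class_limits INC" "has_entropy \<Gamma> e"
  shows "e \<le> 1/2"
proof -
  obtain W where W: "represents W \<Gamma>" "graphon_entropy W = e"
    using assms(2) by (auto simp: has_entropy_def)
  then have "graphon W" by (simp add: represents_def)
  from entropy_bound(1)[OF this AE_no_free_triangle[OF W(1) assms(1)]] W(2) show ?thesis by simp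
qed

theorem theorem1p7:
  fixes \<Gamma> :: graph_limit
  assumes "\<Gamma> \<in> graph_limits"
  shows "\<Gamma> \<in> max_entropy_limits INC \<longleftrightarrow> (\<exists>a\<in>{0..1}. represents (W_graphon 2 a) \<Gamma>)"
proof
  assume "\<Gamma> \<in> max_entropy_limits INC"
  then obtain e where L: "\<Gamma> \<in> class_limits INC" and e: "has_entropy \<Gamma> e"
    and max: "\<And>\<Gamma>' e'. \<Gamma>' \<in> class_limits INC \<Longrightarrow> has_entropy \<Gamma>' e' \<Longrightarrow> e' \<le> e"
    by (auto simp: max_entropy_limits_def)
  have 1: "(1::real) \<in> {0..1}" by simp
  \<comment> \<open>One limit of entropy \<open>1/2\<close> shows that the maximum is at least
    \<open>1/2\<close>; the parameter 1 is an arbitrary choice from the unit interval.\<close>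
  have "(\<lambda>F. graphon_density F (W_graphon 2 1)) \<in> class_limits INC"
    by (rule W_graphon_2_class_limit[OF 1]) (rule graphon_density_W_graphon_2[OF 1])
  moreover have "has_entropy (\<lambda>F. graphon_density F (W_graphon 2 1)) (1/2)"
    unfolding has_entropy_def represents_def
    using graphon_W_graphon_2[OF 1] graphon_entropy_W_graphon_2[of 1] by blast
  ultimately have "1/2 \<le> e" by (rule max)
  with INC_entropy_le[OF L e] have "e = 1/2" by linarith
  then obtain W where rep: "represents W \<Gamma>" "graphon_entropy W = 1/2"
    using e by (auto simp: has_entropy_def)
  then have gW: "graphon W" by (simp add: represents_def)
  from entropy_bound(2)[OF gW AE_no_free_triangle[OF rep(1) L] rep(2)]
  obtain A where "A \<in> sets unit_leb" "measure unit_leb A = 1/2"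
    "AE x in unit_leb. AE y in unit_leb. if (x \<in> A) \<noteq> (y \<in> A) then W x y = 1/2 else W x y = 0 \<or> W x y = 1"
    by blast
  then interpret split_inc_graphon W \<Gamma> A
    by unfold_locales (use rep L in auto)
  obtain c where c: "c \<in> unit_leb \<rightarrow>\<^sub>M count_space UNIV" "c \<in> {0..1} \<rightarrow> {0, 1, 2}"
    "measure unit_leb {x \<in> {0..1}. c x = 2} = 1/2"
    "AE y in unit_leb. AE z in unit_leb. W y z = block_weight (c y) (c z)"
    by (rule block_structure)
  let ?D = "\<lambda>j. {x \<in> {0..1}. c x = j}"
  \<comment> \<open>In the standard graphon label 0 has measure \<open>a/2\<close>, hence the factor
    2. The disjoint set of label 2 takes measure \<open>1/2\<close>, which keeps \<open>a\<close> at
    most 1.\<close>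
  define a where "a = 2 * measure unit_leb (?D 0)"
  have "?D j \<in> sets unit_leb" for j
    using measurable_sets[OF c(1), of "{j}"] by (simp add: vimage_def Int_def conj_commute)
  then have "measure unit_leb (?D 0) + measure unit_leb (?D 2) = measure unit_leb (?D 0 \<union> ?D 2)"
    by (intro finite_measure_Union[symmetric]) auto
  also have "\<dots> \<le> 1" by (rule prob_le_1)
  finally have a: "a \<in> {0..1}" using c(3) by (simp add: a_def)
  have "represents (W_graphon 2 a) \<Gamma>"
    unfolding represents_def
  proof (intro conjI allI impI graphon_W_graphon_2[OF a])
    fix F :: "nat pair_pre_digraph" assume F: "pair_graph F"
    have "\<Gamma> F = graphon_density F W" using rep(1) F by (simp add: represents_def)
    also have "\<dots> = block_density F a"
      by (rule graphon_density_blocks[OF gW F c(1,2,4,3)]) (simp add: a_def)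
    also have "\<dots> = graphon_density F (W_graphon 2 a)"
      by (rule graphon_density_W_graphon_2[OF a F, symmetric])
    finally show "\<Gamma> F = graphon_density F (W_graphon 2 a)" .
  qed
  with a show "\<exists>a\<in>{0..1}. represents (W_graphon 2 a) \<Gamma>" ..
next
  assume "\<exists>a\<in>{0..1}. represents (W_graphon 2 a) \<Gamma>"
  then obtain a where a: "a \<in> {0..1}" "represents (W_graphon 2 a) \<Gamma>" ..
  have "\<Gamma> \<in> class_limits INC"
    using a(2) graphon_density_W_graphon_2[OF a(1)]
    by (intro W_graphon_2_class_limit[OF a(1)]) (simp add: represents_def)
  moreover have "has_entropy \<Gamma> (1/2)"
    using a(2) graphon_entropy_W_graphon_2[of a] unfolding has_entropy_def by blast
  ultimately show "\<Gamma> \<in> max_entropy_limits INC"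
    using INC_entropy_le unfolding max_entropy_limits_def by blast
qed

end
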